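(* Let $m\in\mathbb{N}$ and $F\in\mathcal{H}^m_\infty$. For $i=1,\dots,m$ let $\phi_i$ be convex, non-negative and increasing on $[0,\infty)$, and let $\varphi_i:\Omega\to\mathbb{R}$ be such that $\frac{\partial^{\boldsymbol 1}\varphi_i(\boldsymbol x)}{\Delta\boldsymbol x^{\boldsymbol 1}}$ is non-negative and $\frac{\partial^{k_j}\varphi_i(\boldsymbol x)}{\Delta_jx_j^{k_j}}\big|_{x_j=a_j}=0$ for $0\le k_j\le\lambda_j-1$, $j=1,\dots,n$. Then for any $f_i\in C^{n\boldsymbol\lambda}_{\rm rd}(\Omega)$ such that $\frac{\partial^{k_j}f_i(\boldsymbol x)}{\Delta_jx_j^{k_j}}\big|_{x_j=a_j}=0$ for all $0\le k_j\le\lambda_j-1$, $j=1,\dots,n$, $i=1,\dots,m$, we have $$\int_\Omega\left[\sum_{i=1}^mD_iF\left(\varphi_1(\boldsymbol x)\phi_1\left(\frac{|f_1(\boldsymbol x)|}{\varphi_1(\boldsymbol x)}\right),\dots,\varphi_m(\boldsymbol x)\phi_m\left(\frac{|f_m(\boldsymbol x)|}{\varphi_m(\boldsymbol x)}\right)\right)\frac{\partial^{\boldsymbol 1}\varphi_i(\boldsymbol x)}{\Delta\boldsymbol x^{\boldsymbol 1}}\,\phi_i\left(H_{\boldsymbol\lambda}(\boldsymbol b,\boldsymbol a)\frac{\left|\frac{\partial^{\boldsymbol\lambda}f_i(\boldsymbol x)}{\Delta\boldsymbol x^{\boldsymbol\lambda}}\right|}{\frac{\partial^{\boldsymbol 1}\varphi_i(\boldsymbol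 x)}{\Delta\boldsymbol x^{\boldsymbol 1}}}\right)\right]\Delta\boldsymbol x$$ $$\le F\left(\int_\Omega\frac{\partial^{\boldsymbol 1}\varphi_1(\boldsymbol x)}{\Delta\boldsymbol x^{\boldsymbol 1}}\phi_1\left(H_{\boldsymbol\lambda}(\boldsymbol b,\boldsymbol a)\frac{\left|\frac{\partial^{\boldsymbol\lambda}f_1(\boldsymbol x)}{\Delta\boldsymbol x^{\boldsymbol\lambda}}\right|}{\frac{\partial^{\boldsymbol 1}\varphi_1(\boldsymbol x)}{\Delta\boldsymbol x^{\boldsymbol 1}}}\right)\Delta\boldsymbol x,\dots,\int_\Omega\frac{\partial^{\boldsymbol 1}\varphi_m(\boldsymbol x)}{\Delta\boldsymbol x^{\boldsymbol 1}}\phi_m\left(H_{\boldsymbol\lambda}(\boldsymbol b,\boldsymbol a)\frac{\left|\frac{\partial^{\boldsymbol\lambda}f_m(\boldsymbol x)}{\Delta\boldsymbol x^{\boldsymbol\lambda}}\right|}{\frac{\partial^{\boldsymbol 1}\varphi_m(\boldsymbol x)}{\Delta\boldsymbol x^{\boldsymbol 1}}}\right)\Delta\boldsymbol x\right).$$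
   Context: Let $n\in\mathbb{N}$, let $\mathbb{T}_1,\dots,\mathbb{T}_n$ be time scales (nonempty closed subsets of $\mathbb{R}$) with forward and backward jump operators $\sigma_j,\rho_j$, and $\Lambda^n=\mathbb{T}_1\times\cdots\times\mathbb{T}_n$. Put $\rho_j^0(x_j)=x_j$ and $\rho_j^k=\rho_j\circ\rho_j^{k-1}$. Inequalities between vectors are componentwise ($\boldsymbol x<\boldsymbol y$ means $x_j<y_j$ for all $j$). $\boldsymbol\lambda=(\lambda_1,\dots,\lambda_n)$ is a multi-index with $\boldsymbol\lambda\ge\boldsymbol 1=(1,\dots,1)$; $\boldsymbol a,\boldsymbol b\in\Lambda^n$ satisfy $\boldsymbol a<\boldsymbol\rho^{\boldsymbol\lambda-\boldsymbol 1}(\boldsymbol b)=(\rho_1^{\lambda_1-1}(b_1),\dots,\rho_n^{\lambda_n-1}(b_n))$, and $\Omega=\{\boldsymbol x\in\Lambda^n:\boldsymbol a\le\boldsymbol x\le\boldsymbol b\}$. $\int_\Omega f\,\Delta\boldsymbol x$ is the $n$-fold iterated delta integral $\int_{a_1}^{b_1}\cdots\int_{a_n}^{b_n}f\,\Delta x_1\cdots\Delta x_n$. The partial delta derivative $\frac{\partial f(\boldsymbol x)}{\Delta_jx_j}$ is $\lim_{t_j\to x_j,\ t_j\ne\sigma_j(x_j)}\frac{f(x_1,\dots,\sigma_j(x_j),\dots,x_n)-f(x_1,\dots,t_j,\dots,x_n)}{\sigma_j(x_j)-t_j}$; higher-order ones are defined by iteration; $\frac{\partial^{\boldsymbol\lambda}f}{\Delta\boldsymbol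 x^{\boldsymbol\lambda}}=\frac{\partial^{\lambda_1+\cdots+\lambda_n}f}{\Delta_1x_1^{\lambda_1}\cdots\Delta_nx_n^{\lambda_n}}$. $C^{n\boldsymbol\lambda}_{\rm rd}(\Omega)$ is the set of $f:\Omega\to\mathbb{R}$ having rd-continuous derivatives $\frac{\partial^{k_1+\cdots+k_j}f}{\Delta_1x_1^{k_1}\cdots\Delta_jx_j^{k_j}}$ for $1\le k_j\le\lambda_j$, $j=1,\dots,n$. $H_{\boldsymbol\lambda}(\boldsymbol x,\boldsymbol t)=\prod_{j=1}^n h^{(j)}_{\lambda_j-1}(x_j,\sigma_j(t_j))$, where $h^{(j)}_0\equiv1$ and $h^{(j)}_{k+1}(t,s)=\int_s^th^{(j)}_k(u,s)\Delta u$ for $t,s\in\mathbb{T}_j$. $\mathcal{H}^m_\infty$ is the set of all functions $F:\mathbb{R}^m\to\mathbb{R}$ such that (1) $F\in C^1(\mathbb{R}^m)$; (2) $F(0,\dots,0)=0$; (3) for each $i=1,\dots,m$ the partial derivative $D_iF=\partial F/\partial t_i$ is non-negative and increasing in each variable on $(0,\infty)$ (arguments in $(0,\infty)^m$). "Increasing" means non-decreasing.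
   Formalization: Added: for each i, the λ-derivative of f_i vanishes at almost every x where the mixed derivative ∂^1 of varphi_i is 0 (otherwise the quotient is undefined; such 0/0 terms count as 0), and the m integrals on the right-hand side are assumed to exist and be finite. *)

theory Defs
  imports "HOL-Analysis.Analysis"
begin

section \<open>Time scales\<close>

definition time_scale :: "real set \<Rightarrow> bool" where
  "time_scale T \<longleftrightarrow> closed T \<and> T \<noteq> {}"

text \<open>The usual conventions \<open>inf {} = sup T\<close> and \<open>sup {} = inf T\<close> mean that the jump operators fix a
  maximum, respectively a minimum, of \<open>T\<close>. The value of \<open>fwd_jump T\<close> at points outside \<open>T\<close> is used
  only in \<open>delta_measure\<close>.\<close>

definition fwd_jump :: "real set \<Rightarrow> real \<Rightarrow> real" where
  "fwd_jump T t = (if \<exists>s\<in>T. t < s then Inf {s \<in> T. t < s} else t)"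

definition bwd_jump :: "real set \<Rightarrow> real \<Rightarrow> real" where
  "bwd_jump T t = (if \<exists>s\<in>T. s < t then Sup {s \<in> T. s < t} else t)"

definition right_dense :: "real set \<Rightarrow> real \<Rightarrow> bool" where
  "right_dense T t \<longleftrightarrow> t \<in> T \<and> (\<exists>s\<in>T. t < s) \<and> fwd_jump T t = t"

text \<open>\<open>T\<^sup>\<kappa>\<close>: \<open>T\<close> without its left-scattered maximum, if it has one.\<close>

definition kappa :: "real set \<Rightarrow> real set" where
  "kappa T = {t \<in> T. \<not> ((\<forall>s\<in>T. s \<le> t) \<and> bwd_jump T t < t)}"

subsection \<open>The delta integral\<close>

text \<open>The Lebesgue delta-measure, as the Lebesgue-Stieltjes measure of the forward jump operator; it
  assigns to \<open>[s, t) \<inter> T\<close> the mass \<open>t - s\<close> (lemma \<open>emeasure_delta_measure\<close> below). The integral is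
  the Lebesgue delta-integral, which agrees with the one defined by antiderivatives on rd-continuous
  functions.\<close>

definition delta_measure :: "real set \<Rightarrow> real measure" where
  "delta_measure T = interval_measure (fwd_jump T)"

lemma fwd_jump_less_le:
  assumes "s \<in> T" "u < s"
  shows "u \<le> fwd_jump T u" "fwd_jump T u \<le> s"
proof -
  have eq: "fwd_jump T u = Inf {r \<in> T. u < r}"
    using assms by (auto simp: fwd_jump_def)
  show "u \<le> fwd_jump T u"
    unfolding eq using assms by (intro cInf_greatest) auto
  show "fwd_jump T u \<le> s"
    unfolding eq using assms by (intro cInf_lower) (auto intro!: bdd_belowI[of _ u])
qed

lemma mono_fwd_jump:
  assumes "u \<le> v"
  shows "fwd_jump T u \<le> fwd_jump T v"
proof (cases "\<exists>s\<in>T. v < s")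
  case True
  have "fwd_jump T u = Inf {r \<in> T. u < r}" "fwd_jump T v = Inf {r \<in> T. v < r}"
    using True assms by (auto simp: fwd_jump_def)
  then show ?thesis
    using True assms by (auto intro!: cInf_superset_mono bdd_belowI[of _ u])
next
  case False
  then have v: "fwd_jump T v = v" by (auto simp: fwd_jump_def)
  show ?thesis
  proof (cases "\<exists>s\<in>T. u < s")
    case True
    then obtain s where s: "s \<in> T" "u < s" by blast
    with False have "s \<le> v" by force
    with fwd_jump_less_le(2)[OF s] v show ?thesis by simp
  next
    case False
    then have "fwd_jump T u = u" by (auto simp: fwd_jump_def)
    with v assms show ?thesis by simp
  qed
qed

lemma fwd_jump_right_cont: "continuous (at_right u) (fwd_jump T)"
  unfolding continuous_within
proof (rule order_tendstoI)
  fix c assume "c < fwd_jump T u"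
  then have "c < fwd_jump T v" if "u < v" for v
    using mono_fwd_jump[of u v T] that by linarith
  then show "eventually (\<lambda>v. c < fwd_jump T v) (at_right u)"
    by (auto simp: eventually_at_right_field intro!: exI[of _ "u + 1"])
next
  fix c assume c: "fwd_jump T u < c"
  have "\<exists>d>u. \<forall>v. u < v \<and> v < d \<longrightarrow> fwd_jump T v < c"
  proof (cases "\<exists>s\<in>T. u < s")
    case True
    then have "Inf {r \<in> T. u < r} < c"
      using c by (simp add: fwd_jump_def)
    then obtain r where r: "r \<in> T" "u < r" "r < c"
      using True cInf_lessD[of "{r \<in> T. u < r}" c] by blast
    have "fwd_jump T v < c" if "v < r" for v
      using fwd_jump_less_le(2)[OF r(1) that] r(3) by linarith
    with r(2) show ?thesis by blast
  next
    case False
    then have "fwd_jump T v = v" if "u \<le> v" for v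
      using that by (force simp: fwd_jump_def)
    with c show ?thesis by (intro exI[of _ c]) auto
  qed
  then show "eventually (\<lambda>v. fwd_jump T v < c) (at_right u)"
    by (auto simp: eventually_at_right_field)
qed

lemma sets_delta_measure [simp, measurable_cong]: "sets (delta_measure T) = sets borel"
  by (simp add: delta_measure_def)

lemma emeasure_delta_measure_Ioc:
  "u \<le> v \<Longrightarrow> emeasure (delta_measure T) {u<..v} = fwd_jump T v - fwd_jump T u"
  unfolding delta_measure_def
  by (intro emeasure_interval_measure_Ioc mono_fwd_jump fwd_jump_right_cont)

lemma emeasure_delta_measure_Ioo:
  assumes "s \<in> T" "u < s"
  shows "emeasure (delta_measure T) {u<..<s} = s - fwd_jump T u"
proof -
  define d where "d n = s - (s - u) / real (Suc n)" for n
  have d: "u \<le> d n" "d n < s" for n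
    using assms mult_right_mono[of u s "real n"] by (auto simp: d_def field_simps)
  have d_mono: "incseq d"
    using assms by (auto simp: incseq_def d_def intro!: divide_left_mono)
  have d_lim: "d \<longlonglongrightarrow> s"
  proof -
    have "(\<lambda>n. s - (s - u) * inverse (real (Suc n))) \<longlonglongrightarrow> s - (s - u) * 0"
      by (intro tendsto_intros LIMSEQ_inverse_real_of_nat)
    then show ?thesis by (simp add: d_def[abs_def] divide_inverse)
  qed
  have Un: "(\<Union>n. {u<..d n}) = {u<..<s}"
  proof (intro equalityI subsetI)
    fix x assume "x \<in> {u<..<s}"
    moreover from this have "eventually (\<lambda>n. x < d n) sequentially"
      using order_tendstoD(1)[OF d_lim] by simp
    ultimately show "x \<in> (\<Union>n. {u<..d n})"
      by (auto simp: eventually_sequentially intro: less_imp_le)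
  qed (use d in \<open>auto intro: le_less_trans\<close>)
  have inc: "incseq (\<lambda>n. {u<..d n})"
    using d_mono by (fastforce simp: incseq_def intro: order_trans)
  have "(\<lambda>n. emeasure (delta_measure T) {u<..d n}) \<longlonglongrightarrow> emeasure (delta_measure T) {u<..<s}"
    using Lim_emeasure_incseq[OF _ inc, of "delta_measure T"] by (simp add: Un image_subset_iff)
  moreover have "(\<lambda>n. emeasure (delta_measure T) {u<..d n}) \<longlonglongrightarrow> ennreal (s - fwd_jump T u)"
  proof -
    have "(\<lambda>n. fwd_jump T (d n)) \<longlonglongrightarrow> s"
      by (rule tendsto_sandwich[OF _ _ d_lim tendsto_const])
        (use fwd_jump_less_le[OF assms(1) d(2)] in auto)
    then have "(\<lambda>n. ennreal (fwd_jump T (d n) - fwd_jump T u)) \<longlonglongrightarrow> ennreal (s - fwd_jump T u)"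
      by (intro tendsto_intros)
    then show ?thesis by (simp add: emeasure_delta_measure_Ioc d)
  qed
  ultimately show ?thesis by (rule LIMSEQ_unique)
qed

lemma emeasure_delta_measure:
  assumes T: "time_scale T" and s: "s \<in> T" and t: "t \<in> T" and le: "s \<le> t"
  shows "emeasure (delta_measure T) (T \<inter> {s..<t}) = t - s"
proof -
  let ?M = "delta_measure T" and ?u = "s - 1"
  have cl: "closed T" using T by (simp add: time_scale_def)
  have meas: "T \<in> sets borel" using cl by (rule borel_closed)
  have F: "fwd_jump T ?u \<le> s" using fwd_jump_less_le(2)[OF s, of ?u] by simp
  have "emeasure ?M {s..<t} = emeasure ?M ({?u<..<t} - {?u<..<s})"
    using le by (intro arg_cong[of _ _ "emeasure ?M"]) auto
  also have "\<dots> = emeasure ?M {?u<..<t} - emeasure ?M {?u<..<s}"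
    using le emeasure_delta_measure_Ioo[OF s, of ?u] by (intro emeasure_Diff) auto
  also have "\<dots> = t - s"
    using le F emeasure_delta_measure_Ioo[OF s, of ?u] emeasure_delta_measure_Ioo[OF t, of ?u]
    by (simp add: ennreal_minus)
  finally have 1: "emeasure ?M {s..<t} = t - s" .
  let ?Q = "{(p, q). p \<in> \<rat> \<and> q \<in> \<rat> \<and> p \<le> q \<and> q < t \<and> {p..q} \<inter> T = {}}"
  have "countable ?Q"
    by (rule countable_subset[of _ "\<rat> \<times> \<rat>"]) (auto intro: countable_rat)
  moreover have "{p<..q} \<in> null_sets ?M" if "(p, q) \<in> ?Q" for p q
  proof -
    have "r \<notin> {p..q}" if "r \<in> T" for r
      using that \<open>(p, q) \<in> ?Q\<close> by blast
    then have "{r \<in> T. p < r} = {r \<in> T. q < r}"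
      using \<open>(p, q) \<in> ?Q\<close> by force
    then have "fwd_jump T p = fwd_jump T q"
      using that t by (auto simp: fwd_jump_def)
    then show ?thesis
      using that by (auto simp: null_sets_def emeasure_delta_measure_Ioc)
  qed
  ultimately have N: "(\<Union>(p, q)\<in>?Q. {p<..q}) \<in> null_sets ?M"
    by (intro null_sets_UN') auto
  have "{s..<t} - T \<subseteq> (\<Union>(p, q)\<in>?Q. {p<..q})"
  proof
    fix x assume x: "x \<in> {s..<t} - T"
    then have "open (- T \<inter> {..<t})" "x \<in> - T \<inter> {..<t}"
      using cl by auto
    then obtain e where e: "e > 0" "ball x e \<subseteq> - T \<inter> {..<t}"
      by (meson open_contains_ball)
    obtain p where p: "p \<in> \<rat>" "x - e < p" "p < x"
      using Rats_dense_in_real[of "x - e" x] e(1) by auto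
    obtain q where q: "q \<in> \<rat>" "x < q" "q < x + e"
      using Rats_dense_in_real[of x "x + e"] e(1) by auto
    have "{p..q} \<subseteq> ball x e"
      using p q by (auto simp: dist_real_def)
    with e(2) have sub: "{p..q} \<subseteq> - T \<inter> {..<t}" by blast
    from p q have "q \<in> {p..q}" by simp
    with sub have "q < t" by blast
    with sub have "(p, q) \<in> ?Q" using p q by auto
    then show "x \<in> (\<Union>(p, q)\<in>?Q. {p<..q})" using p q by force
  qed
  then have "{s..<t} - T \<in> null_sets ?M"
    using N meas by (intro null_sets_subset[OF N]) auto
  then have "emeasure ?M ({s..<t} - ({s..<t} - T)) = emeasure ?M {s..<t}"
    by (intro emeasure_Diff_null_set) auto
  moreover have "{s..<t} - ({s..<t} - T) = T \<inter> {s..<t}" by auto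
  ultimately show ?thesis using 1 by simp
qed

definition delta_integral :: "real set \<Rightarrow> real \<Rightarrow> real \<Rightarrow> (real \<Rightarrow> real) \<Rightarrow> real" where
  "delta_integral T s t f =
    (if s \<le> t then LINT u:T \<inter> {s..<t}|delta_measure T. f u
     else - (LINT u:T \<inter> {t..<s}|delta_measure T. f u))"

primrec h_mono :: "real set \<Rightarrow> nat \<Rightarrow> real \<Rightarrow> real \<Rightarrow> real" where
  "h_mono T 0 t s = 1"
| "h_mono T (Suc k) t s = delta_integral T s t (\<lambda>u. h_mono T k u s)"

section \<open>Several variables\<close>

text \<open>A point of \<open>\<Lambda>\<^sup>n\<close> is a function on the index set \<open>{1..n}\<close>, extended by \<open>undefined\<close>.\<close>

definition ts_box :: "nat \<Rightarrow> (nat \<Rightarrow> real set) \<Rightarrow> (nat \<Rightarrow> real) \<Rightarrow> (nat \<Rightarrow> real) \<Rightarrow> (nat \<Rightarrow> real) set" where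
  "ts_box n T a b = (\<Pi>\<^sub>E j\<in>{1..n}. T j \<inter> {a j..b j})"

text \<open>The outermost integration variable is \<open>x\<^sub>1\<close>, the innermost one \<open>x\<^sub>n\<close>.\<close>

primrec iter_integral ::
  "(nat \<Rightarrow> real set) \<Rightarrow> (nat \<Rightarrow> real) \<Rightarrow> (nat \<Rightarrow> real) \<Rightarrow> nat \<Rightarrow> ((nat \<Rightarrow> real) \<Rightarrow> real) \<Rightarrow> real" where
  "iter_integral T a b 0 f = f (\<lambda>_. undefined)"
| "iter_integral T a b (Suc n) f =
    iter_integral T a b n
      (\<lambda>x. delta_integral (T (Suc n)) (a (Suc n)) (b (Suc n)) (\<lambda>t. f (x(Suc n := t))))"

text \<open>The product delta-measure on \<open>\<Omega>\<close>. As for the integral in one variable, the right end points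
  \<open>x\<^sub>j = b\<^sub>j\<close> carry no mass.\<close>

definition box_measure ::
  "nat \<Rightarrow> (nat \<Rightarrow> real set) \<Rightarrow> (nat \<Rightarrow> real) \<Rightarrow> (nat \<Rightarrow> real) \<Rightarrow> (nat \<Rightarrow> real) measure" where
  "box_measure n T a b =
    PiM {1..n} (\<lambda>j. restrict_space (delta_measure (T j)) (T j \<inter> {a j..<b j}))"

definition H_mono ::
  "nat \<Rightarrow> (nat \<Rightarrow> real set) \<Rightarrow> (nat \<Rightarrow> nat) \<Rightarrow> (nat \<Rightarrow> real) \<Rightarrow> (nat \<Rightarrow> real) \<Rightarrow> real" where
  "H_mono n T lam x t = (\<Prod>j=1..n. h_mono (T j) (lam j - 1) (x j) (fwd_jump (T j) (t j)))"

subsection \<open>Partial delta derivatives\<close>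

text \<open>The filter of \<open>t \<rightarrow> s\<close>, \<open>t \<in> S\<close>, \<open>t \<noteq> \<sigma>(s)\<close>. The value \<open>t = s\<close> is allowed if \<open>s\<close> is
  right-scattered. The filter is trivial exactly if \<open>s \<notin> S\<^sup>\<kappa>\<close> or \<open>S = {s}\<close>.\<close>

definition delta_at :: "real set \<Rightarrow> real \<Rightarrow> real filter" where
  "delta_at S s = inf (nhds s) (principal (S - {fwd_jump S s}))"

definition pd_quot :: "real set \<Rightarrow> nat \<Rightarrow> ((nat \<Rightarrow> real) \<Rightarrow> real) \<Rightarrow> (nat \<Rightarrow> real) \<Rightarrow> real \<Rightarrow> real" where
  "pd_quot S j f x t =
    (f (x(j := fwd_jump S (x j))) - f (x(j := t))) / (fwd_jump S (x j) - t)"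

definition has_pd :: "real set \<Rightarrow> nat \<Rightarrow> ((nat \<Rightarrow> real) \<Rightarrow> real) \<Rightarrow> (nat \<Rightarrow> real) \<Rightarrow> real \<Rightarrow> bool" where
  "has_pd S j f x l \<longleftrightarrow> (pd_quot S j f x \<longlongrightarrow> l) (delta_at S (x j))"

text \<open>Where \<open>x\<^sub>j \<notin> S\<^sup>\<kappa>\<close> there is no derivative to speak of; it is then given the value 0, and
  existence (\<open>has_pd\<close>) is no condition at such a point.\<close>

definition pd :: "real set \<Rightarrow> nat \<Rightarrow> ((nat \<Rightarrow> real) \<Rightarrow> real) \<Rightarrow> (nat \<Rightarrow> real) \<Rightarrow> real" where
  "pd S j f x =
    (if delta_at S (x j) = bot then 0 else Lim (delta_at S (x j)) (pd_quot S j f x))"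

text \<open>A \<open>k\<close>-th derivative is a function on \<open>T\<close> with \<open>\<kappa>\<close> applied \<open>k\<close> times; the next one is its
  derivative on that time scale. This differs from iterating on \<open>T\<close> itself only if \<open>T\<close> has a
  left-scattered maximum.\<close>

primrec pd_iter ::
  "real set \<Rightarrow> nat \<Rightarrow> nat \<Rightarrow> ((nat \<Rightarrow> real) \<Rightarrow> real) \<Rightarrow> (nat \<Rightarrow> real) \<Rightarrow> real" where
  "pd_iter T j 0 f = f"
| "pd_iter T j (Suc k) f = pd ((kappa ^^ k) T) j (pd_iter T j k f)"

text \<open>\<open>mixed_pd T k j f\<close> is the derivative of order \<open>k\<^sub>1 + \<dots> + k\<^sub>j\<close> of \<open>f\<close>, of order \<open>k\<^sub>i\<close> in
  \<open>x\<^sub>i\<close> for \<open>i \<le> j\<close>. The differentiations in \<open>x\<^sub>1\<close> come first, then those in \<open>x\<^sub>2\<close>, and so on: in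
  this order all intermediate derivatives are among those required in \<open>C_rd\<close>.\<close>

primrec mixed_pd ::
  "(nat \<Rightarrow> real set) \<Rightarrow> (nat \<Rightarrow> nat) \<Rightarrow> nat \<Rightarrow> ((nat \<Rightarrow> real) \<Rightarrow> real) \<Rightarrow> (nat \<Rightarrow> real) \<Rightarrow> real" where
  "mixed_pd T k 0 f = f"
| "mixed_pd T k (Suc j) f = pd_iter (T (Suc j)) (Suc j) (k (Suc j)) (mixed_pd T k j f)"

definition mixed_pd_exists ::
  "(nat \<Rightarrow> real set) \<Rightarrow> (nat \<Rightarrow> real) set \<Rightarrow> (nat \<Rightarrow> nat) \<Rightarrow> nat \<Rightarrow> ((nat \<Rightarrow> real) \<Rightarrow> real) \<Rightarrow> bool" where
  "mixed_pd_exists T X k j f \<longleftrightarrow>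
    (\<forall>i\<in>{1..j}. \<forall>r<k i. \<forall>x\<in>X. \<exists>l.
      has_pd ((kappa ^^ r) (T i)) i (pd_iter (T i) i r (mixed_pd T k (i - 1) f)) x l)"

text \<open>All derivatives of \<open>f\<close> in \<open>x\<^sub>j\<close> of orders \<open>0, \<dots>, \<lambda>\<^sub>j - 1\<close> exist and vanish where
  \<open>x\<^sub>j = a\<^sub>j\<close>.\<close>

definition vanishes_at_start ::
  "nat \<Rightarrow> (nat \<Rightarrow> real set) \<Rightarrow> (nat \<Rightarrow> real) \<Rightarrow> (nat \<Rightarrow> real) \<Rightarrow> (nat \<Rightarrow> nat)
    \<Rightarrow> ((nat \<Rightarrow> real) \<Rightarrow> real) \<Rightarrow> bool" where
  "vanishes_at_start n T a b lam f \<longleftrightarrow>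
    (\<forall>j\<in>{1..n}. \<forall>x\<in>ts_box n T a b. x j = a j \<longrightarrow>
      (\<forall>k<lam j - 1. \<exists>l. has_pd ((kappa ^^ k) (T j)) j (pd_iter (T j) j k f) x l) \<and>
      (\<forall>k\<le>lam j - 1. pd_iter (T j) j k f x = 0))"

text \<open>Joint rd-continuity on a set \<open>X\<close> of points: finite limits from every orthant exist, and the limit
  is the value of \<open>f\<close> if all coordinates that approach from the left are right-dense. Only left-dense
  coordinates can approach from the left (otherwise the filter is trivial), so that for
  \<open>n = 1\<close> this says: continuous at right-dense points, with finite left limits at left-dense points.\<close>

definition rd_continuous ::
  "nat \<Rightarrow> (nat \<Rightarrow> real set) \<Rightarrow> (nat \<Rightarrow> real) set \<Rightarrow> ((nat \<Rightarrow> real) \<Rightarrow> real) \<Rightarrow> bool" where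
  "rd_continuous n T X f \<longleftrightarrow>
    (\<forall>x\<in>X. \<forall>L\<subseteq>{1..n}. \<exists>l.
      (f \<longlongrightarrow> l) (at x within {t\<in>X. \<forall>j\<in>{1..n}. if j \<in> L then t j < x j else x j \<le> t j}) \<and>
      ((\<forall>j\<in>L. right_dense (T j) (x j)) \<longrightarrow> l = f x))"

text \<open>Derivatives at points of \<open>\<Omega>\<close> are those of a function on \<open>\<Lambda>\<^sup>n\<close>, since they may involve
  \<open>\<sigma>\<^sub>j(x\<^sub>j) > b\<^sub>j\<close>. A function given on \<open>\<Omega>\<close> only is the case in which \<open>T\<^sub>j\<close> is contained in
  \<open>[a\<^sub>j, b\<^sub>j]\<close>.\<close>

definition C_rd ::
  "nat \<Rightarrow> (nat \<Rightarrow> real set) \<Rightarrow> (nat \<Rightarrow> real) \<Rightarrow> (nat \<Rightarrow> real) \<Rightarrow> (nat \<Rightarrow> nat)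
    \<Rightarrow> ((nat \<Rightarrow> real) \<Rightarrow> real) set" where
  "C_rd n T a b lam =
    {f. \<forall>j\<in>{1..n}. \<forall>k. (\<forall>i\<in>{1..j}. 1 \<le> k i \<and> k i \<le> lam i) \<longrightarrow>
      mixed_pd_exists T (ts_box n T a b) k j f \<and> rd_continuous n T (ts_box n T a b) (mixed_pd T k j f)}"

section \<open>The class \<open>\<H>\<^sup>m\<^sub>\<infinity>\<close>\<close>

definition partial :: "'m::finite \<Rightarrow> (real ^ 'm \<Rightarrow> real) \<Rightarrow> real ^ 'm \<Rightarrow> real" where
  "partial i F y = frechet_derivative F (at y) (axis i 1)"

definition C1_fun :: "(real ^ 'm::finite \<Rightarrow> real) \<Rightarrow> bool" where
  "C1_fun F \<longleftrightarrow> (\<forall>y. F differentiable (at y)) \<and> (\<forall>i. continuous_on UNIV (partial i F))"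

definition H_infty :: "(real ^ 'm::finite \<Rightarrow> real) set" where
  "H_infty = {F. C1_fun F \<and> F 0 = 0 \<and>
    (\<forall>i y. (\<forall>l. 0 < y $ l) \<longrightarrow>
      0 \<le> partial i F y \<and>
      (\<forall>k. mono_on {0<..} (\<lambda>t. partial i F (\<chi> l. if l = k then t else y $ l))))}"

end

theory Submission
  imports Defs
begin

text \<open>Write \<open>G\<^sub>i\<close> for the integrand on the right-hand side and \<open>H\<close> for \<open>H\<^sub>\<lambda>(b, a)\<close>. Taylor's formula
  in each variable expresses \<open>f\<^sub>i\<close> as an iterated primitive of \<open>\<partial>\<^sup>\<lambda>f\<^sub>i\<close>, so
  that \<open>|f\<^sub>i(x)| \<le> H \<integral>\<^bsub>[a,x)\<^esub> |\<partial>\<^sup>\<lambda>f\<^sub>i|\<close>, while \<open>\<phi>\<^sub>i(x) = \<integral>\<^bsub>[a,x)\<^esub> \<partial>\<^sup>1\<phi>\<^sub>i\<close>. Jensen's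
  inequality gives \<open>\<phi>\<^sub>i(x) p\<^sub>i(|f\<^sub>i(x)| / \<phi>\<^sub>i(x)) \<le> \<integral>\<^bsub>[a,x)\<^esub> G\<^sub>i \<le> m\<^sub>i(x\<^sub>1)\<close>, where \<open>m\<^sub>i(t)\<close> is the
  integral of \<open>G\<^sub>i\<close> over \<open>{y. y\<^sub>1 < t}\<close>. As the partial derivatives of \<open>F\<close> are non-negative and
  increasing, the left-hand side is at most \<open>\<integral> \<Sum>\<^sub>i D\<^sub>iF(m(y\<^sub>1)) G\<^sub>i(y)\<close>. This is a
  Stieltjes integral in the single variable \<open>y\<^sub>1\<close>, and its lower sums telescope below \<open>F(m(b\<^sub>1))\<close>.

  No regularity of \<open>\<partial>\<^sup>1\<phi>\<^sub>i\<close> beyond its existence is available. The fundamental theorem of calculus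
  is therefore derived from the Henstock-Kurzweil integral, and \<open>\<partial>\<^sup>1\<phi>\<^sub>i\<close> is only integrated one
  variable at a time.\<close>

section \<open>The fundamental theorem of calculus with countably many exceptions\<close>

text \<open>Why one coordinate: in several variables no chain rule turns \<open>F\<close> of an
  n-fold primitive into exactly the sum on the left. Enlarging \<open>[a,x)\<close> to
  \<open>{y. y 1 < x 1}\<close> only increases the integrals of the non-negative \<open>G i\<close>,
  and the remaining problem is monotone and one-dimensional. The obstacle at the right end: a k-th
  derivative lives on \<open>(kappa ^^ k) T\<close>, so near \<open>b j\<close> the value of
  \<open>pd_iter\<close> may be a mere default. This is harmless because k nested primitives at
  \<open>x\<close> see their integrand only up to the k-fold backward jump of \<open>x j\<close>;
  and \<open>a j\<close> lies below that of \<open>b j\<close> for k up to \<open>lam j - 1\<close>,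
  so the derivatives at \<open>a j\<close> are genuine limits. The forward jump inside
  \<open>H_mono\<close> appears because a primitive vanishes at \<open>a j\<close> and
  \<open>[a j, fwd_jump (T j) (a j))\<close> contains no further point of \<open>T j\<close>, so the
  next integration may start at the jump. Quotients by zero are 0. If phi vanishes at
  \<open>x\<close>, its factor makes the Jensen term 0; where the mixed derivative of phi vanishes,
  so does \<open>G\<close>, and the supporting-line estimate then requires the derivative of f to
  vanish too, which holds almost everywhere by hypothesis.\<close>

text \<open>At the \<open>n\<close>-th exceptional point continuity allows an error of order \<open>2\<^sup>-\<^sup>n\<close>. The jumps of the
  function \<open>B\<close> account for these errors additively over a tagged division.\<close>

lemma ftc_countable_exceptions:
  fixes f f' :: "real \<Rightarrow> real"
  assumes ab: "a \<le> b" and C: "countable C" and cont: "continuous_on {a..b} f"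
    and deriv: "\<And>x. x \<in> {a..b} - C \<Longrightarrow> (f has_real_derivative f' x) (at x within {a..b})"
  shows "(f' has_integral (f b - f a)) {a..b}"
proof (cases "a = b")
  case True
  then show ?thesis using has_integral_refl(2)[of f' b] by simp
next
  case False
  with ab have ab': "a < b" by simp
  obtain c :: "nat \<Rightarrow> real" where c: "C \<subseteq> range c"
    using C subset_range_from_nat_into by blast
  then obtain m where m: "\<And>x. x \<in> C \<Longrightarrow> c (m x) = x"
    by (metis (no_types) f_inv_into_f subsetD)
  \<comment> \<open>Each exceptional point contributes one jump just before and one just after
    itself. Thus \<open>B\<close> grows by at least \<open>(1/2)^k\<close> over every nondegenerate
    \<open>[u,v]\<close> containing \<open>c k\<close>, also when \<open>c k\<close> is an end
    point, and the total growth is at most 4.\<close>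
  define B where "B s = (\<Sum>n. (1/2::real)^n * (of_bool (c n < s) + of_bool (c n \<le> s)))" for s
  have sm: "summable (\<lambda>n. (1/2::real)^n * (of_bool (c n < s) + of_bool (c n \<le> s)))" for s
    by (rule summable_comparison_test'[where g = "\<lambda>n. 2 * (1/2::real)^n"])
      (auto intro!: summable_mult)
  have B0: "0 \<le> B s" for s
    unfolding B_def by (rule suminf_nonneg[OF sm]) auto
  have B4: "B s \<le> 4" for s
  proof -
    have "B s \<le> (\<Sum>n. 2 * (1/2::real)^n)"
      unfolding B_def by (rule suminf_le[OF _ sm]) (auto intro!: summable_mult)
    also have "\<dots> = 4" by (subst suminf_mult) (auto simp: suminf_geometric)
    finally show ?thesis .
  qed
  have Bmono: "B u \<le> B v" if "u \<le> v" for u v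
    unfolding B_def using that by (intro suminf_le[OF _ sm sm] mult_left_mono add_mono) auto
  have Bjump: "(1/2)^k \<le> B v - B u" if "u < v" "u \<le> c k" "c k \<le> v" for u v k
  proof -
    let ?g = "\<lambda>n. (1/2::real)^n * (of_bool (c n < v) + of_bool (c n \<le> v))
       - (1/2::real)^n * (of_bool (c n < u) + of_bool (c n \<le> u))"
    have g0: "0 \<le> ?g n" for n
      unfolding right_diff_distrib[symmetric] using that(1) by (intro mult_nonneg_nonneg) auto
    have "(1/2::real)^k \<le> ?g k"
      using that by (cases "c k = v"; cases "c k = u") auto
    also have "\<dots> = (\<Sum>n\<in>{k}. ?g n)" by simp
    also have "\<dots> \<le> suminf ?g"
      using g0 by (intro sum_le_suminf summable_diff sm) auto
    also have "\<dots> = B v - B u"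
      unfolding B_def by (rule suminf_diff[OF sm sm, symmetric])
    finally show ?thesis .
  qed
  show ?thesis
    unfolding has_integral_factor_content_real
  proof (intro allI impI)
    fix e :: real assume e: "e > 0"
    \<comment> \<open>The total growth 4 of \<open>B\<close> turns this into
      \<open>e/2 * (b - a)\<close>, the half of the error left over by the differentiable
      points.\<close>
    define \<eta> where "\<eta> = e * (b - a) / 8"
    have \<eta>: "\<eta> > 0" using e ab' by (simp add: \<eta>_def)
    define E where "E x u v = (if x \<in> C then \<eta> * (1/2) ^ m x else e / 2 * (v - u))" for x u v
    have "\<exists>d>0. x \<in> {a..b} \<longrightarrow> (\<forall>u\<in>{a..b}. \<forall>v\<in>{a..b}. u \<le> x \<longrightarrow> x \<le> v \<longrightarrow> \<bar>u - x\<bar> < d \<longrightarrow> \<bar>v - x\<bar> < d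
        \<longrightarrow> \<bar>(v - u) * f' x - (f v - f u)\<bar> \<le> E x u v)" for x
    proof (cases "x \<in> {a..b}")
      case x: True
      show ?thesis
      proof (cases "x \<in> C")
        case True
        define z where "z = \<eta> * (1/2) ^ m x"
        have z: "z > 0" using \<eta> by (simp add: z_def)
        obtain d1 where d1: "d1 > 0" "\<And>y. y \<in> {a..b} \<Longrightarrow> \<bar>y - x\<bar> < d1 \<Longrightarrow> \<bar>f y - f x\<bar> < z / 4"
          using cont x z unfolding continuous_on_iff dist_real_def by (metis zero_less_divide_iff zero_less_numeral)
        \<comment> \<open>The value \<open>f' x\<close> is arbitrary at an exceptional point. The
          second bound makes \<open>(v - u) * f' x\<close> at most \<open>z/2\<close>, as
          \<open>v - u\<close> is at most \<open>2 * d\<close>; the two increments of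
          \<open>f\<close> use up the other half.\<close>
        define d where "d = min d1 (z / (4 * (\<bar>f' x\<bar> + 1)))"
        have d: "d > 0" using d1 z by (simp add: d_def add_nonneg_pos)
        have "\<bar>(v - u) * f' x - (f v - f u)\<bar> \<le> z"
          if "u \<in> {a..b}" "v \<in> {a..b}" "u \<le> x" "x \<le> v" "\<bar>u - x\<bar> < d" "\<bar>v - x\<bar> < d" for u v
        proof -
          have "\<bar>f v - f x\<bar> < z / 4" "\<bar>f u - f x\<bar> < z / 4"
            using that d1(2)[of u] d1(2)[of v] by (auto simp: d_def)
          moreover have "\<bar>(v - u) * f' x\<bar> \<le> z / 2"
          proof -
            have "\<bar>(v - u) * f' x\<bar> \<le> (2 * d) * (\<bar>f' x\<bar> + 1)"
              unfolding abs_mult using that by (intro mult_mono) auto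
            also have "\<dots> \<le> (2 * (z / (4 * (\<bar>f' x\<bar> + 1)))) * (\<bar>f' x\<bar> + 1)"
              by (intro mult_right_mono) (auto simp: d_def)
            also have "\<dots> = z / 2" by (simp add: add_nonneg_pos divide_simps)
            finally show ?thesis .
          qed
          ultimately show ?thesis by linarith
        qed
        then show ?thesis using d True unfolding E_def z_def by auto
      next
        case False
        then have "(f has_derivative (*) (f' x)) (at x within {a..b})"
          using deriv x by (simp add: has_field_derivative_def)
        then obtain d where d: "d > 0" "\<And>y. y \<in> {a..b} \<Longrightarrow> \<bar>y - x\<bar> < d \<Longrightarrow>
            \<bar>f y - f x - f' x * (y - x)\<bar> \<le> e / 2 * \<bar>y - x\<bar>"
          using e unfolding has_derivative_within_alt real_norm_def by (meson half_gt_zero)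
        \<comment> \<open>Because the tag lies between \<open>u\<close> and \<open>v\<close>, the
          distances from it add up to \<open>v - u\<close>, and so do the two linear errors.\<close>
        have "\<bar>(v - u) * f' x - (f v - f u)\<bar> \<le> e / 2 * (v - u)"
          if "u \<in> {a..b}" "v \<in> {a..b}" "u \<le> x" "x \<le> v" "\<bar>u - x\<bar> < d" "\<bar>v - x\<bar> < d" for u v
          using d(2)[of u] d(2)[of v] that by (simp add: abs_if algebra_simps split: if_splits)
        then show ?thesis using d(1) False unfolding E_def by auto
      qed
    qed (auto intro: exI[of _ 1])
    then obtain d where d: "\<And>x. d x > 0" "\<And>x u v. x \<in> {a..b} \<Longrightarrow> u \<in> {a..b} \<Longrightarrow> v \<in> {a..b} \<Longrightarrow> u \<le> x \<Longrightarrow> x \<le> v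
       \<Longrightarrow> \<bar>u - x\<bar> < d x \<Longrightarrow> \<bar>v - x\<bar> < d x \<Longrightarrow> \<bar>(v - u) * f' x - (f v - f u)\<bar> \<le> E x u v"
      by metis
    show "\<exists>\<gamma>. gauge \<gamma> \<and> (\<forall>p. p tagged_division_of {a..b} \<and> \<gamma> fine p \<longrightarrow>
      norm ((\<Sum>(x, k)\<in>p. measure lborel k *\<^sub>R f' x) - (f b - f a)) \<le> e * measure lborel {a..b})"
    proof (intro exI[of _ "\<lambda>x. ball x (d x)"] conjI allI impI)
      show "gauge (\<lambda>x. ball x (d x))" using d(1) gauge_ball_dependent by blast
      fix p assume "p tagged_division_of {a..b} \<and> (\<lambda>x. ball x (d x)) fine p"
      then have p: "p tagged_division_of {a..b}" and fine: "(\<lambda>x. ball x (d x)) fine p" by auto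
      note add = additive_tagged_division_1[OF ab p]
      let ?R = "\<lambda>K. e / 2 * (Sup K - Inf K) + \<eta> * (B (Sup K) - B (Inf K))"
      have "norm ((\<Sum>(x, k)\<in>p. measure lborel k *\<^sub>R f' x) - (f b - f a))
        = norm (\<Sum>(x, K)\<in>p. measure lborel K *\<^sub>R f' x - (f (Sup K) - f (Inf K)))"
        using add[of f] by (simp add: split_def sum_subtractf)
      also have "\<dots> \<le> (\<Sum>(x, K)\<in>p. ?R K)"
      proof (rule sum_norm_le, clarify)
        fix x K assume xK: "(x, K) \<in> p"
        then obtain u v where K: "K = {u..v}" using p by (metis box_real(2) tagged_division_ofD(4))
        have xin: "x \<in> K" and sub: "K \<subseteq> {a..b}" using p xK by (meson tagged_division_ofD)+
        then have uxv: "u \<le> x" "x \<le> v" "u \<le> v" and in': "x \<in> {a..b}" "u \<in> {a..b}" "v \<in> {a..b}" using K by auto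
        have "K \<subseteq> ball x (d x)" using fine xK by (auto simp: fine_def)
        then have "\<bar>u - x\<bar> < d x" "\<bar>v - x\<bar> < d x"
          using subsetD[of K "ball x (d x)" u] subsetD[of K "ball x (d x)" v] uxv K by (auto simp: dist_real_def)
        then have *: "\<bar>(v - u) * f' x - (f v - f u)\<bar> \<le> E x u v"
          using d(2) in' uxv by blast
        have "\<bar>(v - u) * f' x - (f v - f u)\<bar> \<le> e / 2 * (v - u) + \<eta> * (B v - B u)"
        proof (cases "u = v")
          case False
          then have uv: "u < v" using uxv by simp
          show ?thesis
          proof (cases "x \<in> C")
            case True
            have "(1/2) ^ m x \<le> B v - B u" using Bjump[OF uv, of "m x"] m[OF True] uxv by auto
            then have "\<eta> * (1/2) ^ m x \<le> \<eta> * (B v - B u)" using \<eta> by (intro mult_left_mono) auto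
            moreover have "0 \<le> e / 2 * (v - u)" using e uv by simp
            ultimately show ?thesis using * True by (simp add: E_def)
          next
            case False
            have "0 \<le> \<eta> * (B v - B u)" using \<eta> Bmono[of u v] uv by auto
            then show ?thesis using * False by (simp add: E_def)
          qed
        qed simp
        then show "norm (measure lborel K *\<^sub>R f' x - (f (Sup K) - f (Inf K))) \<le> ?R K"
          using K uxv by simp
      qed
      also have "\<dots> = e / 2 * (\<Sum>(x, K)\<in>p. Sup K - Inf K) + \<eta> * (\<Sum>(x, K)\<in>p. B (Sup K) - B (Inf K))"
        by (simp add: split_def sum.distrib sum_distrib_left)
      also have "\<dots> = e / 2 * (b - a) + \<eta> * (B b - B a)"
        using add[of "\<lambda>x. x"] add[of B] by simp
      also have "\<dots> \<le> e / 2 * (b - a) + \<eta> * 4"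
        using B0[of a] B4[of b] \<eta> by (intro add_left_mono mult_left_mono) auto
      also have "\<dots> = e * measure lborel {a..b}" using ab by (simp add: \<eta>_def field_simps)
      finally show "norm ((\<Sum>(x, k)\<in>p. measure lborel k *\<^sub>R f' x) - (f b - f a)) \<le> e * measure lborel {a..b}" .
    qed
  qed
qed

section \<open>Delta calculus in one variable\<close>

text \<open>On a gap of \<open>T\<close> this is constantly the left end point, the point whose
  delta derivative is the slope across the gap.\<close>

definition ts_floor :: "real set \<Rightarrow> real \<Rightarrow> real" where
  "ts_floor T s = Sup {t \<in> T. t \<le> s}"

definition delta_on :: "real set \<Rightarrow> real \<Rightarrow> real \<Rightarrow> real measure" where
  "delta_on T a x = restrict_space (delta_measure T) (T \<inter> {a..<x})"

definition has_delta_deriv :: "real set \<Rightarrow> (real \<Rightarrow> real) \<Rightarrow> real \<Rightarrow> real \<Rightarrow> bool" where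
  "has_delta_deriv T v t l \<longleftrightarrow>
    ((\<lambda>s. (v (fwd_jump T t) - v s) / (fwd_jump T t - s)) \<longlongrightarrow> l) (delta_at T t)"

lemma ts_floor:
  assumes "closed T" "a \<in> T" "a \<le> s"
  shows "ts_floor T s \<in> T" "ts_floor T s \<le> s" "a \<le> ts_floor T s"
    "t \<in> T \<Longrightarrow> t \<le> s \<Longrightarrow> t \<le> ts_floor T s"
proof -
  have ne: "{t \<in> T. t \<le> s} \<noteq> {}" and bdd: "bdd_above {t \<in> T. t \<le> s}"
    using assms by (auto intro!: bdd_aboveI[of _ s])
  have "closed (T \<inter> {..s})" using assms by auto
  then have "closed {t \<in> T. t \<le> s}" by (simp add: Int_def)
  then have "ts_floor T s \<in> {t \<in> T. t \<le> s}"
    unfolding ts_floor_def using closed_contains_Sup[OF ne bdd] by simp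
  then show "ts_floor T s \<in> T" "ts_floor T s \<le> s" by auto
  show up: "t \<in> T \<Longrightarrow> t \<le> s \<Longrightarrow> t \<le> ts_floor T s" for t
    unfolding ts_floor_def using bdd by (intro cSup_upper) auto
  show "a \<le> ts_floor T s" using up assms by blast
qed

lemma ts_floor_eq: "s \<in> T \<Longrightarrow> ts_floor T s = s"
  unfolding ts_floor_def by (intro cSup_eq_maximum) auto

lemma ts_floor_eqI:
  assumes "t \<in> T" "t \<le> s" "\<And>r. r \<in> T \<Longrightarrow> r \<le> s \<Longrightarrow> r \<le> t"
  shows "ts_floor T s = t"
  unfolding ts_floor_def using assms by (intro cSup_eq_maximum) auto

lemma fwd_jump_mem:
  assumes "closed T" "u \<in> T" "t < u"
  shows "fwd_jump T t \<in> T"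
proof -
  have ne: "{s \<in> T. t < s} \<noteq> {}" and bdd: "bdd_below {s \<in> T. t < s}"
    using assms by (auto intro!: bdd_belowI[of _ t])
  have "Inf {s \<in> T. t < s} \<in> closure {s \<in> T. t < s}"
    by (rule closure_contains_Inf[OF ne bdd])
  also have "\<dots> \<subseteq> T" using assms(1) by (intro closure_minimal) auto
  finally show ?thesis using assms by (auto simp: fwd_jump_def)
qed

lemma fwd_jump_ge: "t \<le> fwd_jump T t"
proof (cases "\<exists>s\<in>T. t < s")
  case True then show ?thesis using fwd_jump_less_le(1) by blast
qed (simp add: fwd_jump_def)

lemma fwd_jump_eqI:
  assumes "u \<in> T" "t < u" "\<And>r. r \<in> T \<Longrightarrow> t < r \<Longrightarrow> u \<le> r"
  shows "fwd_jump T t = u"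
proof -
  have "Inf {s \<in> T. t < s} = u" using assms by (intro cInf_eq_minimum) auto
  then show ?thesis using assms by (auto simp: fwd_jump_def)
qed

text \<open>If the forward jump of the floor did not pass \<open>s\<close>, it would be the floor
  itself, and points of \<open>T\<close> would accumulate there from the right. One of them would
  lie strictly between the floor and \<open>s\<close>.\<close>

lemma gap_around:
  assumes "closed T" "a \<in> T" "a \<le> s" "s \<notin> T" "u \<in> T" "s < u"
  shows "ts_floor T s < s" "s < fwd_jump T (ts_floor T s)"
    "s' \<in> {ts_floor T s..<fwd_jump T (ts_floor T s)} \<Longrightarrow> ts_floor T s' = ts_floor T s"
proof -
  note tf = ts_floor[OF assms(1-3)]
  show lt: "ts_floor T s < s" using tf(1,2) assms(4) by (cases "ts_floor T s = s") auto
  let ?v = "fwd_jump T (ts_floor T s)"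
  have vT: "?v \<in> T" using fwd_jump_mem[OF assms(1) assms(5), of "ts_floor T s"] lt assms(6) by simp
  show "s < ?v"
  proof (rule ccontr)
    assume "\<not> s < ?v"
    then have v: "?v \<le> s" by simp
    then have "?v \<le> ts_floor T s" by (rule tf(4)[OF vT])
    then have eq: "?v = ts_floor T s" using fwd_jump_ge[of "ts_floor T s" T] by simp
    have "Inf {r \<in> T. ts_floor T s < r} = ts_floor T s"
      using eq lt assms(5,6) unfolding fwd_jump_def by (metis less_trans)
    then have "Inf {r \<in> T. ts_floor T s < r} < s" using lt by simp
    moreover have "{r \<in> T. ts_floor T s < r} \<noteq> {}" using assms(5,6) lt by auto
    ultimately obtain r where "r \<in> T" "ts_floor T s < r" "r < s"
      using cInf_lessD[of "{r \<in> T. ts_floor T s < r}" s] by blast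
    then show False using tf(4)[of r] by simp
  qed
  show "ts_floor T s' = ts_floor T s" if s': "s' \<in> {ts_floor T s..<?v}"
  proof (rule ts_floor_eqI)
    fix r assume r: "r \<in> T" "r \<le> s'"
    show "r \<le> ts_floor T s"
    proof (rule ccontr)
      assume "\<not> r \<le> ts_floor T s"
      then have "?v \<le> r" using fwd_jump_less_le(2)[OF r(1)] by simp
      then show False using s' r by simp
    qed
  qed (use tf(1-3) s' in auto)
qed

text \<open>A case rule: either a gap opens at \<open>t\<close>, or points of \<open>T\<close>
  accumulate at \<open>t\<close> from the right. The point \<open>u\<close> keeps all witnesses
  inside a prescribed interval.\<close>

lemma right_scattered_or_dense:
  assumes "closed T" "t \<in> T" "u \<in> T" "t < u"
  obtains "t < fwd_jump T t" "fwd_jump T t \<in> T" "fwd_jump T t \<le> u" "T \<inter> {t..fwd_jump T t} = {t, fwd_jump T t}"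
  | "fwd_jump T t = t" "\<And>d. d > 0 \<Longrightarrow> \<exists>r\<in>T. t < r \<and> r < t + d \<and> r \<le> u"
proof (cases "fwd_jump T t = t")
  case True
  have "\<exists>r\<in>T. t < r \<and> r < t + d \<and> r \<le> u" if "d > 0" for d
  proof -
    have "Inf {r \<in> T. t < r} = t" using True assms by (auto simp: fwd_jump_def split: if_splits)
    then have "Inf {r \<in> T. t < r} < min u (t + d)" using that assms by simp
    moreover have "{r \<in> T. t < r} \<noteq> {}" using assms by auto
    ultimately show ?thesis using cInf_lessD[of "{r \<in> T. t < r}"] by fastforce
  qed
  then show ?thesis using True that(2) by blast
next
  case False
  then have "t < fwd_jump T t" using fwd_jump_ge[of t T] by simp
  moreover have mem: "fwd_jump T t \<in> T" using fwd_jump_mem assms by blast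
  moreover have "fwd_jump T t \<le> u" using fwd_jump_less_le(2) assms by blast
  moreover have "T \<inter> {t..fwd_jump T t} = {t, fwd_jump T t}"
  proof (intro equalityI subsetI)
    fix r assume "r \<in> T \<inter> {t..fwd_jump T t}"
    then show "r \<in> {t, fwd_jump T t}" using fwd_jump_less_le(2)[of r T t] by (cases "r = t") auto
  qed (use mem assms(2) calculation(1) in auto)
  ultimately show ?thesis using that(1) by blast
qed

text \<open>The scattered case yields a predecessor through \<open>fwd_jump\<close>, since slopes
  across gaps are expressed at their left ends. The predecessor is the floor of \<open>s - d\<close>
  for a \<open>d\<close> such that \<open>(s - d, s)\<close> misses \<open>T\<close>.\<close>

lemma left_scattered_or_dense:
  assumes "closed T" "a \<in> T" "s \<in> T" "a < s"
  obtains r where "r \<in> T" "a \<le> r" "r < s" "fwd_jump T r = s"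
  | "\<And>d. d > 0 \<Longrightarrow> \<exists>r\<in>T. s - d < r \<and> r < s \<and> a \<le> r"
proof (cases "\<forall>d>0. \<exists>r\<in>T. s - d < r \<and> r < s")
  case True
  have "\<exists>r\<in>T. s - d < r \<and> r < s \<and> a \<le> r" if "d > 0" for d
  proof -
    from True[rule_format, OF that] obtain r where "r \<in> T" "s - d < r" "r < s" by blast
    then show ?thesis using assms by (intro bexI[of _ "max a r"]) (auto simp: max_def)
  qed
  then show ?thesis using that(2) by blast
next
  case False
  then obtain d where d: "d > 0" "\<And>r. r \<in> T \<Longrightarrow> r < s \<Longrightarrow> r \<le> s - d" by force
  then have as: "a \<le> s - d" using assms by blast
  note tf = ts_floor[OF assms(1,2) as]
  have "fwd_jump T (ts_floor T (s - d)) = s"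
  proof (rule fwd_jump_eqI)
    fix r assume r: "r \<in> T" "ts_floor T (s - d) < r"
    show "s \<le> r"
    proof (rule ccontr)
      assume "\<not> s \<le> r"
      then have "r \<le> s - d" using d r by simp
      then show False using tf(4)[of r] r by simp
    qed
  qed (use assms d(1) tf(1-3) in auto)
  moreover have "ts_floor T (s - d) < s" using tf(2) d(1) by simp
  ultimately show ?thesis using that(1) tf(1,3) by blast
qed

lemma eventually_delta_at:
  "eventually P (delta_at T t) \<longleftrightarrow> (\<exists>d>0. \<forall>s\<in>T. s \<noteq> fwd_jump T t \<longrightarrow> \<bar>s - t\<bar> < d \<longrightarrow> P s)"
  unfolding delta_at_def eventually_inf_principal eventually_nhds_metric dist_real_def by auto

text \<open>The filter \<open>delta_at\<close> excludes only the jump, so \<open>t\<close> itself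
  belongs to every set of the filter and the limit must be the quotient at \<open>t\<close>.\<close>

lemma has_delta_deriv_scattered:
  assumes "has_delta_deriv T v t l" "t \<in> T" "t < fwd_jump T t"
  shows "l = (v (fwd_jump T t) - v t) / (fwd_jump T t - t)"
proof (rule ccontr)
  let ?q = "\<lambda>s. (v (fwd_jump T t) - v s) / (fwd_jump T t - s)"
  assume "l \<noteq> ?q t"
  then have "\<bar>l - ?q t\<bar> > 0" by simp
  then have "eventually (\<lambda>s. dist (?q s) l < \<bar>l - ?q t\<bar>) (delta_at T t)"
    using assms(1) unfolding has_delta_deriv_def by (metis tendstoD)
  then show False
    using assms(2,3) unfolding eventually_delta_at by (auto simp: dist_real_def abs_minus_commute)
qed

lemma has_delta_deriv_dense:
  assumes "has_delta_deriv T v t l" "t \<in> T" "fwd_jump T t = t" "e > 0"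
  shows "\<exists>d>0. \<forall>s\<in>T. \<bar>s - t\<bar> < d \<longrightarrow> \<bar>v s - v t - l * (s - t)\<bar> \<le> e * \<bar>s - t\<bar>"
proof -
  have "eventually (\<lambda>s. dist ((v t - v s) / (t - s)) l < e) (delta_at T t)"
    using assms unfolding has_delta_deriv_def by (auto dest: tendstoD)
  then obtain d where d: "d > 0"
    "\<And>s. s \<in> T \<Longrightarrow> s \<noteq> t \<Longrightarrow> \<bar>s - t\<bar> < d \<Longrightarrow> \<bar>(v t - v s) / (t - s) - l\<bar> < e"
    using assms(3) unfolding eventually_delta_at dist_real_def by auto
  have "\<bar>v s - v t - l * (s - t)\<bar> \<le> e * \<bar>s - t\<bar>" if "s \<in> T" "\<bar>s - t\<bar> < d" for s
  proof (cases "s = t")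
    case False
    then have "v s - v t - l * (s - t) = ((v t - v s) / (t - s) - l) * (s - t)"
      by (simp add: field_simps)
    then show ?thesis
      using d(2)[OF that(1) False that(2)] by (simp add: abs_mult mult_right_mono)
  qed simp
  then show ?thesis using d(1) by blast
qed

lemma has_delta_deriv_isCont:
  assumes "has_delta_deriv T v t l" "t \<in> T"
  shows "continuous (at t within T) v"
proof (cases "fwd_jump T t = t")
  case True
  obtain d where d: "d > 0" "\<And>s. s \<in> T \<Longrightarrow> \<bar>s - t\<bar> < d \<Longrightarrow> \<bar>v s - v t - l * (s - t)\<bar> \<le> 1 * \<bar>s - t\<bar>"
    using has_delta_deriv_dense[OF assms True, of 1] by auto
  show ?thesis unfolding continuous_within_eps_delta dist_real_def
  proof (intro allI impI)
    fix e :: real assume e: "e > 0"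
    let ?d = "min d (e / (1 + \<bar>l\<bar>))"
    have "\<bar>v s - v t\<bar> < e" if "s \<in> T" "\<bar>s - t\<bar> < ?d" for s
    proof -
      have "\<bar>v s - v t\<bar> \<le> \<bar>s - t\<bar> + \<bar>l * (s - t)\<bar>" using d(2)[of s] that by simp
      also have "\<dots> = (1 + \<bar>l\<bar>) * \<bar>s - t\<bar>" by (simp add: abs_mult distrib_right)
      also have "\<dots> < (1 + \<bar>l\<bar>) * (e / (1 + \<bar>l\<bar>))" using that by (intro mult_strict_left_mono) auto
      also have "\<dots> = e" by simp
      finally show ?thesis .
    qed
    then show "\<exists>d>0. \<forall>x'\<in>T. \<bar>x' - t\<bar> < d \<longrightarrow> \<bar>v x' - v t\<bar> < e"
      using d(1) e by (intro exI[of _ ?d]) (auto simp: add_pos_nonneg)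
  qed
next
  case False
  then have sc: "t < fwd_jump T t" using fwd_jump_ge[of t T] by simp
  \<comment> \<open>Solving the difference quotient for \<open>v s\<close> writes \<open>v\<close>
    as a function with a limit at \<open>t\<close>; by the formula at right-scattered points this
    limit is \<open>v t\<close>.\<close>
  have lim: "((\<lambda>s. v (fwd_jump T t) - (v (fwd_jump T t) - v s) / (fwd_jump T t - s) * (fwd_jump T t - s))
      \<longlongrightarrow> v (fwd_jump T t) - l * (fwd_jump T t - t)) (delta_at T t)"
    using assms(1) unfolding has_delta_deriv_def
    by (intro tendsto_intros) (auto simp: delta_at_def intro: tendsto_mono[OF inf_le1] filterlim_ident)
  have val: "v (fwd_jump T t) - l * (fwd_jump T t - t) = v t"
    using has_delta_deriv_scattered[OF assms sc] sc by simp
  have le: "at t within T \<le> delta_at T t"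
  proof (rule filter_leI)
    fix P assume "eventually P (delta_at T t)"
    then obtain d where "d > 0" "\<And>s. s \<in> T \<Longrightarrow> s \<noteq> fwd_jump T t \<Longrightarrow> \<bar>s - t\<bar> < d \<Longrightarrow> P s"
      unfolding eventually_delta_at by blast
    then show "eventually P (at t within T)"
      unfolding eventually_at dist_real_def using sc
      by (intro exI[of _ "min d (fwd_jump T t - t)"]) auto
  qed
  have "((\<lambda>s. v (fwd_jump T t) - (v (fwd_jump T t) - v s) / (fwd_jump T t - s) * (fwd_jump T t - s)) \<longlongrightarrow> v t) (at t within T)"
    using tendsto_mono[OF le lim] val by simp
  moreover have "eventually (\<lambda>s. v (fwd_jump T t) - (v (fwd_jump T t) - v s) / (fwd_jump T t - s) * (fwd_jump T t - s) = v s) (at t within T)"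
    unfolding eventually_at dist_real_def using sc
    by (intro exI[of _ "fwd_jump T t - t"]) auto
  ultimately show ?thesis unfolding continuous_within by (rule Lim_transform_eventually)
qed

text \<open>With \<open>D\<close> the delta derivative of \<open>Y\<close>, this interpolates \<open>Y\<close> linearly across the gaps of \<open>T\<close>.\<close>

definition interp :: "real set \<Rightarrow> (real \<Rightarrow> real) \<Rightarrow> (real \<Rightarrow> real) \<Rightarrow> real \<Rightarrow> real" where
  "interp T Y D s = Y (ts_floor T s) + (s - ts_floor T s) * D (ts_floor T s)"

lemma interp_mem: "s \<in> T \<Longrightarrow> interp T Y D s = Y s"
  by (simp add: interp_def ts_floor_eq)

text \<open>On a gap the interpolation is a convex combination of its values at the two ends, and so
  are both affine functions; the bound therefore passes from \<open>T\<close> to the gaps. An affine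
  error bound serves continuity (a constant plus a slope) as well as differentiability (a slope
  \<open>e\<close> or \<open>- e\<close>).\<close>

lemma interp_affine_bound:
  assumes T: "closed T" and r: "r1 \<in> T" "r2 \<in> T"
    and D: "\<And>t. t \<in> T \<Longrightarrow> r1 \<le> t \<Longrightarrow> t < r2 \<Longrightarrow> t < fwd_jump T t \<Longrightarrow>
      D t = (Y (fwd_jump T t) - Y t) / (fwd_jump T t - t)"
    and bd: "\<And>t. t \<in> T \<Longrightarrow> r1 \<le> t \<Longrightarrow> t \<le> r2 \<Longrightarrow> \<bar>Y t - (\<alpha> + \<beta> * t)\<bar> \<le> \<gamma> + \<kappa> * t"
    and s: "r1 \<le> s" "s \<le> r2"
  shows "\<bar>interp T Y D s - (\<alpha> + \<beta> * s)\<bar> \<le> \<gamma> + \<kappa> * s"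
proof (cases "s \<in> T")
  case True
  then show ?thesis using bd[of s] s by (simp add: interp_mem)
next
  case False
  then have sr: "s < r2" using s r by (metis less_le)
  define t1 where "t1 = ts_floor T s"
  define t2 where "t2 = fwd_jump T t1"
  note tf = ts_floor[OF T r(1) s(1), folded t1_def]
  note gap = gap_around[OF T r(1) s(1) False r(2) sr, folded t1_def, folded t2_def]
  have t2T: "t2 \<in> T" and t2r: "t2 \<le> r2"
    unfolding t2_def using fwd_jump_mem[OF T r(2)] fwd_jump_less_le(2)[OF r(2)] gap(1) sr by auto
  define \<theta> where "\<theta> = (s - t1) / (t2 - t1)"
  have \<theta>: "0 \<le> \<theta>" "\<theta> \<le> 1" using gap(1,2) by (auto simp: \<theta>_def)
  have Dt: "D t1 = (Y t2 - Y t1) / (t2 - t1)"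
    unfolding t2_def using tf(1-3) gap(1,2) sr by (intro D) (auto simp: t2_def)
  have "\<theta> * (t2 - t1) = s - t1" using gap(1,2) by (simp add: \<theta>_def)
  then have s_eq: "s = (1 - \<theta>) * t1 + \<theta> * t2" by (simp add: algebra_simps)
  have Ys: "interp T Y D s = (1 - \<theta>) * Y t1 + \<theta> * Y t2"
  proof -
    have "interp T Y D s = Y t1 + \<theta> * (Y t2 - Y t1)"
      by (simp add: interp_def Dt \<theta>_def flip: t1_def)
    then show ?thesis by (simp add: algebra_simps)
  qed
  have b1: "\<bar>Y t1 - (\<alpha> + \<beta> * t1)\<bar> \<le> \<gamma> + \<kappa> * t1" using tf(1-3) gap(1,2) sr by (intro bd) auto
  have b2: "\<bar>Y t2 - (\<alpha> + \<beta> * t2)\<bar> \<le> \<gamma> + \<kappa> * t2" using tf(1-3) gap(1,2) sr t2T t2r by (intro bd) auto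
  have "interp T Y D s - (\<alpha> + \<beta> * s) = (1 - \<theta>) * (Y t1 - (\<alpha> + \<beta> * t1)) + \<theta> * (Y t2 - (\<alpha> + \<beta> * t2))"
    unfolding Ys by (subst s_eq) (simp add: algebra_simps)
  also have "\<bar>\<dots>\<bar> \<le> (1 - \<theta>) * \<bar>Y t1 - (\<alpha> + \<beta> * t1)\<bar> + \<theta> * \<bar>Y t2 - (\<alpha> + \<beta> * t2)\<bar>"
    using \<theta> by (intro order_trans[OF abs_triangle_ineq]) (auto simp: abs_mult)
  also have "\<dots> \<le> (1 - \<theta>) * (\<gamma> + \<kappa> * t1) + \<theta> * (\<gamma> + \<kappa> * t2)"
    using \<theta> b1 b2 by (intro add_mono mult_left_mono) auto
  also have "\<dots> = \<gamma> + \<kappa> * s" by (subst s_eq) (simp add: algebra_simps)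
  finally show ?thesis .
qed

lemma interp_deriv_gap:
  assumes "closed T" "a \<in> T" "a \<le> s" "s \<notin> T" "u \<in> T" "s < u"
  shows "(interp T Y D has_real_derivative D (ts_floor T s)) (at s)"
proof -
  note gap = gap_around[OF assms]
  show ?thesis
  proof (rule has_field_derivative_transform_within_open)
    show "((\<lambda>s'. Y (ts_floor T s) + (s' - ts_floor T s) * D (ts_floor T s)) has_real_derivative D (ts_floor T s)) (at s)"
      by (auto intro!: derivative_eq_intros)
    show "open {ts_floor T s<..<fwd_jump T (ts_floor T s)}" "s \<in> {ts_floor T s<..<fwd_jump T (ts_floor T s)}"
      using gap(1,2) by auto
    fix s' assume "s' \<in> {ts_floor T s<..<fwd_jump T (ts_floor T s)}"
    then have *: "ts_floor T s' = ts_floor T s" by (intro gap(3)) auto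
    show "Y (ts_floor T s) + (s' - ts_floor T s) * D (ts_floor T s) = interp T Y D s'"
      unfolding interp_def * ..
  qed
qed

lemma Lipschitz_eps_delta:
  fixes r s e K :: real
  assumes "r \<noteq> s" "e > 0" "0 \<le> K"
  shows "\<exists>d>0. \<forall>s'. \<bar>s' - s\<bar> < d \<longrightarrow> \<bar>s' - s\<bar> < \<bar>r - s\<bar> \<and> e / 2 + K * \<bar>s' - s\<bar> < e"
proof (intro exI[of _ "min \<bar>r - s\<bar> (e / (2 * (K + 1)))"] conjI allI impI)
  fix s' assume s': "\<bar>s' - s\<bar> < min \<bar>r - s\<bar> (e / (2 * (K + 1)))"
  then show "\<bar>s' - s\<bar> < \<bar>r - s\<bar>" by simp
  have "K * \<bar>s' - s\<bar> \<le> (K + 1) * \<bar>s' - s\<bar>" by (intro mult_right_mono) auto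
  also have "\<dots> < (K + 1) * (e / (2 * (K + 1)))" using s' assms by (intro mult_strict_left_mono) auto
  also have "\<dots> = e / 2" using assms by (simp add: field_simps)
  finally show "e / 2 + K * \<bar>s' - s\<bar> < e" by simp
qed (use assms in auto)

lemma interp_continuous:
  assumes T: "closed T" "a \<in> T" "x \<in> T"
    and cont: "continuous_on (T \<inter> {a..x}) Y"
    and D: "\<And>t. t \<in> T \<Longrightarrow> a \<le> t \<Longrightarrow> t < x \<Longrightarrow> t < fwd_jump T t \<Longrightarrow>
      D t = (Y (fwd_jump T t) - Y t) / (fwd_jump T t - t)"
  shows "continuous_on {a..x} (interp T Y D)"
  unfolding continuous_on_eq_continuous_within
proof
  fix s assume s: "s \<in> {a..x}"
  show "continuous (at s within {a..x}) (interp T Y D)"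
  proof (cases "s \<in> T")
    case False
    then have "s < x" using s T by (cases "s = x") auto
    then have "isCont (interp T Y D) s"
      using DERIV_isCont[OF interp_deriv_gap[OF T(1,2) _ False T(3)]] s by auto
    then show ?thesis by (rule continuous_at_imp_continuous_at_within)
  next
    case sT: True
    show ?thesis unfolding continuous_within_eps_delta dist_real_def
    proof (intro allI impI)
      fix e :: real assume e: "e > 0"
      obtain d0 where d0: "d0 > 0" "\<And>t. t \<in> T \<Longrightarrow> a \<le> t \<Longrightarrow> t \<le> x \<Longrightarrow> \<bar>t - s\<bar> < d0 \<Longrightarrow> \<bar>Y t - Y s\<bar> < e / 2"
      proof -
        have "e / 2 > 0" "s \<in> T \<inter> {a..x}" using e s sT by auto
        then obtain d where "d > 0" "\<forall>t\<in>T \<inter> {a..x}. \<bar>t - s\<bar> < d \<longrightarrow> \<bar>Y t - Y s\<bar> < e / 2"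
          using cont unfolding continuous_on_iff dist_real_def by blast
        then show ?thesis by (intro that[of d]) auto
      qed
      have right: "\<exists>d>0. \<forall>s'. \<bar>s' - s\<bar> < d \<longrightarrow> s \<le> s' \<longrightarrow> s' \<le> x \<longrightarrow> \<bar>interp T Y D s' - Y s\<bar> < e"
      proof (cases "s < x")
        case True
        \<comment> \<open>Both kinds of point are reduced to one affine bound: across a gap the
          absolute chord slope serves as \<open>K\<close>, at a right-dense point continuity of
          \<open>Y\<close> allows \<open>K = 0\<close>.\<close>
        have "\<exists>r\<in>T. s < r \<and> r \<le> x \<and> (\<exists>K\<ge>0. \<forall>t\<in>T. s \<le> t \<longrightarrow> t \<le> r \<longrightarrow> \<bar>Y t - Y s\<bar> \<le> e / 2 + K * (t - s))"
          using T(1) sT T(3) True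
        proof (cases rule: right_scattered_or_dense)
          case 1
          let ?K = "\<bar>Y (fwd_jump T s) - Y s\<bar> / (fwd_jump T s - s)"
          have "\<bar>Y t - Y s\<bar> \<le> e / 2 + ?K * (t - s)" if "t \<in> T" "s \<le> t" "t \<le> fwd_jump T s" for t
          proof -
            have "t \<in> T \<inter> {s..fwd_jump T s}" using that by simp
            then have "t = s \<or> t = fwd_jump T s" unfolding 1(4) by simp
            then show ?thesis using e 1(1) by auto
          qed
          moreover have "?K \<ge> 0" using 1(1) by simp
          ultimately show ?thesis using 1(1-3) by blast
        next
          case 2
          from 2(2)[OF d0(1)] obtain r where r: "r \<in> T" "s < r" "r < s + d0" "r \<le> x" by blast
          have "\<bar>Y t - Y s\<bar> \<le> e / 2 + 0 * (t - s)" if "t \<in> T" "s \<le> t" "t \<le> r" for t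
            using d0(2)[of t] that r s by auto
          then show ?thesis using r by blast
        qed
        then obtain r K where r: "r \<in> T" "s < r" "r \<le> x" and K: "K \<ge> 0"
          "\<And>t. t \<in> T \<Longrightarrow> s \<le> t \<Longrightarrow> t \<le> r \<Longrightarrow> \<bar>Y t - Y s\<bar> \<le> e / 2 + K * (t - s)" by blast
        have bd: "\<bar>interp T Y D s' - (Y s + 0 * s')\<bar> \<le> (e / 2 - K * s) + K * s'" if "s \<le> s'" "s' \<le> r" for s'
          using that r s K(2) by (intro interp_affine_bound[OF T(1) sT r(1) D]) (auto simp: algebra_simps)
        obtain d where d: "d > 0" "\<And>s'. \<bar>s' - s\<bar> < d \<Longrightarrow> \<bar>s' - s\<bar> < \<bar>r - s\<bar> \<and> e / 2 + K * \<bar>s' - s\<bar> < e"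
          using Lipschitz_eps_delta[of r s e K] r e K(1) by auto
        have "\<bar>interp T Y D s' - Y s\<bar> < e" if "\<bar>s' - s\<bar> < d" "s \<le> s'" for s'
          using d(2)[OF that(1)] bd[of s'] that r by (simp add: algebra_simps)
        then show ?thesis using d(1) by blast
      next
        case False
        then have "s = x" using s by simp
        then have "s \<le> s' \<Longrightarrow> s' \<le> x \<Longrightarrow> interp T Y D s' = Y s" for s'
          using interp_mem[OF sT] by (metis antisym)
        then show ?thesis using e by (intro exI[of _ 1]) auto
      qed
      have left: "\<exists>d>0. \<forall>s'. \<bar>s' - s\<bar> < d \<longrightarrow> a \<le> s' \<longrightarrow> s' \<le> s \<longrightarrow> \<bar>interp T Y D s' - Y s\<bar> < e"
      proof (cases "a < s")
        case True
        have "\<exists>r\<in>T. a \<le> r \<and> r < s \<and> (\<exists>K\<ge>0. \<forall>t\<in>T. r \<le> t \<longrightarrow> t \<le> s \<longrightarrow> \<bar>Y t - Y s\<bar> \<le> e / 2 + K * (s - t))"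
          using T(1,2) sT True
        proof (cases rule: left_scattered_or_dense)
          case (1 r)
          let ?K = "\<bar>Y r - Y s\<bar> / (s - r)"
          have "\<bar>Y t - Y s\<bar> \<le> e / 2 + ?K * (s - t)" if "t \<in> T" "r \<le> t" "t \<le> s" for t
          proof -
            have "t = r \<or> t = s" using 1(4) that fwd_jump_less_le(2)[OF that(1), of r] by force
            then show ?thesis using e 1(3) by auto
          qed
          moreover have "?K \<ge> 0" using 1(3) by simp
          ultimately show ?thesis using 1(1-3) by blast
        next
          case 2
          from 2[OF d0(1)] obtain r where r: "r \<in> T" "s - d0 < r" "r < s" "a \<le> r" by blast
          have "\<bar>Y t - Y s\<bar> \<le> e / 2 + 0 * (s - t)" if "t \<in> T" "r \<le> t" "t \<le> s" for t
            using d0(2)[of t] that r s by auto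
          then show ?thesis using r by blast
        qed
        then obtain r K where r: "r \<in> T" "a \<le> r" "r < s" and K: "K \<ge> 0"
          "\<And>t. t \<in> T \<Longrightarrow> r \<le> t \<Longrightarrow> t \<le> s \<Longrightarrow> \<bar>Y t - Y s\<bar> \<le> e / 2 + K * (s - t)" by blast
        have bd: "\<bar>interp T Y D s' - (Y s + 0 * s')\<bar> \<le> (e / 2 + K * s) + (- K) * s'" if "r \<le> s'" "s' \<le> s" for s'
          using that r s K(2) by (intro interp_affine_bound[OF T(1) r(1) sT D]) (auto simp: algebra_simps)
        obtain d where d: "d > 0" "\<And>s'. \<bar>s' - s\<bar> < d \<Longrightarrow> \<bar>s' - s\<bar> < \<bar>r - s\<bar> \<and> e / 2 + K * \<bar>s' - s\<bar> < e"
          using Lipschitz_eps_delta[of r s e K] r e K(1) by auto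
        have "\<bar>interp T Y D s' - Y s\<bar> < e" if "\<bar>s' - s\<bar> < d" "s' \<le> s" for s'
          using d(2)[OF that(1)] bd[of s'] that r by (simp add: algebra_simps)
        then show ?thesis using d(1) by blast
      next
        case False
        then have "s = a" using s by simp
        then have "a \<le> s' \<Longrightarrow> s' \<le> s \<Longrightarrow> interp T Y D s' = Y s" for s'
          using interp_mem[OF sT] by (metis antisym)
        then show ?thesis using e by (intro exI[of _ 1]) auto
      qed
      from left right obtain d1 d2 where "d1 > 0" "d2 > 0"
        and l: "\<And>s'. \<bar>s' - s\<bar> < d1 \<Longrightarrow> a \<le> s' \<Longrightarrow> s' \<le> s \<Longrightarrow> \<bar>interp T Y D s' - Y s\<bar> < e"
        and r: "\<And>s'. \<bar>s' - s\<bar> < d2 \<Longrightarrow> s \<le> s' \<Longrightarrow> s' \<le> x \<Longrightarrow> \<bar>interp T Y D s' - Y s\<bar> < e" by blast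
      have "\<bar>interp T Y D s' - interp T Y D s\<bar> < e" if "s' \<in> {a..x}" "\<bar>s' - s\<bar> < min d1 d2" for s'
        using l[of s'] r[of s'] that interp_mem[OF sT, of Y D] by (cases "s' \<le> s") auto
      then show "\<exists>d>0. \<forall>x'\<in>{a..x}. \<bar>x' - s\<bar> < d \<longrightarrow> \<bar>interp T Y D x' - interp T Y D s\<bar> < e"
        using \<open>d1 > 0\<close> \<open>d2 > 0\<close> by (intro exI[of _ "min d1 d2"]) auto
    qed
  qed
qed

text \<open>Here \<open>s\<close> is neither the left nor the right end of a gap, so there are
  points of \<open>T\<close> close to \<open>s\<close> on both sides. Between them the linear error
  bound for \<open>Y\<close>, affine on each side of \<open>s\<close>, carries over to the
  interpolation.\<close>

lemma interp_deriv_dense: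
  assumes T: "closed T" "a \<in> T" "x \<in> T" and s: "s \<in> T" "a < s" "s < x"
    and D: "\<And>t. t \<in> T \<Longrightarrow> a \<le> t \<Longrightarrow> t < x \<Longrightarrow> t < fwd_jump T t \<Longrightarrow>
      D t = (Y (fwd_jump T t) - Y t) / (fwd_jump T t - t)"
    and deriv: "has_delta_deriv T Y s l"
    and dense: "fwd_jump T s = s" "\<And>r. r \<in> T \<Longrightarrow> r < s \<Longrightarrow> fwd_jump T r \<noteq> s"
  shows "(interp T Y D has_real_derivative l) (at s)"
  unfolding has_field_derivative_def has_derivative_within_alt real_norm_def
proof (intro conjI allI impI)
  show "bounded_linear ((*) l)" by (rule bounded_linear_mult_right)
  fix e :: real assume e: "e > 0"
  obtain d where d: "d > 0" "\<And>t. t \<in> T \<Longrightarrow> \<bar>t - s\<bar> < d \<Longrightarrow> \<bar>Y t - Y s - l * (t - s)\<bar> \<le> e * \<bar>t - s\<bar>"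
    using has_delta_deriv_dense[OF deriv s(1) dense(1) e] by auto
  obtain r2 where r2: "r2 \<in> T" "s < r2" "r2 < s + d" "r2 \<le> x"
    using T(1) s(1) T(3) s(3)
  proof (cases rule: right_scattered_or_dense)
    case 2
    then show ?thesis using that d(1) by blast
  qed (use dense in auto)
  obtain r1 where r1: "r1 \<in> T" "s - d < r1" "r1 < s" "a \<le> r1"
    using T(1,2) s(1,2)
  proof (cases rule: left_scattered_or_dense)
    case 2
    then show ?thesis using that d(1) by blast
  qed (use dense in auto)
  have b1: "\<bar>interp T Y D s' - ((Y s - l * s) + l * s')\<bar> \<le> - e * s + e * s'" if "s \<le> s'" "s' \<le> r2" for s'
  proof (intro interp_affine_bound[OF T(1) s(1) r2(1) D])
    fix t assume "t \<in> T" "s \<le> t" "t \<le> r2"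
    then show "\<bar>Y t - (Y s - l * s + l * t)\<bar> \<le> - e * s + e * t"
      using d(2)[of t] r2 by (simp add: algebra_simps)
  qed (use s r2 that in auto)
  have b2: "\<bar>interp T Y D s' - ((Y s - l * s) + l * s')\<bar> \<le> e * s + (- e) * s'" if "r1 \<le> s'" "s' \<le> s" for s'
  proof (intro interp_affine_bound[OF T(1) r1(1) s(1) D])
    fix t assume "t \<in> T" "r1 \<le> t" "t \<le> s"
    then show "\<bar>Y t - (Y s - l * s + l * t)\<bar> \<le> e * s + (- e) * t"
      using d(2)[of t] r1 by (simp add: algebra_simps)
  qed (use s r1 that in auto)
  have "\<bar>interp T Y D y - interp T Y D s - l * (y - s)\<bar> \<le> e * \<bar>y - s\<bar>"
    if "\<bar>y - s\<bar> < min (r2 - s) (s - r1)" for y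
    using that b1[of y] b2[of y] interp_mem[OF s(1), of Y D] by (cases "y \<le> s") (auto simp: algebra_simps)
  then show "\<exists>d>0. \<forall>y\<in>UNIV. \<bar>y - s\<bar> < d \<longrightarrow> \<bar>interp T Y D y - interp T Y D s - l * (y - s)\<bar> \<le> e * \<bar>y - s\<bar>"
    using r1 r2 by (intro exI[of _ "min (r2 - s) (s - r1)"]) auto
qed

text \<open>The gaps to the right of such points are disjoint nonempty open intervals.\<close>

lemma countable_right_scattered: "countable {t \<in> T. t < fwd_jump T t}"
proof -
  let ?S = "{t \<in> T. t < fwd_jump T t}" and ?I = "\<lambda>t. {t<..<fwd_jump T t}"
  have disj: "?I t \<inter> ?I u = {}" if "t \<in> ?S" "u \<in> ?S" "t < u" for t u
    using fwd_jump_less_le(2)[of u T t] that by auto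
  have "countable (?I ` ?S)"
  proof (rule countable_disjoint_open_subsets)
    show "pairwise disjnt (?I ` ?S)"
      unfolding pairwise_def disjnt_def
    proof (intro ballI impI)
      fix A B assume "A \<in> ?I ` ?S" "B \<in> ?I ` ?S" "A \<noteq> B"
      then obtain t u where tu: "t \<in> ?S" "u \<in> ?S" "A = ?I t" "B = ?I u" "t \<noteq> u" by auto
      then show "A \<inter> B = {}" using disj[of t u] disj[of u t] by (cases "t < u") auto
    qed
  qed auto
  moreover have "inj_on ?I ?S"
  proof (rule inj_onI)
    fix t u assume tu: "t \<in> ?S" "u \<in> ?S" "?I t = ?I u"
    show "t = u"
    proof (rule ccontr)
      assume "t \<noteq> u"
      then have "?I t \<inter> ?I u = {}" using disj[of t u] disj[of u t] tu by (cases "t < u") auto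
      then show False using tu by auto
    qed
  qed
  ultimately show ?thesis by (simp add: countable_image_inj_eq)
qed

lemma ftc_time_scale:
  assumes T: "closed T" "a \<in> T" "x \<in> T" "a \<le> x"
    and cont: "continuous_on (T \<inter> {a..x}) Y"
    and deriv: "\<And>t. t \<in> T \<Longrightarrow> a \<le> t \<Longrightarrow> t < x \<Longrightarrow> has_delta_deriv T Y t (D t)"
  shows "((\<lambda>s. D (ts_floor T s)) has_integral (Y x - Y a)) {a..x}"
proof -
  let ?S = "{t \<in> T. t < fwd_jump T t}"
  \<comment> \<open>At either end of a gap the interpolation may have a corner, and at
    \<open>a\<close> and \<open>x\<close> it is controlled from one side only.\<close>
  let ?C = "?S \<union> fwd_jump T ` ?S \<union> {a, x}"
  have D: "D t = (Y (fwd_jump T t) - Y t) / (fwd_jump T t - t)"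
    if "t \<in> T" "a \<le> t" "t < x" "t < fwd_jump T t" for t
    using has_delta_deriv_scattered[OF deriv] that by blast
  have "((\<lambda>s. D (ts_floor T s)) has_integral (interp T Y D x - interp T Y D a)) {a..x}"
  proof (rule ftc_countable_exceptions[of a x ?C])
    show "countable ?C" using countable_right_scattered by simp
    show "continuous_on {a..x} (interp T Y D)" using interp_continuous[OF T(1-3) cont D] .
    fix s assume s: "s \<in> {a..x} - ?C"
    then have s': "a < s" "s < x" by auto
    show "(interp T Y D has_real_derivative D (ts_floor T s)) (at s within {a..x})"
    proof (cases "s \<in> T")
      case False
      then show ?thesis
        using interp_deriv_gap[OF T(1,2) _ False T(3)] s' by (auto intro: DERIV_subset)
    next
      case True
      have 1: "fwd_jump T s = s" using s True fwd_jump_ge[of s T] by auto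
      have 2: "fwd_jump T r \<noteq> s" if "r \<in> T" "r < s" for r
        using s that by auto
      show ?thesis unfolding ts_floor_eq[OF True]
        by (rule DERIV_subset[OF interp_deriv_dense[OF T(1-3) True s' D deriv 1 2]]) (use True s' in auto)
    qed
  qed (use T in auto)
  then show ?thesis using T by (simp add: interp_mem)
qed

section \<open>Delta integrals as Lebesgue integrals\<close>

lemma ts_floor_measurable:
  assumes "closed T" "a \<in> T"
  shows "ts_floor T \<in> borel_measurable (restrict_space borel {a..<x})"
proof (rule borel_measurable_mono_on_fnc, rule mono_onI)
  fix r s assume "r \<in> {a..<x}" "s \<in> {a..<x}" "r \<le> s"
  then show "ts_floor T r \<le> ts_floor T s"
    using ts_floor(1,2)[OF assms, of r] ts_floor(4)[OF assms, of s] by auto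
qed

lemma sets_delta_on: "sets (delta_on T a x) = sets (restrict_space borel (T \<inter> {a..<x}))"
  unfolding delta_on_def by (rule sets_restrict_space_cong) simp

lemma space_delta_measure [simp]: "space (delta_measure T) = UNIV"
  using sets_eq_imp_space_eq[OF sets_delta_measure] by simp

lemma space_delta_on [simp]: "space (delta_on T a x) = T \<inter> {a..<x}"
  unfolding delta_on_def space_restrict_space by simp

lemma emeasure_delta_on:
  assumes "closed T" "A \<in> sets borel"
  shows "emeasure (delta_on T a x) (A \<inter> (T \<inter> {a..<x})) = emeasure (delta_measure T) (A \<inter> (T \<inter> {a..<x}))"
  unfolding delta_on_def using assms by (subst emeasure_restrict_space) auto

text \<open>The delta measure is the push-forward of the Lebesgue measure under \<open>ts_floor\<close>, so that delta
  integrals of \<open>G\<close> become Lebesgue integrals of \<open>G \<circ> ts_floor T\<close>.\<close>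

lemma delta_on_eq_distr:
  assumes T: "closed T" "a \<in> T" "x \<in> T" "a \<le> x"
  shows "delta_on T a x = distr (restrict_space lborel {a..<x}) (restrict_space borel (T \<inter> {a..<x})) (ts_floor T)"
    (is "_ = distr ?L ?B _")
proof -
  have sL: "sets ?L = sets (restrict_space borel {a..<x})" by (rule sets_restrict_space_cong) simp
  have spL: "space ?L = {a..<x}" by (simp add: space_restrict_space)
  note tf = ts_floor[OF T(1,2)]
  have mb: "ts_floor T \<in> borel_measurable ?L"
    using ts_floor_measurable[OF T(1,2), of x] unfolding measurable_cong_sets[OF sL refl] .
  have mB: "ts_floor T \<in> measurable ?L ?B"
    using tf(1-3) mb order.strict_trans1[OF tf(2)]
    by (intro measurable_restrict_space2) (auto simp: space_restrict_space)
  define M where "M = distr ?L borel (ts_floor T)"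
  define N where "N = distr (delta_on T a x) borel (\<lambda>t. t)"
  have mN: "(\<lambda>t. t) \<in> measurable (delta_on T a x) borel"
    unfolding measurable_cong_sets[OF sets_delta_on refl] by (rule measurable_restrict_space1) simp
  have eq: "emeasure N {..<c} = emeasure M {..<c}" for c
  proof -
    \<comment> \<open>The mass of \<open>T \<inter> {a..<c}\<close> is known only for end points in
      \<open>T\<close>. Moving \<open>c\<close> up to the next point of \<open>T\<close> from
      \<open>a\<close> on, or down to \<open>x\<close>, does not change which points of
      \<open>T \<inter> {a..<x}\<close> lie below it.\<close>
    define c' where "c' = (if c \<le> x then Inf {t \<in> T. max a c \<le> t} else x)"
    have c': "c' \<in> T \<and> a \<le> c' \<and> c' \<le> x \<and> (\<forall>t\<in>T. a \<le> t \<longrightarrow> t < x \<longrightarrow> (t < c \<longleftrightarrow> t < c'))"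
    proof (cases "c \<le> x")
      case True
      have ne: "{t \<in> T. max a c \<le> t} \<noteq> {}" and bdd: "bdd_below {t \<in> T. max a c \<le> t}"
        using True T by (auto intro!: bdd_belowI[of _ a])
      have "closed (T \<inter> {max a c..})" using T by auto
      then have "closed {t \<in> T. max a c \<le> t}" by (simp add: Int_def)
      then have "Inf {t \<in> T. max a c \<le> t} \<in> {t \<in> T. max a c \<le> t}"
        using closed_contains_Inf[OF ne bdd] by simp
      then have m: "c' \<in> T" "a \<le> c'" "c \<le> c'" using True by (auto simp: c'_def)
      have low: "c' \<le> t" if "t \<in> T" "a \<le> t" "c \<le> t" for t
        using cInf_lower[OF _ bdd, of t] that True by (auto simp: c'_def)
      have "t < c \<longleftrightarrow> t < c'" if "t \<in> T" "a \<le> t" for t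
        using low[of t] m that by (cases "c \<le> t") auto
      then show ?thesis using m low[of x] T True by blast
    qed (use T in \<open>auto simp: c'_def\<close>)
    have "emeasure N {..<c} = emeasure (delta_on T a x) ({..<c} \<inter> (T \<inter> {a..<x}))"
      unfolding N_def by (subst emeasure_distr[OF mN]) auto
    also have "\<dots> = emeasure (delta_measure T) ({..<c} \<inter> (T \<inter> {a..<x}))"
      by (rule emeasure_delta_on[OF T(1)]) auto
    also have "{..<c} \<inter> (T \<inter> {a..<x}) = T \<inter> {a..<c'}"
      using c' by auto
    also have "emeasure (delta_measure T) \<dots> = ennreal (c' - a)"
      using c' T by (intro emeasure_delta_measure) (auto simp: time_scale_def)
    finally have N: "emeasure N {..<c} = ennreal (c' - a)" .
    \<comment> \<open>As \<open>c'\<close> is in \<open>T\<close>, the floor of \<open>s\<close>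
      reaches \<open>c'\<close> exactly when \<open>s\<close> does.\<close>
    have iff: "ts_floor T s < c \<longleftrightarrow> s < c'" if "s \<in> {a..<x}" for s
    proof -
      have "ts_floor T s < c \<longleftrightarrow> ts_floor T s < c'"
        using c' tf[of s] that by auto
      also have "\<dots> \<longleftrightarrow> s < c'"
        using tf(2)[of s] tf(4)[of s c'] c' that by (cases "c' \<le> s") auto
      finally show ?thesis .
    qed
    have "emeasure M {..<c} = emeasure ?L (ts_floor T -` {..<c} \<inter> {a..<x})"
      unfolding M_def by (subst emeasure_distr[OF mb]) (auto simp: spL)
    also have "ts_floor T -` {..<c} \<inter> {a..<x} = {a..<c'}"
      using iff c' by auto
    also have "emeasure ?L {a..<c'} = emeasure lborel {a..<c'}"
      using c' by (intro emeasure_restrict_space) auto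
    also have "\<dots> = ennreal (c' - a)" using c' by simp
    finally show ?thesis using N by simp
  qed
  have MN: "M = N"
  proof (rule measure_eqI_generator_eq[of "range (\<lambda>c::real. {..<c})" UNIV])
    show "Int_stable (range (\<lambda>c::real. {..<c}))"
    proof (rule Int_stableI_image)
      fix c d :: real
      show "\<exists>k\<in>UNIV. {..<c} \<inter> {..<d} = {..<k}" by (intro bexI[of _ "min c d"]) auto
    qed
    have b: "sets borel = sigma_sets UNIV (range (\<lambda>c::real. {..<c}))"
      by (subst borel_eq_lessThan) (simp add: lessThan_def eucl_less_def)
    show "sets M = sigma_sets UNIV (range (\<lambda>c::real. {..<c}))"
      "sets N = sigma_sets UNIV (range (\<lambda>c::real. {..<c}))"
      using b by (simp_all add: M_def N_def)
    show "range (\<lambda>i::nat. {..<real i}) \<subseteq> range (\<lambda>c::real. {..<c})" by auto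
    show "(\<Union>i::nat. {..<real i}) = UNIV" using reals_Archimedean2 by auto
    show "emeasure M {..<real i} \<noteq> \<infinity>" for i
    proof -
      have "emeasure M {..<real i} \<le> emeasure ?L (space ?L)"
        unfolding M_def by (subst emeasure_distr[OF mb]) (auto intro!: emeasure_space simp del: space_restrict_space2)
      also have "\<dots> = emeasure lborel {a..<x}" by (simp add: spL emeasure_restrict_space)
      also have "\<dots> < \<infinity>" using T(4) by simp
      finally show ?thesis by simp
    qed
  qed (use eq in auto)
  show ?thesis
  proof (rule measure_eqI)
    show "sets (delta_on T a x) = sets (distr ?L ?B (ts_floor T))" by (simp add: sets_delta_on)
    fix A assume "A \<in> sets (delta_on T a x)"
    then have A: "A \<in> sets borel" "A \<subseteq> T \<inter> {a..<x}"
      using T by (auto simp: sets_delta_on sets_restrict_space_iff)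
    have AB: "A \<in> sets ?B" using A T by (auto simp: sets_restrict_space_iff)
    have "emeasure (delta_on T a x) A = emeasure N A"
      unfolding N_def using A by (subst emeasure_distr[OF mN]) (auto simp: Int_absorb2)
    also have "\<dots> = emeasure M A" by (simp add: MN)
    also have "\<dots> = emeasure (distr ?L ?B (ts_floor T)) A"
      unfolding M_def using A AB by (simp add: emeasure_distr[OF mb] emeasure_distr[OF mB])
    finally show "emeasure (delta_on T a x) A = emeasure (distr ?L ?B (ts_floor T)) A" .
  qed
qed

text \<open>Nothing is assumed about the measurability of \<open>D\<close>. The Henstock-Kurzweil
  integral of \<open>D\<close> composed with the floor exists by the fundamental theorem, and it is
  compared with that of the integrable majorant \<open>G\<close>. Scaling by constants of either
  sign later turns this into equalities.\<close>

lemma delta_deriv_le_integral: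
  assumes T: "closed T" "a \<in> T" "x \<in> T" "a \<le> x"
    and cont: "continuous_on (T \<inter> {a..x}) Y"
    and deriv: "\<And>t. t \<in> T \<Longrightarrow> a \<le> t \<Longrightarrow> t < x \<Longrightarrow> has_delta_deriv T Y t (D t)"
    and G: "integrable (delta_on T a x) G" and le: "AE t in delta_on T a x. D t \<le> G t"
  shows "Y x - Y a \<le> (\<integral>t. G t \<partial>delta_on T a x)"
proof -
  let ?L = "restrict_space lborel {a..<x}" and ?B = "restrict_space borel (T \<inter> {a..<x})"
  have sL: "sets ?L = sets (restrict_space borel {a..<x})" by (rule sets_restrict_space_cong) simp
  have "ts_floor T \<in> borel_measurable ?L"
    using ts_floor_measurable[OF T(1,2), of x] unfolding measurable_cong_sets[OF sL refl] .
  then have mB: "ts_floor T \<in> measurable ?L ?B"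
    using ts_floor(1-3)[OF T(1,2)] order.strict_trans1[OF ts_floor(2)[OF T(1,2)]]
    by (intro measurable_restrict_space2) (auto simp: space_restrict_space)
  note eq = delta_on_eq_distr[OF T]
  have GB: "G \<in> borel_measurable ?B"
    using borel_measurable_integrable[OF G] unfolding measurable_cong_sets[OF sets_delta_on refl] .
  have int: "integrable ?L (\<lambda>s. G (ts_floor T s))"
    using G integrable_distr_eq[OF mB GB] by (simp add: eq)
  have val: "(\<integral>t. G t \<partial>delta_on T a x) = (\<integral>s. G (ts_floor T s) \<partial>?L)"
    using integral_distr[OF mB GB] by (simp add: eq)
  have AE: "AE s in ?L. D (ts_floor T s) \<le> G (ts_floor T s)"
    using le mB unfolding eq by (rule AE_distrD[rotated])
  let ?g = "\<lambda>s. indicator {a..<x} s *\<^sub>R G (ts_floor T s)"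
  have "integrable lborel ?g" "(\<integral>s. G (ts_floor T s) \<partial>?L) = integral\<^sup>L lborel ?g"
    using int by (auto simp: integrable_restrict_space integral_restrict_space)
  then have "(?g has_integral (\<integral>t. G t \<partial>delta_on T a x)) UNIV"
    using has_integral_integral_lborel[of ?g] val by simp
  moreover have "?g = (\<lambda>s. if s \<in> {a..x} then ?g s else 0)" by (auto simp: fun_eq_iff indicator_def)
  ultimately have g: "(?g has_integral (\<integral>t. G t \<partial>delta_on T a x)) {a..x}"
    using has_integral_restrict_UNIV[of "{a..x}" ?g] by metis
  have "AE s in lborel. s \<in> {a..<x} \<longrightarrow> D (ts_floor T s) \<le> G (ts_floor T s)"
    using AE by (simp add: AE_restrict_space_iff)
  moreover have "AE s in lborel. s \<noteq> x" by (rule AE_lborel_singleton)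
  ultimately have "AE s in lborel. s \<in> {a..x} \<longrightarrow> ?g s = max (?g s) (D (ts_floor T s))"
    by eventually_elim auto
  \<comment> \<open>The comparison of gauge integrals is pointwise. The maximum dominates everywhere
    and differs from \<open>?g\<close> only on a null set, so its integral is the same.\<close>
  then have "((\<lambda>s. max (?g s) (D (ts_floor T s))) has_integral (\<integral>t. G t \<partial>delta_on T a x)) {a..x}"
    by (subst has_integral_AE[where g = ?g]) (use g in \<open>auto elim: eventually_mono\<close>)
  from has_integral_le[OF ftc_time_scale[OF T cont deriv] this] show ?thesis by simp
qed

section \<open>Backward jumps and the successively truncated time scales\<close>

lemma bwd_jump_le: "bwd_jump T t \<le> t"
proof (cases "\<exists>s\<in>T. s < t")
  case True
  then have "Sup {s \<in> T. s < t} \<le> t" by (intro cSup_least) auto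
  then show ?thesis using True by (simp add: bwd_jump_def)
qed (simp add: bwd_jump_def)

lemma bwd_jump_mem:
  assumes "closed T" "t \<in> T"
  shows "bwd_jump T t \<in> T"
proof (cases "\<exists>s\<in>T. s < t")
  case True
  then have ne: "{s \<in> T. s < t} \<noteq> {}" and bdd: "bdd_above {s \<in> T. s < t}"
    by (auto intro!: bdd_aboveI[of _ t])
  have "Sup {s \<in> T. s < t} \<in> closure {s \<in> T. s < t}" by (rule closure_contains_Sup[OF ne bdd])
  also have "\<dots> \<subseteq> T" using assms(1) by (intro closure_minimal) auto
  finally show ?thesis using True by (auto simp: bwd_jump_def)
qed (use assms in \<open>auto simp: bwd_jump_def\<close>)

lemma le_bwd_jump: "s \<in> T \<Longrightarrow> s < t \<Longrightarrow> s \<le> bwd_jump T t"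
  by (auto simp: bwd_jump_def intro!: cSup_upper bdd_aboveI[of _ t])

lemma bwd_jump_mono:
  assumes "closed T" "s \<in> T" "t \<in> T" "s \<le> t"
  shows "bwd_jump T s \<le> bwd_jump T t"
  using assms bwd_jump_le[of T s] le_bwd_jump[of s T t] by (cases "s = t") auto

lemma funpow_bwd_jump:
  assumes "closed T" "t \<in> T"
  shows "(bwd_jump T ^^ k) t \<in> T" "(bwd_jump T ^^ Suc k) t \<le> (bwd_jump T ^^ k) t" "(bwd_jump T ^^ k) t \<le> t"
proof -
  show *: "(bwd_jump T ^^ k) t \<in> T" for k
    by (induction k) (use assms bwd_jump_mem in auto)
  show **: "(bwd_jump T ^^ Suc k) t \<le> (bwd_jump T ^^ k) t" for k
    by (simp add: bwd_jump_le)
  show "(bwd_jump T ^^ k) t \<le> t"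
    by (induction k) (use ** order_trans in \<open>auto simp del: funpow.simps(2)\<close>)
qed

lemma funpow_bwd_jump_mono:
  assumes "closed T" "s \<in> T" "t \<in> T" "s \<le> t"
  shows "(bwd_jump T ^^ k) s \<le> (bwd_jump T ^^ k) t"
  by (induction k) (use assms bwd_jump_mono funpow_bwd_jump(1) in auto)

lemma funpow_bwd_jump_antimono:
  assumes "closed T" "t \<in> T" "k \<le> l"
  shows "(bwd_jump T ^^ l) t \<le> (bwd_jump T ^^ k) t"
  using assms(3)
proof (induction l rule: dec_induct)
  case (step l)
  then show ?case using funpow_bwd_jump(2)[OF assms(1,2), of l] by simp
qed simp

lemma kappa_subset: "(kappa ^^ k) T \<subseteq> T"
  by (induction k) (auto simp: kappa_def)

text \<open>The next truncation could remove \<open>t\<close> only as a left-scattered maximum. The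
  k-fold backward jump of \<open>x\<close> is still present, so \<open>t\<close> would equal it; but
  then \<open>t\<close> is at most its own backward jump, hence not left-scattered.\<close>

lemma mem_kappa:
  assumes T: "closed T" "x \<in> T"
  shows "t \<in> T \<Longrightarrow> t \<le> (bwd_jump T ^^ k) x \<Longrightarrow> t \<in> (kappa ^^ k) T"
proof (induction k arbitrary: t)
  case (Suc k)
  let ?S = "(kappa ^^ k) T" and ?u = "(bwd_jump T ^^ k) x"
  note fb = funpow_bwd_jump[OF T]
  have le: "t \<le> ?u" using Suc.prems fb(2)[of k] by simp
  have tS: "t \<in> ?S" using Suc le by blast
  have uS: "?u \<in> ?S" using Suc.IH[OF fb(1)] by simp
  show ?case
  proof (rule ccontr)
    assume "t \<notin> (kappa ^^ Suc k) T"
    then have mx: "\<And>s. s \<in> ?S \<Longrightarrow> s \<le> t" and b: "bwd_jump ?S t < t"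
      using tS by (auto simp: kappa_def)
    have "?u = t" using mx[OF uS] le by simp
    then have bt: "bwd_jump T t = t" using Suc.prems(2) bwd_jump_le[of T t] by simp
    have "{s \<in> ?S. s < t} = {s \<in> T. s < t}"
      using Suc.IH le kappa_subset[of k T] by auto
    then have "bwd_jump ?S t = bwd_jump T t" by (auto simp: bwd_jump_def)
    then show False using b bt by simp
  qed
qed simp

lemma fwd_jump_cong_below:
  assumes "S \<subseteq> T" "\<And>s. s \<in> T \<Longrightarrow> s \<le> u \<Longrightarrow> s \<in> S" "u \<in> T" "t < u"
  shows "fwd_jump S t = fwd_jump T t"
proof -
  have uS: "u \<in> S" using assms by auto
  have bdd: "bdd_below {s \<in> S. t < s}" "bdd_below {s \<in> T. t < s}" by (auto intro!: bdd_belowI[of _ t])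
  have "Inf {s \<in> T. t < s} \<le> Inf {s \<in> S. t < s}"
    using uS assms bdd by (intro cInf_superset_mono) auto
  moreover have "Inf {s \<in> S. t < s} \<le> Inf {s \<in> T. t < s}"
  proof (rule cInf_greatest)
    fix r assume r: "r \<in> {s \<in> T. t < s}"
    show "Inf {s \<in> S. t < s} \<le> r"
    proof (cases "r \<le> u")
      case True
      then show ?thesis using r assms bdd by (intro cInf_lower) auto
    next
      case False
      have "Inf {s \<in> S. t < s} \<le> u" using uS assms bdd by (intro cInf_lower) auto
      then show ?thesis using False by simp
    qed
  qed (use assms in auto)
  ultimately show ?thesis using uS assms by (auto simp: fwd_jump_def)
qed

lemma delta_at_cong_below:
  assumes "S \<subseteq> T" "\<And>s. s \<in> T \<Longrightarrow> s \<le> u \<Longrightarrow> s \<in> S" "u \<in> T" "t < u"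
  shows "delta_at S t = delta_at T t"
proof (rule filter_eqI)
  fix P
  have f: "fwd_jump S t = fwd_jump T t" by (rule fwd_jump_cong_below[OF assms])
  show "eventually P (delta_at S t) = eventually P (delta_at T t)"
  proof
    assume "eventually P (delta_at S t)"
    then obtain d where d: "d > 0" "\<forall>s\<in>S. s \<noteq> fwd_jump T t \<longrightarrow> \<bar>s - t\<bar> < d \<longrightarrow> P s"
      unfolding eventually_delta_at f by blast
    have "P s" if "s \<in> T" "s \<noteq> fwd_jump T t" "\<bar>s - t\<bar> < min d (u - t)" for s
      using d(2) assms(2)[of s] that by auto
    then show "eventually P (delta_at T t)"
      unfolding eventually_delta_at using d(1) assms(4) by (intro exI[of _ "min d (u - t)"]) auto
  next
    assume "eventually P (delta_at T t)"
    then show "eventually P (delta_at S t)"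
      unfolding eventually_delta_at f using assms(1) by blast
  qed
qed

text \<open>Below the k-fold backward jump of \<open>x\<close> the truncations have removed nothing,
  and the filter at \<open>t\<close> sees only points near \<open>t\<close>. Iterated derivatives
  can thus be handled on \<open>T\<close> itself.\<close>

lemma has_delta_deriv_kappa:
  assumes "closed T" "x \<in> T" "t < (bwd_jump T ^^ k) x"
  shows "has_delta_deriv ((kappa ^^ k) T) v t l \<longleftrightarrow> has_delta_deriv T v t l"
    "delta_at ((kappa ^^ k) T) t = delta_at T t"
proof -
  note c = kappa_subset[of k T] mem_kappa[OF assms(1,2)] funpow_bwd_jump(1)[OF assms(1,2)] assms(3)
  have f: "fwd_jump ((kappa ^^ k) T) t = fwd_jump T t" by (rule fwd_jump_cong_below[OF c])
  show *: "delta_at ((kappa ^^ k) T) t = delta_at T t" by (rule delta_at_cong_below[OF c])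
  show "has_delta_deriv ((kappa ^^ k) T) v t l \<longleftrightarrow> has_delta_deriv T v t l"
    unfolding has_delta_deriv_def * f ..
qed

lemma delta_at_neq_bot:
  assumes "closed T" "t \<in> T" "u \<in> T" "t < u"
  shows "delta_at T t \<noteq> bot"
proof
  assume "delta_at T t = bot"
  then have "eventually (\<lambda>_. False) (delta_at T t)" by simp
  then obtain d where d: "d > 0" "\<forall>s\<in>T. s \<noteq> fwd_jump T t \<longrightarrow> \<not> \<bar>s - t\<bar> < d"
    unfolding eventually_delta_at by blast
  show False
    using assms
  proof (cases rule: right_scattered_or_dense)
    case 1
    then show False using d assms(2) by auto
  next
    case 2
    from 2(2)[OF d(1)] obtain r where "r \<in> T" "t < r" "r < t + d" by blast
    then show False using d(2) 2(1) by force
  qed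
qed

section \<open>Partial derivatives as derivatives in one variable\<close>

lemma has_pd_iff: "has_pd S j f x l \<longleftrightarrow> has_delta_deriv S (\<lambda>t. f (x(j := t))) (x j) l"
  by (simp add: has_pd_def has_delta_deriv_def pd_quot_def[abs_def])

lemma has_pd_pd:
  assumes "has_pd S j f x l" "delta_at S (x j) \<noteq> bot"
  shows "pd S j f x = l"
  using assms tendsto_Lim unfolding pd_def has_pd_def by auto

text \<open>The strict bound on \<open>t\<close> makes the filter nontrivial; otherwise
  \<open>pd\<close> would be the default 0 rather than the limit.\<close>

lemma has_pd_upd:
  assumes ex: "\<exists>l. has_pd ((kappa ^^ k) T) j g (x(j := t)) l"
    and T: "closed T" "u \<in> T" "t \<in> T" "t < (bwd_jump T ^^ k) u"
  shows "has_delta_deriv T (\<lambda>s. g (x(j := s))) t (pd ((kappa ^^ k) T) j g (x(j := t)))"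
proof -
  from ex obtain l where l: "has_pd ((kappa ^^ k) T) j g (x(j := t)) l" by blast
  have "delta_at ((kappa ^^ k) T) t \<noteq> bot"
    using has_delta_deriv_kappa(2)[OF T(1,2,4)] delta_at_neq_bot[OF T(1,3) funpow_bwd_jump(1)[OF T(1,2)] T(4)] by simp
  then have "pd ((kappa ^^ k) T) j g (x(j := t)) = l"
    by (intro has_pd_pd[OF l]) simp
  moreover have "has_delta_deriv ((kappa ^^ k) T) (\<lambda>s. g (x(j := s))) t l"
    using l by (simp add: has_pd_iff)
  ultimately show ?thesis using has_delta_deriv_kappa(1)[OF T(1,2,4)] by simp
qed

text \<open>In contrast to the value of \<open>pd\<close>, continuity is available up to and
  including the k-fold backward jump of \<open>u\<close>, where the filter may be trivial. This
  closes the interval for the fundamental theorem.\<close>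

lemma has_pd_upd_cont:
  assumes ex: "\<And>t. t \<in> T \<Longrightarrow> c \<le> t \<Longrightarrow> t \<le> y \<Longrightarrow> \<exists>l. has_pd ((kappa ^^ k) T) j g (x(j := t)) l"
    and T: "closed T" "u \<in> T" "y \<le> (bwd_jump T ^^ k) u"
  shows "continuous_on (T \<inter> {c..y}) (\<lambda>s. g (x(j := s)))"
  unfolding continuous_on_eq_continuous_within
proof
  let ?S = "(kappa ^^ k) T"
  have sub: "T \<inter> {c..y} \<subseteq> ?S" using mem_kappa[OF T(1,2)] T(3) by auto
  fix t assume t: "t \<in> T \<inter> {c..y}"
  then obtain l where "has_pd ?S j g (x(j := t)) l" using ex by auto
  then have "has_delta_deriv ?S (\<lambda>s. g (x(j := s))) t l" by (simp add: has_pd_iff)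
  then have "continuous (at t within ?S) (\<lambda>s. g (x(j := s)))"
    using sub t by (intro has_delta_deriv_isCont) auto
  then show "continuous (at t within T \<inter> {c..y}) (\<lambda>s. g (x(j := s)))"
    using sub by (rule continuous_within_subset)
qed

lemma delta_integral_eq:
  assumes "closed T" "s \<le> t"
  shows "delta_integral T s t f = (\<integral>u. f u \<partial>delta_on T s t)"
  using assms by (simp add: delta_integral_def set_lebesgue_integral_def delta_on_def integral_restrict_space)

lemma emeasure_space_delta_on:
  assumes "closed T" "s \<in> T" "t \<in> T" "s \<le> t"
  shows "emeasure (delta_on T s t) (space (delta_on T s t)) = ennreal (t - s)"
  using emeasure_delta_on[OF assms(1), of UNIV s t] emeasure_delta_measure[of T s t] assms
  by (auto simp: time_scale_def)

lemma finite_measure_delta_on: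
  assumes "closed T" "s \<in> T" "t \<in> T" "s \<le> t"
  shows "finite_measure (delta_on T s t)"
  by (rule finite_measureI) (simp add: emeasure_space_delta_on[OF assms, simplified])

lemma measure_delta_on:
  assumes "closed T" "s \<in> T" "t \<in> T" "s \<le> t"
  shows "measure (delta_on T s t) (T \<inter> {s..<t}) = t - s"
  using emeasure_space_delta_on[OF assms] assms(4) by (simp add: measure_def)

section \<open>Integration over boxes of time scales\<close>

context product_sigma_finite
begin

text \<open>Both measures give rectangles the same mass. As a push-forward of a pair measure, the
  larger product inherits null sets and integrability of sections from Fubini's theorem.\<close>

lemma distr_fun_upd:
  assumes I: "finite I" "i \<notin> I"
  shows "distr (Pi\<^sub>M I M \<Otimes>\<^sub>M M i) (Pi\<^sub>M (insert i I) M) (\<lambda>(x, y). x(i := y)) = Pi\<^sub>M (insert i I) M"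
proof (rule PiM_eqI)
  interpret I: finite_product_sigma_finite M I by standard fact
  fix A assume A: "\<And>j. j \<in> insert i I \<Longrightarrow> A j \<in> sets (M j)"
  have *: "(\<lambda>(x, y). x(i := y)) -` Pi\<^sub>E (insert i I) A \<inter> space (Pi\<^sub>M I M \<Otimes>\<^sub>M M i) = Pi\<^sub>E I A \<times> A i"
    using A[THEN sets.sets_into_space] I(2)
    by (auto simp: space_PiM space_pair_measure PiE_def Pi_iff extensional_def fun_upd_def split: if_splits)
  have "emeasure (Pi\<^sub>M I M \<Otimes>\<^sub>M M i) (Pi\<^sub>E I A \<times> A i) = emeasure (Pi\<^sub>M I M) (Pi\<^sub>E I A) * emeasure (M i) (A i)"
    using A I by (intro sigma_finite_measure.emeasure_pair_measure_Times[OF sigma_finite_measures] sets_PiM_I_finite) auto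
  also have "\<dots> = (\<Prod>j\<in>insert i I. emeasure (M j) (A j))"
    using A I by (simp add: I.measure_times mult.commute)
  finally show "emeasure (distr (Pi\<^sub>M I M \<Otimes>\<^sub>M M i) (Pi\<^sub>M (insert i I) M) (\<lambda>(x, y). x(i := y))) (Pi\<^sub>E (insert i I) A)
      = (\<Prod>j\<in>insert i I. emeasure (M j) (A j))"
    using A I by (subst emeasure_distr) (auto simp: * intro!: sets_PiM_I_finite measurable_add_dim)
qed (use I in auto)

lemma
  fixes f :: "_ \<Rightarrow> real"
  assumes I: "finite I" "i \<notin> I"
  shows AE_PiM_insert: "AE x in Pi\<^sub>M (insert i I) M. P x \<Longrightarrow> AE x in Pi\<^sub>M I M. AE y in M i. P (x(i := y))"
    and integrable_PiM_insert: "integrable (Pi\<^sub>M (insert i I) M) f \<Longrightarrow>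
      integrable (Pi\<^sub>M I M) (\<lambda>x. \<integral>y. f (x(i := y)) \<partial>M i)"
    and AE_integrable_PiM_insert: "integrable (Pi\<^sub>M (insert i I) M) f \<Longrightarrow>
      AE x in Pi\<^sub>M I M. integrable (M i) (\<lambda>y. f (x(i := y)))"
proof -
  interpret I: finite_product_sigma_finite M I by standard fact
  interpret P: pair_sigma_finite "Pi\<^sub>M I M" "M i" ..
  have m: "(\<lambda>(x, y). x(i := y)) \<in> measurable (Pi\<^sub>M I M \<Otimes>\<^sub>M M i) (Pi\<^sub>M (insert i I) M)"
    by (rule measurable_add_dim)
  {
    assume "AE x in Pi\<^sub>M (insert i I) M. P x"
    then have "AE z in Pi\<^sub>M I M \<Otimes>\<^sub>M M i. P ((\<lambda>(x, y). x(i := y)) z)"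
      by (rule AE_distrD[OF m, unfolded distr_fun_upd[OF I]])
    then have "AE x in Pi\<^sub>M I M. AE y in M i. P ((\<lambda>(x, y). x(i := y)) (x, y))"
      by (rule P.AE_pair)
    then show "AE x in Pi\<^sub>M I M. AE y in M i. P (x(i := y))" by simp
  }
  assume f: "integrable (Pi\<^sub>M (insert i I) M) f"
  then have "integrable (distr (Pi\<^sub>M I M \<Otimes>\<^sub>M M i) (Pi\<^sub>M (insert i I) M) (\<lambda>(x, y). x(i := y))) f"
    unfolding distr_fun_upd[OF I] .
  then have "integrable (Pi\<^sub>M I M \<Otimes>\<^sub>M M i) (\<lambda>z. f ((\<lambda>(x, y). x(i := y)) z))"
    by (rule integrable_distr[OF m])
  then have *: "integrable (Pi\<^sub>M I M \<Otimes>\<^sub>M M i) (case_prod (\<lambda>x y. f (x(i := y))))"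
    by (simp add: split_def)
  show "integrable (Pi\<^sub>M I M) (\<lambda>x. \<integral>y. f (x(i := y)) \<partial>M i)" by (rule P.integrable_fst[OF *])
  show "AE x in Pi\<^sub>M I M. integrable (M i) (\<lambda>y. f (x(i := y)))" by (rule P.AE_integrable_fst[OF *])
qed

end

section \<open>Restriction of a time scale to a half-line\<close>

lemma fwd_jump_Int_atLeast:
  assumes "a \<le> t"
  shows "fwd_jump (T \<inter> {a..}) t = fwd_jump T t"
proof -
  have "{s \<in> T \<inter> {a..}. t < s} = {s \<in> T. t < s}" using assms by auto
  then show ?thesis using assms by (auto simp: fwd_jump_def intro: less_imp_le order_trans)
qed

text \<open>At \<open>t = a\<close> the restriction discards points to the left, so the filter may
  get finer; beyond \<open>a\<close> it agrees with the old one near \<open>t\<close>.\<close>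

lemma delta_at_Int_atLeast:
  assumes "a \<le> t"
  shows "delta_at (T \<inter> {a..}) t \<le> delta_at T t"
    and "a < t \<Longrightarrow> delta_at (T \<inter> {a..}) t = delta_at T t"
proof -
  note f = fwd_jump_Int_atLeast[OF assms]
  show le: "delta_at (T \<inter> {a..}) t \<le> delta_at T t"
    by (rule filter_leI) (auto simp: eventually_delta_at f)
  assume at: "a < t"
  have "delta_at T t \<le> delta_at (T \<inter> {a..}) t"
  proof (rule filter_leI)
    fix P assume "eventually P (delta_at (T \<inter> {a..}) t)"
    then obtain d where d: "d > 0" "\<forall>s\<in>T \<inter> {a..}. s \<noteq> fwd_jump T t \<longrightarrow> \<bar>s - t\<bar> < d \<longrightarrow> P s"
      unfolding eventually_delta_at f by blast
    then show "eventually P (delta_at T t)"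
      unfolding eventually_delta_at using at by (intro exI[of _ "min d (t - a)"]) auto
  qed
  with le show "delta_at (T \<inter> {a..}) t = delta_at T t" by (rule antisym)
qed

lemma has_delta_deriv_Int_atLeast:
  assumes "a \<le> t"
  shows "has_delta_deriv T v t l \<Longrightarrow> has_delta_deriv (T \<inter> {a..}) v t l"
    and "a < t \<Longrightarrow> has_delta_deriv (T \<inter> {a..}) v t l \<Longrightarrow> has_delta_deriv T v t l"
  using delta_at_Int_atLeast[OF assms, of T] fwd_jump_Int_atLeast[OF assms, of T]
  by (auto simp: has_delta_deriv_def intro: tendsto_mono)

lemma has_delta_deriv_unique:
  assumes "closed T" "t \<in> T" "u \<in> T" "t < u" "has_delta_deriv T v t l" "has_delta_deriv T v t m"
  shows "l = m"
  using tendsto_unique[OF delta_at_neq_bot[OF assms(1-4)]] assms(5,6) unfolding has_delta_deriv_def .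

lemma has_delta_deriv_cong:
  assumes "u \<in> T" "t < u" "closed T" "\<And>s. s \<in> T \<Longrightarrow> s \<le> u \<Longrightarrow> v s = w s" "has_delta_deriv T v t l"
  shows "has_delta_deriv T w t l"
proof -
  have "v (fwd_jump T t) = w (fwd_jump T t)"
    using assms fwd_jump_mem[OF assms(3,1,2)] fwd_jump_less_le(2)[OF assms(1,2)] by auto
  then have "eventually (\<lambda>s. (v (fwd_jump T t) - v s) / (fwd_jump T t - s) = (w (fwd_jump T t) - w s) / (fwd_jump T t - s)) (delta_at T t)"
    unfolding eventually_delta_at using assms(2,4) by (intro exI[of _ "u - t"]) auto
  then show ?thesis
    using assms(5) unfolding has_delta_deriv_def by (rule tendsto_cong[THEN iffD1])
qed

text \<open>At \<open>t = a\<close> the values of \<open>v\<close> to the left are unknown. The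
  limit exists by assumption and is computed from the right, on \<open>T \<inter> {a..}\<close>,
  where it is unique.\<close>

lemma has_delta_deriv_eq_0:
  assumes "closed T" "t \<in> T" "u \<in> T" "a \<le> t" "t < u" "has_delta_deriv T v t l"
    and "\<And>s. s \<in> T \<Longrightarrow> a \<le> s \<Longrightarrow> s \<le> u \<Longrightarrow> v s = 0"
  shows "l = 0"
proof (rule has_delta_deriv_unique[of "T \<inter> {a..}" t u v])
  show "has_delta_deriv (T \<inter> {a..}) v t l" by (rule has_delta_deriv_Int_atLeast(1)[OF assms(4,6)])
  have "has_delta_deriv (T \<inter> {a..}) (\<lambda>_. 0) t 0" by (simp add: has_delta_deriv_def)
  then show "has_delta_deriv (T \<inter> {a..}) v t 0"
    by (rule has_delta_deriv_cong[rotated -1]) (use assms in auto)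
qed (use assms in auto)

lemma has_delta_deriv_cmult:
  assumes "has_delta_deriv T v t l"
  shows "has_delta_deriv T (\<lambda>s. c * v s) t (c * l)"
proof -
  have "((\<lambda>s. c * ((v (fwd_jump T t) - v s) / (fwd_jump T t - s))) \<longlongrightarrow> c * l) (delta_at T t)"
    using assms unfolding has_delta_deriv_def by (intro tendsto_intros)
  then show ?thesis by (simp add: has_delta_deriv_def right_diff_distrib)
qed

text \<open>The first \<open>j\<close> coordinates are integration variables taken from
  \<open>y\<close>; the others stay at those of the upper corner \<open>x\<close>.\<close>

definition overwrite :: "nat \<Rightarrow> (nat \<Rightarrow> 'a) \<Rightarrow> (nat \<Rightarrow> 'a) \<Rightarrow> nat \<Rightarrow> 'a" where
  "overwrite j y x = (\<lambda>i. if i \<in> {1..j} then y i else x i)"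

lemma overwrite_Suc: "overwrite (Suc j) (y(Suc j := t)) x = (overwrite j y x)(Suc j := t)"
  by (auto simp: overwrite_def fun_eq_iff)

lemma overwrite_0 [simp]: "overwrite 0 y x = x"
  by (simp add: overwrite_def)

section \<open>Boxes and their iterated integrals\<close>

locale time_scale_box =
  fixes n :: nat and T :: "nat \<Rightarrow> real set" and a b :: "nat \<Rightarrow> real"
  assumes closed_T: "j \<in> {1..n} \<Longrightarrow> closed (T j)"
    and a_mem: "j \<in> {1..n} \<Longrightarrow> a j \<in> T j" and b_mem: "j \<in> {1..n} \<Longrightarrow> b j \<in> T j"
    and a_le_b: "j \<in> {1..n} \<Longrightarrow> a j \<le> b j"
begin

abbreviation box :: "(nat \<Rightarrow> real) set" where
  "box \<equiv> ts_box n T a b"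

text \<open>Unlike membership in \<open>box\<close>, this imposes no value outside
  \<open>{1..n}\<close>, so that \<open>b\<close> itself qualifies.\<close>

definition corner :: "(nat \<Rightarrow> real) \<Rightarrow> bool" where
  "corner x \<longleftrightarrow> (\<forall>j\<in>{1..n}. x j \<in> T j \<and> a j \<le> x j \<and> x j \<le> b j)"

text \<open>The Lebesgue measure is a filler: \<open>product_sigma_finite\<close> asks for a
  sigma-finite measure at every index.\<close>

definition axis_measure :: "(nat \<Rightarrow> real) \<Rightarrow> nat \<Rightarrow> real measure" where
  "axis_measure x j = (if j \<in> {1..n} then delta_on (T j) (a j) (x j) else lborel)"

abbreviation box_meas :: "nat \<Rightarrow> (nat \<Rightarrow> real) \<Rightarrow> (nat \<Rightarrow> real) measure" where
  "box_meas m x \<equiv> Pi\<^sub>M {1..m} (axis_measure x)"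

lemma box_corner: "x \<in> box \<Longrightarrow> corner x"
  by (auto simp: ts_box_def corner_def dest: PiE_mem)

lemma corner_b: "corner b"
  using b_mem a_le_b by (simp add: corner_def)

lemma boxD:
  assumes "x \<in> box" "j \<in> {1..n}"
  shows "x j \<in> T j" "a j \<le> x j" "x j \<le> b j"
  using box_corner[OF assms(1)] assms(2) by (auto simp: corner_def)

lemma box_upd: "x \<in> box \<Longrightarrow> j \<in> {1..n} \<Longrightarrow> t \<in> T j \<Longrightarrow> a j \<le> t \<Longrightarrow> t \<le> b j \<Longrightarrow> x(j := t) \<in> box"
  by (auto simp: ts_box_def PiE_def extensional_def)

lemma product_sigma_finite_axis:
  assumes "corner x"
  shows "product_sigma_finite (axis_measure x)"
proof -
  have "sigma_finite_measure (axis_measure x j)" if "j \<in> {1..n}" for j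
  proof -
    interpret finite_measure "delta_on (T j) (a j) (x j)"
      using assms closed_T a_mem that by (intro finite_measure_delta_on) (auto simp: corner_def)
    show ?thesis using that sigma_finite_measure_axioms by (simp add: axis_measure_def)
  qed
  moreover have "sigma_finite_measure (axis_measure x j)" if "j \<notin> {1..n}" for j
    unfolding axis_measure_def if_not_P[OF that] by (rule lborel.sigma_finite_measure_axioms)
  ultimately show ?thesis unfolding product_sigma_finite_def by blast
qed

lemma finite_measure_axis:
  assumes "corner x" "j \<in> {1..n}"
  shows "finite_measure (axis_measure x j)"
  using assms closed_T a_mem by (simp add: axis_measure_def finite_measure_delta_on corner_def)

lemma space_axis_measure: "j \<in> {1..n} \<Longrightarrow> space (axis_measure x j) = T j \<inter> {a j..<x j}"
  by (simp add: axis_measure_def)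

lemma space_PiM_axis: "j \<le> n \<Longrightarrow> space (box_meas j x) = (\<Pi>\<^sub>E i\<in>{1..j}. T i \<inter> {a i..<x i})"
  by (auto simp: space_PiM intro!: PiE_cong simp: space_axis_measure)

lemma box_measure_eq: "box_measure n T a b = box_meas n b"
  unfolding box_measure_def by (intro PiM_cong) (auto simp: axis_measure_def delta_on_def)

lemma overwrite_box:
  assumes "x \<in> box" "j \<le> n" "y \<in> space (box_meas j x)"
  shows "overwrite j y x \<in> box" "\<And>i. i \<in> {1..j} \<Longrightarrow> overwrite j y x i < x i"
proof -
  have yE: "y \<in> (\<Pi>\<^sub>E i\<in>{1..j}. T i \<inter> {a i..<x i})"
    using assms(3) unfolding space_PiM_axis[OF assms(2)] .
  have y: "y i \<in> T i" "a i \<le> y i" "y i < x i" if "i \<in> {1..j}" for i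
    using PiE_mem[OF yE that] by auto
  have "overwrite j y x i \<in> T i \<inter> {a i..b i}" if "i \<in> {1..n}" for i
    using y[of i] boxD[OF assms(1) that] by (auto simp: overwrite_def)
  moreover have "overwrite j y x i = undefined" if "i \<notin> {1..n}" for i
    using assms(1,2) that by (auto simp: overwrite_def ts_box_def PiE_def extensional_def)
  ultimately show "overwrite j y x \<in> box" unfolding ts_box_def by (intro PiE_I) auto
  show "\<And>i. i \<in> {1..j} \<Longrightarrow> overwrite j y x i < x i" using y by (simp add: overwrite_def)
qed

lemma mixed_pd_1_exists:
  assumes "mixed_pd_exists T box (\<lambda>_. 1) n \<psi>" "Suc j \<le> n" "x \<in> box"
  shows "\<exists>l. has_pd ((kappa ^^ 0) (T (Suc j))) (Suc j) (mixed_pd T (\<lambda>_. 1) j \<psi>) x l"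
  using assms unfolding mixed_pd_exists_def by (force dest: bspec[of _ _ "Suc j"])

text \<open>Difference quotients in the other variables stay on the face \<open>z i = a i\<close>,
  where all values in the box are 0. The bounds \<open>z m < b m\<close> keep the forward jumps
  inside the box and the limits unique.\<close>

lemma mixed_pd_1_zero:
  assumes ex: "mixed_pd_exists T box (\<lambda>_. 1) n \<psi>" and i: "i \<in> {1..n}"
    and zero: "\<And>z. z \<in> box \<Longrightarrow> z i = a i \<Longrightarrow> \<psi> z = 0"
  shows "l < i \<Longrightarrow> z \<in> box \<Longrightarrow> z i = a i \<Longrightarrow> (\<And>m. m \<in> {1..l} \<Longrightarrow> z m < b m) \<Longrightarrow> mixed_pd T (\<lambda>_. 1) l \<psi> z = 0"
proof (induction l arbitrary: z)
  case 0
  then show ?case using zero by simp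
next
  case (Suc l)
  let ?j = "Suc l"
  have j: "?j \<in> {1..n}" using Suc.prems(1) i by auto
  note zj = boxD[OF Suc.prems(2) j]
  have lt: "z ?j < b ?j" using Suc.prems(4) by simp
  have "has_delta_deriv (T ?j) (\<lambda>s. mixed_pd T (\<lambda>_. 1) l \<psi> (z(?j := s))) (z ?j)
      (pd ((kappa ^^ 0) (T ?j)) ?j (mixed_pd T (\<lambda>_. 1) l \<psi>) (z(?j := z ?j)))"
    using mixed_pd_1_exists[OF ex _ Suc.prems(2)] j closed_T[OF j] b_mem[OF j] zj lt
    by (intro has_pd_upd) auto
  then have d: "has_delta_deriv (T ?j) (\<lambda>s. mixed_pd T (\<lambda>_. 1) l \<psi> (z(?j := s))) (z ?j) (mixed_pd T (\<lambda>_. 1) ?j \<psi> z)"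
    by simp
  show ?case
  proof (rule has_delta_deriv_eq_0[OF closed_T[OF j] zj(1) b_mem[OF j] zj(2) lt d])
    fix s assume s: "s \<in> T ?j" "a ?j \<le> s" "s \<le> b ?j"
    show "mixed_pd T (\<lambda>_. 1) l \<psi> (z(?j := s)) = 0"
      using Suc.prems j s by (intro Suc.IH box_upd) auto
  qed
qed

text \<open>Each induction step integrates out one variable: on a section, the mixed derivative of
  order \<open>j + 1\<close> is the delta derivative of the one of order \<open>j\<close>, whose
  boundary value vanishes. Only \<open>Q\<close> is integrated jointly. The factor \<open>A\<close>
  may have either sign, which gives upper and lower bounds for \<open>\<psi>\<close>.\<close>

lemma scaled_le_integral:
  assumes x: "x \<in> box" and ex: "mixed_pd_exists T box (\<lambda>_. 1) n \<psi>"
    and zero: "\<And>z i. z \<in> box \<Longrightarrow> i \<in> {1..n} \<Longrightarrow> z i = a i \<Longrightarrow> \<psi> z = 0"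
  shows "j \<le> n \<Longrightarrow> integrable (box_meas j x) Q \<Longrightarrow>
    AE y in box_meas j x. A * mixed_pd T (\<lambda>_. 1) j \<psi> (overwrite j y x) \<le> Q y \<Longrightarrow>
    A * \<psi> x \<le> (\<integral>y. Q y \<partial>box_meas j x)"
proof (induction j arbitrary: Q)
  case 0
  have e: "Pi\<^sub>M {1..0::nat} (axis_measure x) = count_space {\<lambda>_. undefined}" by (simp add: PiM_empty)
  then show ?case
    using 0(2,3) unfolding e by (simp add: AE_count_space lebesgue_integral_count_space_finite del: One_nat_def)
next
  case (Suc j)
  interpret product_sigma_finite "axis_measure x"
    by (rule product_sigma_finite_axis[OF box_corner[OF x]])
  let ?i = "Suc j"
  have i: "?i \<in> {1..n}" using Suc.prems(1) by auto
  have I: "finite {1..j}" "?i \<notin> {1..j}" by auto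
  have ins: "{1..Suc j} = insert ?i {1..j}" by auto
  note int = Suc.prems(2)[unfolded ins] and AE = Suc.prems(3)[unfolded ins]
  define Q' where "Q' y = (\<integral>t. Q (y(?i := t)) \<partial>axis_measure x ?i)" for y
  have Q': "integrable (box_meas j x) Q'"
    unfolding Q'_def by (rule integrable_PiM_insert[OF I int])
  have "AE y in box_meas j x. A * mixed_pd T (\<lambda>_. 1) j \<psi> (overwrite j y x) \<le> Q' y"
    using AE_PiM_insert[OF I AE] AE_integrable_PiM_insert[OF I int] AE_space
  proof eventually_elim
    fix y
    assume le: "AE t in axis_measure x ?i. A * mixed_pd T (\<lambda>_. 1) ?i \<psi> (overwrite ?i (y(?i := t)) x) \<le> Q (y(?i := t))"
      and Qy: "integrable (axis_measure x ?i) (\<lambda>t. Q (y(?i := t)))"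
      and y: "y \<in> space (box_meas j x)"
    define z where "z = overwrite j y x"
    have z: "z \<in> box" "\<And>m. m \<in> {1..j} \<Longrightarrow> z m < b m"
      using overwrite_box(1)[OF x _ y] order.strict_trans2[OF overwrite_box(2)[OF x _ y] boxD(3)[OF x]] Suc.prems(1)
      unfolding z_def by auto
    have zi: "z ?i = x ?i" by (simp add: z_def overwrite_def)
    note xi = boxD[OF x i]
    let ?g = "mixed_pd T (\<lambda>_. 1) j \<psi>"
    have zb: "z(?i := t) \<in> box" if "t \<in> T ?i" "a ?i \<le> t" "t \<le> x ?i" for t
      using that xi z i by (intro box_upd) auto
    have "A * ?g (z(?i := x ?i)) - A * ?g (z(?i := a ?i)) \<le> (\<integral>t. Q (y(?i := t)) \<partial>delta_on (T ?i) (a ?i) (x ?i))"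
    proof (rule delta_deriv_le_integral[OF closed_T[OF i] a_mem[OF i] xi(1,2)])
      show "continuous_on (T ?i \<inter> {a ?i..x ?i}) (\<lambda>t. A * ?g (z(?i := t)))"
        by (intro continuous_intros has_pd_upd_cont[where k = 0 and u = "b ?i"])
          (use mixed_pd_1_exists[OF ex Suc.prems(1) zb] closed_T[OF i] b_mem[OF i] xi in auto)
      fix t assume t: "t \<in> T ?i" "a ?i \<le> t" "t < x ?i"
      have "has_delta_deriv (T ?i) (\<lambda>s. ?g (z(?i := s))) t (pd ((kappa ^^ 0) (T ?i)) ?i ?g (z(?i := t)))"
        using mixed_pd_1_exists[OF ex Suc.prems(1) zb] t closed_T[OF i] b_mem[OF i] xi
        by (intro has_pd_upd) auto
      then show "has_delta_deriv (T ?i) (\<lambda>s. A * ?g (z(?i := s))) t (A * mixed_pd T (\<lambda>_. 1) ?i \<psi> (z(?i := t)))"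
        by (intro has_delta_deriv_cmult) simp
    next
      show "integrable (delta_on (T ?i) (a ?i) (x ?i)) (\<lambda>t. Q (y(?i := t)))"
        using Qy i by (simp add: axis_measure_def)
      show "AE t in delta_on (T ?i) (a ?i) (x ?i). A * mixed_pd T (\<lambda>_. 1) ?i \<psi> (z(?i := t)) \<le> Q (y(?i := t))"
        using le unfolding overwrite_Suc z_def axis_measure_def if_P[OF i] .
    qed
    moreover have "?g (z(?i := a ?i)) = 0"
      using z zb[of "a ?i"] a_mem[OF i] xi by (intro mixed_pd_1_zero[OF ex i zero[OF _ i]]) auto
    moreover have "z(?i := x ?i) = z" using zi by (metis fun_upd_triv)
    ultimately show "A * mixed_pd T (\<lambda>_. 1) j \<psi> (overwrite j y x) \<le> Q' y"
      using i by (simp add: Q'_def axis_measure_def z_def del: mixed_pd.simps)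
  qed
  then have "A * \<psi> x \<le> integral\<^sup>L (box_meas j x) Q'"
    using Suc.prems(1) Q' by (intro Suc.IH) auto
  also have "\<dots> = (\<integral>y. Q y \<partial>box_meas ?i x)"
    unfolding ins Q'_def by (rule product_integral_insert[OF I int, symmetric])
  finally show ?case .
qed

lemma iter_integral_eq:
  "j \<le> n \<Longrightarrow> integrable (box_meas j b) v \<Longrightarrow>
    iter_integral T a b j v = (\<integral>y. v y \<partial>box_meas j b)"
proof (induction j arbitrary: v)
  case 0
  then show ?case by (simp add: PiM_empty lebesgue_integral_count_space_finite)
next
  case (Suc j)
  interpret product_sigma_finite "axis_measure b" by (rule product_sigma_finite_axis[OF corner_b])
  have i: "Suc j \<in> {1..n}" using Suc.prems(1) by auto
  have I: "finite {1..j}" "Suc j \<notin> {1..j}" by auto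
  have ins: "{1..Suc j} = insert (Suc j) {1..j}" by auto
  note int = Suc.prems(2)[unfolded ins]
  have "delta_integral (T (Suc j)) (a (Suc j)) (b (Suc j)) g = (\<integral>t. g t \<partial>axis_measure b (Suc j))" for g
    using i closed_T a_le_b by (simp add: delta_integral_eq axis_measure_def)
  then have "iter_integral T a b (Suc j) v = iter_integral T a b j (\<lambda>y. \<integral>t. v (y(Suc j := t)) \<partial>axis_measure b (Suc j))"
    by simp
  also have "\<dots> = (\<integral>y. (\<integral>t. v (y(Suc j := t)) \<partial>axis_measure b (Suc j)) \<partial>box_meas j b)"
    using Suc.prems(1) by (intro Suc.IH integrable_PiM_insert[OF I int]) simp
  also have "\<dots> = (\<integral>y. v y \<partial>Pi\<^sub>M {1..Suc j} (axis_measure b))"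
    unfolding ins by (rule product_integral_insert[OF I int, symmetric])
  finally show ?case .
qed

text \<open>A non-integrable section of \<open>u\<close> contributes \<open>0\<close> to the iterated integral.\<close>

lemma iter_integral_le:
  "j \<le> n \<Longrightarrow> integrable (box_meas j b) v \<Longrightarrow>
    (\<And>y. y \<in> space (box_meas j b) \<Longrightarrow> 0 \<le> u y) \<Longrightarrow>
    AE y in box_meas j b. u y \<le> v y \<Longrightarrow>
    iter_integral T a b j u \<le> (\<integral>y. v y \<partial>box_meas j b)"
proof (induction j arbitrary: u v)
  case 0
  have e: "Pi\<^sub>M {1..0::nat} (axis_measure b) = count_space {\<lambda>_. undefined}" by (simp add: PiM_empty)
  then show ?case
    using 0(2,4) unfolding e by (simp add: AE_count_space lebesgue_integral_count_space_finite del: One_nat_def)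
next
  case (Suc j)
  interpret product_sigma_finite "axis_measure b" by (rule product_sigma_finite_axis[OF corner_b])
  let ?M = "axis_measure b (Suc j)"
  have i: "Suc j \<in> {1..n}" using Suc.prems(1) by auto
  have I: "finite {1..j}" "Suc j \<notin> {1..j}" by auto
  have ins: "{1..Suc j} = insert (Suc j) {1..j}" by auto
  note int = Suc.prems(2)[unfolded ins] and AE = Suc.prems(4)[unfolded ins]
  have eq: "delta_integral (T (Suc j)) (a (Suc j)) (b (Suc j)) g = (\<integral>t. g t \<partial>?M)" for g
    using i closed_T a_le_b by (simp add: delta_integral_eq axis_measure_def)
  have u0: "0 \<le> u (y(Suc j := t))" if "y \<in> space (box_meas j b)" "t \<in> space ?M" for y t
    unfolding ins using PiE_fun_upd[OF that(2) that(1)[unfolded space_PiM]]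
    by (intro Suc.prems(3)) (simp only: ins space_PiM)
  have "iter_integral T a b (Suc j) u = iter_integral T a b j (\<lambda>y. \<integral>t. u (y(Suc j := t)) \<partial>?M)"
    by (simp add: eq)
  also have "\<dots> \<le> (\<integral>y. (\<integral>t. v (y(Suc j := t)) \<partial>?M) \<partial>box_meas j b)"
  proof (rule Suc.IH)
    show "j \<le> n" using Suc.prems(1) by simp
    show "integrable (box_meas j b) (\<lambda>y. \<integral>t. v (y(Suc j := t)) \<partial>?M)"
      by (rule integrable_PiM_insert[OF I int])
    show "0 \<le> (\<integral>t. u (y(Suc j := t)) \<partial>?M)" if "y \<in> space (box_meas j b)" for y
      using u0[OF that] by (intro Bochner_Integration.integral_nonneg_AE AE_I2) auto
    show "AE y in box_meas j b. (\<integral>t. u (y(Suc j := t)) \<partial>?M) \<le> (\<integral>t. v (y(Suc j := t)) \<partial>?M)"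
      using AE_PiM_insert[OF I AE] AE_integrable_PiM_insert[OF I int] AE_space
    proof eventually_elim
      fix y
      assume le: "AE t in ?M. u (y(Suc j := t)) \<le> v (y(Suc j := t))"
        and v: "integrable ?M (\<lambda>t. v (y(Suc j := t)))"
        and y: "y \<in> space (box_meas j b)"
      have "AE t in ?M. 0 \<le> v (y(Suc j := t))"
        using le AE_space by eventually_elim (use u0[OF y] order_trans in blast)
      then show "(\<integral>t. u (y(Suc j := t)) \<partial>?M) \<le> (\<integral>t. v (y(Suc j := t)) \<partial>?M)"
        by (rule integral_mono_AE'[OF v le])
    qed
  qed
  also have "\<dots> = (\<integral>y. v y \<partial>Pi\<^sub>M {1..Suc j} (axis_measure b))"
    unfolding ins by (rule product_integral_insert[OF I int, symmetric])
  finally show ?case .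
qed

end

section \<open>Iterated primitives and Taylor's formula\<close>

lemma tendsto_fun_iff:
  fixes f :: "'a \<Rightarrow> 'i \<Rightarrow> 'b::topological_space"
  shows "(f \<longlongrightarrow> l) F \<longleftrightarrow> (\<forall>i. ((\<lambda>x. f x i) \<longlongrightarrow> l i) F)"
  by (simp add: limitin_componentwise flip: limitin_canonical_iff euclidean_product_topology)

lemma delta_integral_bound:
  assumes T: "closed S" "s \<in> S" "t \<in> S" "s \<le> t" and C: "\<And>u. u \<in> S \<Longrightarrow> s \<le> u \<Longrightarrow> u < t \<Longrightarrow> \<bar>h u\<bar> \<le> C"
  shows "\<bar>\<integral>u. h u \<partial>delta_on S s t\<bar> \<le> C * (t - s)"
proof (cases "integrable (delta_on S s t) h")
  case True
  interpret finite_measure "delta_on S s t" by (rule finite_measure_delta_on[OF T])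
  have "\<bar>\<integral>u. h u \<partial>delta_on S s t\<bar> \<le> (\<integral>u. \<bar>h u\<bar> \<partial>delta_on S s t)" by simp
  also have "\<dots> \<le> (\<integral>u. C \<partial>delta_on S s t)" using True C by (intro integral_mono) auto
  also have "\<dots> = C * (t - s)" using measure_delta_on[OF T] by simp
  finally show ?thesis .
next
  case False
  \<comment> \<open>The default integral is 0. A nonempty interval forces \<open>C\<close> to be
    non-negative through its value at \<open>s\<close>.\<close>
  have "0 \<le> C * (t - s)"
    using C[of s] T by (cases "s = t") (auto intro!: mult_nonneg_nonneg)
  then show ?thesis using False by (simp add: not_integrable_integral_eq)
qed

section \<open>Bounded Borel functions on a box\<close>

context time_scale_box
begin

text \<open>The sides are closed, in contrast to those of the integration measures: the upper corner
  \<open>x\<close> of a box of integration may have \<open>x j = b j\<close>.\<close>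

definition box_space :: "(nat \<Rightarrow> real) measure" where
  "box_space = Pi\<^sub>M {1..n} (\<lambda>j. restrict_space borel (T j \<inter> {a j..b j}))"

text \<open>This class takes the place of the rd-continuous functions, because it is preserved by
  partial integration, freezing a coordinate and linear combinations.\<close>

definition bmeas :: "((nat \<Rightarrow> real) \<Rightarrow> real) \<Rightarrow> bool" where
  "bmeas q \<longleftrightarrow> q \<in> borel_measurable box_space \<and> (\<exists>C. \<forall>x\<in>box. \<bar>q x\<bar> \<le> C)"

lemma space_box_space: "space box_space = box"
  by (auto simp: box_space_def space_PiM ts_box_def space_restrict_space intro!: PiE_cong)

lemma measurable_box_coord:
  assumes "j \<in> {1..n}"
  shows "(\<lambda>x. x j) \<in> borel_measurable box_space"
proof -
  have "(\<lambda>x. x j) \<in> measurable box_space (restrict_space borel (T j \<inter> {a j..b j}))"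
    unfolding box_space_def by (rule measurable_component_singleton[OF assms])
  then show ?thesis by (simp add: measurable_restrict_space2_iff)
qed

text \<open>An extensional product is a full product with the singleton \<open>{undefined}\<close>
  at the remaining indices, to which Tychonoff's theorem applies.\<close>

lemma compact_box: "compact box"
proof -
  have box: "box = (\<Pi>\<^sub>E j\<in>UNIV. if j \<in> {1..n} then T j \<inter> {a j..b j} else {undefined})"
    by (auto simp: ts_box_def PiE_def extensional_def Pi_def)
  have "compact (T j \<inter> {a j..b j})" if "j \<in> {1..n}" for j
    using closed_T[OF that] by (intro closed_Int_compact) auto
  then have "compactin (product_topology (\<lambda>_. euclidean) UNIV)
      (\<Pi>\<^sub>E j\<in>UNIV. if j \<in> {1..n} then T j \<inter> {a j..b j} else {undefined})"
    by (subst compactin_PiE) (auto simp: compactin_euclidean_iff)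
  then show ?thesis unfolding box by (simp add: euclidean_product_topology compactin_euclidean_iff)
qed

text \<open>Points where \<open>q\<close> is ever larger would have a convergent subsequence. Around
  its limit there are finitely many orthants, and \<open>q\<close> has a finite limit along each of
  them, hence is bounded nearby.\<close>

lemma rd_continuous_bounded:
  assumes rd: "rd_continuous n T box q"
  shows "\<exists>C. \<forall>x\<in>box. \<bar>q x\<bar> \<le> C"
proof (rule ccontr)
  assume "\<not> ?thesis"
  then have "\<forall>k::nat. \<exists>x\<in>box. real k < \<bar>q x\<bar>" by (meson not_less)
  then obtain X where X: "\<And>k. X k \<in> box" "\<And>k::nat. real k < \<bar>q (X k)\<bar>" by metis
  obtain x r where x: "x \<in> box" and r: "strict_mono r" and lim: "(X \<circ> r) \<longlonglongrightarrow> x"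
    using compact_imp_seq_compact[OF compact_box] X(1) unfolding seq_compact_def by meson
  let ?S = "\<lambda>L. {t \<in> box. \<forall>j\<in>{1..n}. if j \<in> L then t j < x j else x j \<le> t j}"
  have "\<exists>C. eventually (\<lambda>t. t \<in> ?S L \<longrightarrow> \<bar>q t\<bar> \<le> C) (nhds x)" if L: "L \<subseteq> {1..n}" for L
  proof -
    obtain l where l: "(q \<longlongrightarrow> l) (at x within ?S L)"
      using rd[unfolded rd_continuous_def, rule_format, OF x L] by blast
    have "eventually (\<lambda>t. dist (q t) l < 1) (at x within ?S L)" using tendstoD[OF l, of 1] by simp
    then have "eventually (\<lambda>t. t \<noteq> x \<longrightarrow> t \<in> ?S L \<longrightarrow> dist (q t) l < 1) (nhds x)"
      unfolding eventually_at_filter by simp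
    then have "eventually (\<lambda>t. t \<in> ?S L \<longrightarrow> \<bar>q t\<bar> \<le> max (\<bar>l\<bar> + 1) \<bar>q x\<bar>) (nhds x)"
      by eventually_elim (auto simp: dist_real_def)
    then show ?thesis by blast
  qed
  then have "\<forall>L\<in>Pow {1..n}. \<exists>C. eventually (\<lambda>t. t \<in> ?S L \<longrightarrow> \<bar>q t\<bar> \<le> C) (nhds x)" by blast
  then obtain C where C: "\<And>L. L \<in> Pow {1..n} \<Longrightarrow> eventually (\<lambda>t. t \<in> ?S L \<longrightarrow> \<bar>q t\<bar> \<le> C L) (nhds x)"
    by (auto simp: bchoice_iff)
  have "eventually (\<lambda>t. \<forall>L\<in>Pow {1..n}. t \<in> ?S L \<longrightarrow> \<bar>q t\<bar> \<le> C L) (nhds x)"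
    using C by (intro eventually_ball_finite) auto
  then have ev: "eventually (\<lambda>k. \<forall>L\<in>Pow {1..n}. X (r k) \<in> ?S L \<longrightarrow> \<bar>q (X (r k))\<bar> \<le> C L) sequentially"
    using lim unfolding filterlim_iff comp_def by blast
  define D where "D = Max (C ` Pow {1..n})"
  have "eventually (\<lambda>k. \<bar>q (X (r k))\<bar> \<le> D) sequentially"
    using ev
  proof eventually_elim
    fix k assume *: "\<forall>L\<in>Pow {1..n}. X (r k) \<in> ?S L \<longrightarrow> \<bar>q (X (r k))\<bar> \<le> C L"
    let ?L = "{j \<in> {1..n}. X (r k) j < x j}"
    have "?L \<in> Pow {1..n}" by auto
    moreover have "X (r k) \<in> ?S ?L" using X(1) by auto
    ultimately have "\<bar>q (X (r k))\<bar> \<le> C ?L" using * by blast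
    also have "\<dots> \<le> D" unfolding D_def by (intro Max_ge) auto
    finally show "\<bar>q (X (r k))\<bar> \<le> D" .
  qed
  moreover have "eventually (\<lambda>k. D < real k) sequentially"
    using filterlim_real_sequentially by (simp add: filterlim_at_top_dense)
  ultimately have "eventually (\<lambda>k. False) sequentially"
  proof eventually_elim
    fix k assume "\<bar>q (X (r k))\<bar> \<le> D" "D < real k"
    moreover have "real k \<le> real (r k)" using seq_suble[OF r] by simp
    ultimately show False using X(2)[of "r k"] by simp
  qed
  then show False by simp
qed

text \<open>For the orthant with no coordinate from the left, the condition that identifies the
  limit with the value is vacuously satisfied.\<close>

lemma rd_continuous_right:
  assumes rd: "rd_continuous n T box q" and x: "x \<in> box"
    and X: "\<And>k. X k \<in> box" "\<And>k j. j \<in> {1..n} \<Longrightarrow> x j \<le> X k j" and lim: "X \<longlonglongrightarrow> x"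
  shows "(\<lambda>k. q (X k)) \<longlonglongrightarrow> q x"
proof -
  let ?S = "{t \<in> box. \<forall>j\<in>{1..n}. if j \<in> {} then t j < x j else x j \<le> t j}"
  have "continuous (at x within ?S) q"
    using rd[unfolded rd_continuous_def, rule_format, OF x, of "{}"] unfolding continuous_within by auto
  then show ?thesis
    by (rule continuous_within_tendsto_compose'[OF _ _ lim]) (use X in auto)
qed

text \<open>A right-continuous function is the pointwise limit of step functions on dyadic grids, pulled
  back to the grid-point projections into the time scales from the right.\<close>

lemma rd_continuous_measurable:
  assumes rd: "rd_continuous n T box q"
  shows "q \<in> borel_measurable box_space"
proof (rule borel_measurable_LIMSEQ_real)
  define Z :: "(nat \<Rightarrow> int) set" where "Z = (\<Pi>\<^sub>E j\<in>{1..n}. UNIV)"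
  define c where "c k x = (\<lambda>j\<in>{1..n}. \<lceil>2 ^ k * x j\<rceil>)" for k :: nat and x :: "nat \<Rightarrow> real"
  \<comment> \<open>The grid point lies above \<open>x j\<close>, and capping at \<open>b j\<close>
    keeps it there. As \<open>x j\<close> belongs to \<open>T j\<close>, passing down to the floor
    cannot fall below \<open>x j\<close> either.\<close>
  define G where "G k z = (\<lambda>j\<in>{1..n}. ts_floor (T j) (min (b j) (real_of_int (z j) / 2 ^ k)))" for k :: nat and z :: "nat \<Rightarrow> int"
  have coord: "x j \<le> G k (c k x) j \<and> G k (c k x) j \<le> x j + (1 / 2) ^ k \<and> G k (c k x) j \<le> b j \<and> G k (c k x) j \<in> T j"
    if x: "x \<in> box" and j: "j \<in> {1..n}" for x j k
  proof -
    note xj = boxD[OF x j]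
    let ?s = "min (b j) (real_of_int \<lceil>2 ^ k * x j\<rceil> / 2 ^ k)"
    have "2 ^ k * x j \<le> real_of_int \<lceil>2 ^ k * x j\<rceil>" "real_of_int \<lceil>2 ^ k * x j\<rceil> \<le> 2 ^ k * x j + 1" by linarith+
    then have "x j \<le> real_of_int \<lceil>2 ^ k * x j\<rceil> / 2 ^ k" "real_of_int \<lceil>2 ^ k * x j\<rceil> / 2 ^ k \<le> x j + (1 / 2) ^ k"
      by (simp_all add: field_simps)
    then have s: "x j \<le> ?s" "?s \<le> x j + (1 / 2) ^ k" "?s \<le> b j" using xj by auto
    have Gj: "G k (c k x) j = ts_floor (T j) ?s" using j by (simp add: G_def c_def)
    note tf = ts_floor[OF closed_T[OF j] xj(1) s(1)]
    show ?thesis unfolding Gj using tf(1-3) s by linarith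
  qed
  have Gbox: "G k (c k x) \<in> box" if x: "x \<in> box" for x k
    unfolding ts_box_def
  proof (rule PiE_I)
    fix j assume j: "j \<in> {1..n}"
    show "G k (c k x) j \<in> T j \<inter> {a j..b j}" using coord[OF x j, of k] boxD[OF x j] by auto
  qed (auto simp: G_def)
  show "(\<lambda>k. q (G k (c k x))) \<longlonglongrightarrow> q x" if "x \<in> space box_space" for x
  proof -
    have x: "x \<in> box" using that by (simp add: space_box_space)
    have "(\<lambda>k. G k (c k x)) \<longlonglongrightarrow> x"
      unfolding tendsto_fun_iff
    proof
      fix j
      show "(\<lambda>k. G k (c k x) j) \<longlonglongrightarrow> x j"
      proof (cases "j \<in> {1..n}")
        case True
        have "(\<lambda>k. x j + (1 / 2) ^ k) \<longlonglongrightarrow> x j + 0"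
          by (intro tendsto_intros LIMSEQ_realpow_zero) auto
        then have u: "(\<lambda>k. x j + (1 / 2) ^ k) \<longlonglongrightarrow> x j" by simp
        show ?thesis
          by (rule tendsto_sandwich[OF _ _ tendsto_const u]) (use coord[OF x True] in auto)
      next
        case False
        then have "G k (c k x) j = x j" for k
          using x by (auto simp: G_def ts_box_def PiE_def extensional_def)
        then show ?thesis by simp
      qed
    qed
    then show ?thesis
      using Gbox[OF x] coord[OF x] by (intro rd_continuous_right[OF rd x]) auto
  qed
  fix k
  have "c k \<in> measurable box_space (count_space Z)"
  proof (subst measurable_count_space_eq_countable)
    show "countable Z" unfolding Z_def by (intro countable_PiE) auto
    show "c k \<in> space box_space \<rightarrow> Z \<and> (\<forall>z\<in>Z. c k -` {z} \<inter> space box_space \<in> sets box_space)"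
    proof (intro conjI ballI)
      fix z assume z: "z \<in> Z"
      have "c k -` {z} \<inter> space box_space = {x \<in> space box_space. \<forall>j\<in>{1..n}. \<lceil>2 ^ k * x j\<rceil> = z j}"
        using z by (auto simp: c_def Z_def fun_eq_iff PiE_def extensional_def)
      also have "\<dots> \<in> sets box_space"
      proof (rule sets.sets_Collect_finite_All)
        fix j assume j: "j \<in> {1..n}"
        note [measurable] = measurable_box_coord[OF j]
        show "{x \<in> space box_space. \<lceil>2 ^ k * x j\<rceil> = z j} \<in> sets box_space" by measurable
      qed auto
      finally show "c k -` {z} \<inter> space box_space \<in> sets box_space" .
    qed (auto simp: c_def Z_def)
  qed
  then show "(\<lambda>x. q (G k (c k x))) \<in> borel_measurable box_space"
    by (rule measurable_compose) simp
qed

lemma rd_continuous_bmeas: "rd_continuous n T box q \<Longrightarrow> bmeas q"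
  unfolding bmeas_def using rd_continuous_measurable rd_continuous_bounded by blast

text \<open>The primitive in variable \<open>i\<close> from \<open>a i\<close>. The measure puts no
  mass on \<open>x i\<close>, so only values at \<open>t < x i\<close> enter.\<close>

definition J :: "nat \<Rightarrow> ((nat \<Rightarrow> real) \<Rightarrow> real) \<Rightarrow> (nat \<Rightarrow> real) \<Rightarrow> real" where
  "J i q x = (\<integral>t. q (x(i := t)) \<partial>delta_on (T i) (a i) (x i))"

lemma measurable_delta_on_id:
  assumes "y \<le> b i"
  shows "(\<lambda>t. t) \<in> measurable (delta_on (T i) (a i) y) (restrict_space borel (T i \<inter> {a i..b i}))"
proof (rule measurable_restrict_space2)
  show "(\<lambda>t. t) \<in> borel_measurable (delta_on (T i) (a i) y)"
    unfolding measurable_cong_sets[OF sets_delta_on refl] by (rule measurable_restrict_space1) simp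
qed (use assms in auto)

lemma measurable_upd:
  assumes i: "i \<in> {1..n}" and f: "f \<in> measurable M box_space"
    and h: "h \<in> measurable M (restrict_space borel (T i \<inter> {a i..b i}))"
  shows "(\<lambda>w. (f w)(i := h w)) \<in> measurable M box_space"
  using f h i unfolding box_space_def by (intro measurable_fun_upd[of _ "{1..n}"]) auto

lemma section_measurable:
  assumes "i \<in> {1..n}" "bmeas q" "x \<in> box" "y \<le> b i"
  shows "(\<lambda>t. q (x(i := t))) \<in> borel_measurable (delta_on (T i) (a i) y)"
proof -
  have m: "(\<lambda>t. x(i := t)) \<in> measurable (delta_on (T i) (a i) y) box_space"
    using assms by (intro measurable_upd measurable_delta_on_id measurable_const) (auto simp: space_box_space)
  show ?thesis using assms(2) unfolding bmeas_def by (auto intro: measurable_compose[OF m])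
qed

lemma section_integrable:
  assumes "i \<in> {1..n}" "bmeas q" "x \<in> box" "y \<in> T i" "a i \<le> y" "y \<le> b i"
  shows "integrable (delta_on (T i) (a i) y) (\<lambda>t. q (x(i := t)))"
proof -
  interpret finite_measure "delta_on (T i) (a i) y"
    using assms by (intro finite_measure_delta_on closed_T a_mem)
  obtain C where "\<forall>x\<in>box. \<bar>q x\<bar> \<le> C" using assms(2) unfolding bmeas_def by blast
  then show ?thesis
    using assms by (intro integrable_const_bound[of _ C] section_measurable AE_I2) (auto intro!: box_upd)
qed

lemma bmeas_abs: "bmeas q \<Longrightarrow> bmeas (\<lambda>x. \<bar>q x\<bar>)"
  unfolding bmeas_def by auto

lemma bmeas_add_scaled:
  assumes "bmeas q" "bmeas q'"
  shows "bmeas (\<lambda>x. q x + c * q' x)"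
proof -
  obtain C C' where "\<forall>x\<in>box. \<bar>q x\<bar> \<le> C" "\<forall>x\<in>box. \<bar>q' x\<bar> \<le> C'" using assms unfolding bmeas_def by blast
  then have "\<forall>x\<in>box. \<bar>q x + c * q' x\<bar> \<le> C + \<bar>c\<bar> * C'"
    by (auto intro!: order_trans[OF abs_triangle_ineq] add_mono mult_left_mono simp: abs_mult)
  then show ?thesis using assms unfolding bmeas_def by auto
qed

lemma bmeas_freeze:
  assumes "bmeas q" "i \<in> {1..n}"
  shows "bmeas (\<lambda>x. q (x(i := a i)))"
proof -
  have m: "(\<lambda>x. x(i := a i)) \<in> measurable box_space box_space"
    using assms(2) a_mem a_le_b by (intro measurable_upd) (auto simp: space_restrict_space)
  have "(\<lambda>x. q (x(i := a i))) \<in> borel_measurable box_space"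
    using assms(1) unfolding bmeas_def by (auto intro: measurable_compose[OF m])
  moreover obtain C where "\<forall>x\<in>box. \<bar>q x\<bar> \<le> C" using assms(1) unfolding bmeas_def by blast
  moreover have "x(i := a i) \<in> box" if "x \<in> box" for x
    using that assms(2) a_mem a_le_b by (intro box_upd) auto
  ultimately show ?thesis unfolding bmeas_def by blast
qed

lemma J_cong:
  assumes "\<And>t. t \<in> T i \<Longrightarrow> a i \<le> t \<Longrightarrow> t < x i \<Longrightarrow> q (x(i := t)) = q' (x(i := t))"
  shows "J i q x = J i q' x"
  unfolding J_def using assms by (intro Bochner_Integration.integral_cong) auto

lemma J_add_scaled:
  assumes "i \<in> {1..n}" "bmeas q" "bmeas q'" "x \<in> box"
  shows "J i (\<lambda>x. q x + c * q' x) x = J i q x + c * J i q' x"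
  using section_integrable[OF assms(1,2,4) boxD[OF assms(4,1)]] section_integrable[OF assms(1,3,4) boxD[OF assms(4,1)]]
  unfolding J_def by simp

lemma J_mono:
  assumes "i \<in> {1..n}" "bmeas q" "bmeas q'" "x \<in> box" "\<And>z. z \<in> box \<Longrightarrow> q z \<le> q' z"
  shows "J i q x \<le> J i q' x"
proof -
  note xi = boxD[OF assms(4,1)]
  show ?thesis
    unfolding J_def using assms xi
    by (intro integral_mono section_integrable) (auto intro!: assms(5) box_upd)
qed

lemma J_nonneg:
  assumes "i \<in> {1..n}" "x \<in> box" "\<And>z. z \<in> box \<Longrightarrow> 0 \<le> q z"
  shows "0 \<le> J i q x"
  using boxD[OF assms(2,1)] assms unfolding J_def
  by (intro Bochner_Integration.integral_nonneg) (auto intro!: assms(3) box_upd)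

lemma J_start: "x i = a i \<Longrightarrow> J i q x = 0"
proof -
  assume "x i = a i"
  then have "space (delta_on (T i) (a i) (x i)) = {}" by simp
  then show ?thesis unfolding J_def by (metis (no_types, lifting) Bochner_Integration.integral_cong empty_iff integral_zero)
qed

text \<open>The moving upper limit is written as an indicator under the fixed measure up to
  \<open>b i\<close>, which makes this a parameter integral of a jointly measurable
  function.\<close>

lemma bmeas_J:
  assumes i: "i \<in> {1..n}" and q: "bmeas q"
  shows "bmeas (J i q)"
proof -
  obtain C where C: "\<And>x. x \<in> box \<Longrightarrow> \<bar>q x\<bar> \<le> C" using q unfolding bmeas_def by blast
  have "\<bar>J i q x\<bar> \<le> \<bar>C\<bar> * (b i - a i)" if x: "x \<in> box" for x
  proof -
    note xi = boxD[OF x i]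
    have "\<bar>J i q x\<bar> \<le> C * (x i - a i)"
      unfolding J_def using xi i a_mem x
      by (intro delta_integral_bound closed_T C box_upd) auto
    also have "\<dots> \<le> \<bar>C\<bar> * (b i - a i)" using xi by (intro mult_mono) auto
    finally show ?thesis .
  qed
  moreover have "J i q \<in> borel_measurable box_space"
  proof -
    let ?N = "delta_on (T i) (a i) (b i)"
    interpret finite_measure ?N using i by (intro finite_measure_delta_on closed_T a_mem b_mem a_le_b)
    have m1: "(\<lambda>w. (fst w)(i := snd w)) \<in> measurable (box_space \<Otimes>\<^sub>M ?N) box_space"
      using measurable_compose[OF measurable_snd measurable_delta_on_id[of "b i" i]]
      by (intro measurable_upd i measurable_fst) auto
    have qm: "q \<in> borel_measurable box_space" using q by (simp add: bmeas_def)
    note [measurable] = measurable_box_coord[OF i] measurable_compose[OF m1 qm]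
    have [measurable]: "snd \<in> borel_measurable (box_space \<Otimes>\<^sub>M ?N)"
    proof -
      have "(\<lambda>t. t) \<in> borel_measurable ?N"
        unfolding measurable_cong_sets[OF sets_delta_on refl] by (rule measurable_restrict_space1) simp
      then show ?thesis by (rule measurable_compose[OF measurable_snd])
    qed
    have "(\<lambda>w. indicator {..<fst w i} (snd w) * q ((fst w)(i := snd w))) \<in> borel_measurable (box_space \<Otimes>\<^sub>M ?N)"
    proof -
      have [measurable]: "(\<lambda>w. fst w i) \<in> borel_measurable (box_space \<Otimes>\<^sub>M ?N)"
        by (rule measurable_compose[OF measurable_fst measurable_box_coord[OF i]])
      have "(\<lambda>w. (if snd w < fst w i then 1 else 0) * q ((fst w)(i := snd w))) \<in> borel_measurable (box_space \<Otimes>\<^sub>M ?N)"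
        by measurable
      then show ?thesis by (simp add: indicator_def)
    qed
    then have "(\<lambda>x. \<integral>t. indicator {..<x i} t * q (x(i := t)) \<partial>?N) \<in> borel_measurable box_space"
      by (intro borel_measurable_lebesgue_integral) (simp add: split_def)
    moreover have "J i q x = (\<integral>t. indicator {..<x i} t * q (x(i := t)) \<partial>?N)" if "x \<in> space box_space" for x
    proof -
      have xi: "x i \<le> b i" using that i by (auto simp: space_box_space boxD)
      have "T i \<in> sets borel" using closed_T[OF i] by (rule borel_closed)
      then show ?thesis
        unfolding J_def delta_on_def using xi
        by (simp add: integral_restrict_space) (intro Bochner_Integration.integral_cong, auto simp: indicator_def)
    qed
    ultimately show ?thesis by (simp cong: measurable_cong)
  qed
  ultimately show ?thesis unfolding bmeas_def by blast
qed

lemma J_commute: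
  assumes i: "i \<in> {1..n}" and k: "k \<in> {1..n}" and ik: "i \<noteq> k" and q: "bmeas q" and x: "x \<in> box"
  shows "J i (J k q) x = J k (J i q) x"
proof -
  note xi = boxD[OF x i] and xk = boxD[OF x k]
  let ?M = "delta_on (T i) (a i) (x i)" and ?N = "delta_on (T k) (a k) (x k)"
  interpret M: finite_measure ?M using xi i by (intro finite_measure_delta_on closed_T a_mem)
  interpret N: finite_measure ?N using xk k by (intro finite_measure_delta_on closed_T a_mem)
  interpret P: pair_sigma_finite ?M ?N ..
  interpret MN: finite_measure "?M \<Otimes>\<^sub>M ?N"
    by (rule finite_measure_pair_measure[OF N.finite_measure_axioms M.finite_measure_axioms])
  obtain C where C: "\<And>x. x \<in> box \<Longrightarrow> \<bar>q x\<bar> \<le> C" using q unfolding bmeas_def by blast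
  have "integrable (?M \<Otimes>\<^sub>M ?N) (\<lambda>w. q ((x(i := fst w))(k := snd w)))"
  proof (rule MN.integrable_const_bound[of _ C])
    have m: "(\<lambda>w. (x(i := fst w))(k := snd w)) \<in> measurable (?M \<Otimes>\<^sub>M ?N) box_space"
      using x i k measurable_compose[OF measurable_snd measurable_delta_on_id[OF xk(3)]]
        measurable_compose[OF measurable_fst measurable_delta_on_id[OF xi(3)]]
      by (intro measurable_upd) (auto simp: space_box_space)
    show "(\<lambda>w. q ((x(i := fst w))(k := snd w))) \<in> borel_measurable (?M \<Otimes>\<^sub>M ?N)"
      using q unfolding bmeas_def by (auto intro: measurable_compose[OF m])
    show "AE w in ?M \<Otimes>\<^sub>M ?N. norm (q ((x(i := fst w))(k := snd w))) \<le> C"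
      using xi xk x i k by (intro AE_I2) (auto simp: space_pair_measure intro!: C box_upd)
  qed
  then have "integrable (?M \<Otimes>\<^sub>M ?N) (case_prod (\<lambda>t s. q (x(i := t, k := s))))"
    by (simp add: split_def)
  from P.Fubini_integral[OF this]
  show ?thesis using ik by (simp add: J_def fun_upd_twist[OF ik])
qed

end

section \<open>Differentiation with respect to the upper limit of an integral\<close>

lemma delta_on_split:
  fixes h :: "real \<Rightarrow> real"
  assumes S: "closed S" and le: "c \<le> u" "u \<le> v" "v \<le> w" and h: "integrable (delta_on S c w) h"
  shows "integrable (delta_on S u v) h"
    and "(\<integral>r. h r \<partial>delta_on S c v) = (\<integral>r. h r \<partial>delta_on S c u) + (\<integral>r. h r \<partial>delta_on S u v)"
proof -
  have Sm [measurable]: "S \<in> sets borel" using S by (rule borel_closed)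
  let ?M = "delta_measure S"
  have int: "integrable ?M (\<lambda>r. indicator (S \<inter> {p..<q}) r *\<^sub>R h r)" if "c \<le> p" "q \<le> w" for p q
  proof -
    have "integrable ?M (\<lambda>r. indicator (S \<inter> {c..<w}) r *\<^sub>R h r)"
      using h integrable_restrict_space[of "S \<inter> {c..<w}" ?M h] Sm unfolding delta_on_def by auto
    from integrable_mult_indicator[OF _ this, of "S \<inter> {p..<q}"]
    have "integrable ?M (\<lambda>r. indicator (S \<inter> {p..<q}) r *\<^sub>R (indicator (S \<inter> {c..<w}) r *\<^sub>R h r))"
      using Sm by simp
    also have "(\<lambda>r. indicator (S \<inter> {p..<q}) r *\<^sub>R (indicator (S \<inter> {c..<w}) r *\<^sub>R h r))
      = (\<lambda>r. indicator (S \<inter> {p..<q}) r *\<^sub>R h r)"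
      using that by (auto simp: fun_eq_iff indicator_def)
    finally show ?thesis .
  qed
  show "integrable (delta_on S u v) h"
    unfolding delta_on_def using int[of u v] le by (subst integrable_restrict_space) auto
  have "(\<lambda>r. indicator (S \<inter> {c..<v}) r *\<^sub>R h r)
    = (\<lambda>r. indicator (S \<inter> {c..<u}) r *\<^sub>R h r + indicator (S \<inter> {u..<v}) r *\<^sub>R h r)"
    using le by (auto simp: fun_eq_iff indicator_def)
  then show "(\<integral>r. h r \<partial>delta_on S c v) = (\<integral>r. h r \<partial>delta_on S c u) + (\<integral>r. h r \<partial>delta_on S u v)"
    unfolding delta_on_def using int[of c u] int[of u v] le by (simp add: integral_restrict_space)
qed

text \<open>The time scale is cut at \<open>c\<close> because the integral is 0 for
  \<open>s < c\<close>, which would spoil the difference quotients at \<open>t = c\<close>.\<close>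

lemma has_delta_deriv_integral:
  assumes S: "closed S" "c \<in> S" "w \<in> S" "t \<in> S" "c \<le> t" "t < w"
    and h: "integrable (delta_on S c w) h"
    and cont: "continuous (at t within S \<inter> {c..w}) h"
  shows "has_delta_deriv (S \<inter> {c..}) (\<lambda>s. \<integral>u. h u \<partial>delta_on S c s) t (h t)"
  unfolding has_delta_deriv_def fwd_jump_Int_atLeast[OF S(5)]
proof (rule tendstoI)
  fix e :: real assume e: "e > 0"
  let ?\<sigma> = "fwd_jump S t" and ?\<Phi> = "\<lambda>s. \<integral>u. h u \<partial>delta_on S c s"
  obtain \<delta> where \<delta>: "\<delta> > 0" "\<And>s. s \<in> S \<Longrightarrow> c \<le> s \<Longrightarrow> s \<le> w \<Longrightarrow> \<bar>s - t\<bar> < \<delta> \<Longrightarrow> \<bar>h s - h t\<bar> < e / 2"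
    using cont e unfolding continuous_within_eps_delta dist_real_def
    by (metis (no_types, lifting) Int_iff atLeastAtMost_iff half_gt_zero)
  have \<sigma>: "t \<le> ?\<sigma>" "?\<sigma> \<in> S" "?\<sigma> \<le> w"
    using fwd_jump_ge fwd_jump_mem[OF S(1,3,6)] fwd_jump_less_le(2)[OF S(3,6)] by auto
  \<comment> \<open>At a right-scattered point the radius excludes everything beyond the jump; at
    any other it keeps \<open>s\<close> below \<open>w\<close>, where \<open>h\<close> is
    integrable.\<close>
  define d where "d = min \<delta> (if ?\<sigma> = t then w - t else ?\<sigma> - t)"
  have d: "d > 0" using \<delta>(1) \<sigma>(1) S(6) by (auto simp: d_def)
  have bound: "\<bar>?\<Phi> v - ?\<Phi> u - h t * (v - u)\<bar> \<le> e / 2 * (v - u)"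
    if uv: "u \<in> S" "v \<in> S" "c \<le> u" "u \<le> v" "v \<le> w" and near: "\<And>r. r \<in> S \<Longrightarrow> u \<le> r \<Longrightarrow> r < v \<Longrightarrow> \<bar>r - t\<bar> < \<delta>" for u v
  proof -
    interpret finite_measure "delta_on S u v" using finite_measure_delta_on[OF S(1) uv(1,2,4)] .
    note sp = delta_on_split[OF S(1) uv(3-5) h]
    have "?\<Phi> v - ?\<Phi> u - h t * (v - u) = (\<integral>r. h r \<partial>delta_on S u v) - (\<integral>r. h t \<partial>delta_on S u v)"
      using sp(2) measure_delta_on[OF S(1) uv(1,2,4)] by simp
    also have "\<dots> = (\<integral>r. h r - h t \<partial>delta_on S u v)"
      using sp(1) by (intro Bochner_Integration.integral_diff[symmetric]) auto
    also have "\<bar>\<dots>\<bar> \<le> e / 2 * (v - u)"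
      using near uv \<delta>(2) by (intro delta_integral_bound[OF S(1) uv(1,2,4)]) (fastforce intro: less_imp_le)
    finally show ?thesis .
  qed
  have "dist ((?\<Phi> ?\<sigma> - ?\<Phi> s) / (?\<sigma> - s)) (h t) < e"
    if s: "s \<in> S \<inter> {c..}" "s \<noteq> ?\<sigma>" "\<bar>s - t\<bar> < d" for s
  proof (cases "s < ?\<sigma>")
    case True
    have "\<bar>?\<Phi> ?\<sigma> - ?\<Phi> s - h t * (?\<sigma> - s)\<bar> \<le> e / 2 * (?\<sigma> - s)"
    proof (rule bound)
      fix r assume r: "r \<in> S" "s \<le> r" "r < ?\<sigma>"
      then have "r \<le> t" using fwd_jump_less_le(2)[OF r(1), of t] by (cases "t < r") auto
      then show "\<bar>r - t\<bar> < \<delta>" using r s by (auto simp: d_def)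
    qed (use s \<sigma> True in auto)
    then have "\<bar>(?\<Phi> ?\<sigma> - ?\<Phi> s - h t * (?\<sigma> - s)) / (?\<sigma> - s)\<bar> \<le> e / 2"
      using True by (simp add: abs_divide pos_divide_le_eq)
    moreover have "(?\<Phi> ?\<sigma> - ?\<Phi> s) / (?\<sigma> - s) - h t = (?\<Phi> ?\<sigma> - ?\<Phi> s - h t * (?\<sigma> - s)) / (?\<sigma> - s)"
      using True by (simp add: diff_divide_distrib)
    ultimately have "dist ((?\<Phi> ?\<sigma> - ?\<Phi> s) / (?\<sigma> - s)) (h t) \<le> e / 2" unfolding dist_real_def by metis
    then show ?thesis using e by linarith
  next
    case False
    then have ls: "?\<sigma> < s" using s by simp
    have \<sigma>t: "?\<sigma> = t" using ls s by (auto simp: d_def split: if_splits)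
    then have sw: "s \<le> w" using s by (auto simp: d_def)
    have "\<bar>?\<Phi> s - ?\<Phi> t - h t * (s - t)\<bar> \<le> e / 2 * (s - t)"
      by (rule bound) (use s S sw ls \<sigma>t in \<open>auto simp: d_def\<close>)
    then have "\<bar>(?\<Phi> s - ?\<Phi> t - h t * (s - t)) / (s - t)\<bar> \<le> e / 2"
      using ls \<sigma>t by (simp add: abs_divide pos_divide_le_eq)
    moreover have "(?\<Phi> t - ?\<Phi> s) / (t - s) - h t = (?\<Phi> s - ?\<Phi> t - h t * (s - t)) / (s - t)"
      using ls \<sigma>t by (simp add: field_simps)
    ultimately have "dist ((?\<Phi> t - ?\<Phi> s) / (t - s)) (h t) \<le> e / 2" unfolding dist_real_def by metis
    then show ?thesis using e \<sigma>t by simp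
  qed
  then show "eventually (\<lambda>s. dist ((?\<Phi> ?\<sigma> - ?\<Phi> s) / (?\<sigma> - s)) (h t) < e) (delta_at (S \<inter> {c..}) t)"
    unfolding eventually_delta_at fwd_jump_Int_atLeast[OF S(5)] using d by blast
qed

text \<open>Such a \<open>u\<close> bounds the forward jump of \<open>t\<close>, so two functions
  that agree strictly below \<open>\<beta>\<close> have the same derivative at \<open>t\<close>. It
  is the backward jump of \<open>\<beta>\<close> if \<open>\<beta>\<close> is left-scattered;
  otherwise points accumulate at \<open>\<beta>\<close>.\<close>

lemma mem_between_bwd_jump:
  assumes "closed S" "t \<in> S" "\<beta> \<in> S" "t < bwd_jump S \<beta>"
  shows "\<exists>u\<in>S. t < u \<and> u < \<beta>"
proof (cases "bwd_jump S \<beta> < \<beta>")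
  case True
  then show ?thesis using assms bwd_jump_mem by blast
next
  case False
  then have eq: "bwd_jump S \<beta> = \<beta>" using bwd_jump_le[of S \<beta>] by simp
  have ex: "t \<in> {s \<in> S. s < \<beta>}" using assms eq by simp
  then have "t < Sup {s \<in> S. s < \<beta>}" using assms by (auto simp: bwd_jump_def split: if_splits)
  then obtain u where "u \<in> {s \<in> S. s < \<beta>}" "t < u" by (rule less_cSupE) (use ex in auto)
  then show ?thesis by blast
qed

lemma mixed_pd_cong: "(\<And>i. i \<in> {1..j} \<Longrightarrow> k i = k' i) \<Longrightarrow> mixed_pd T k j f = mixed_pd T k' j f"
  by (induction j) auto

section \<open>Repeated primitives in one variable\<close>

context time_scale_box
begin

definition slice_cont :: "nat \<Rightarrow> ((nat \<Rightarrow> real) \<Rightarrow> real) \<Rightarrow> bool" where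
  "slice_cont i V \<longleftrightarrow> (\<forall>z\<in>box. continuous_on (T i \<inter> {a i..b i}) (\<lambda>s. V (z(i := s))))"

text \<open>A primitive of a function bounded by \<open>C\<close> is \<open>C\<close>-Lipschitz in
  its upper limit.\<close>

lemma slice_cont_J:
  assumes i: "i \<in> {1..n}" and q: "bmeas q"
  shows "slice_cont i (J i q)"
  unfolding slice_cont_def
proof
  fix z assume z: "z \<in> box"
  obtain C where C: "\<And>x. x \<in> box \<Longrightarrow> \<bar>q x\<bar> \<le> C" using q unfolding bmeas_def by blast
  have C0: "C \<ge> 0" using C[OF z] by simp
  note T = closed_T[OF i] a_mem[OF i] b_mem[OF i] a_le_b[OF i]
  have le: "\<bar>J i q (z(i := v)) - J i q (z(i := u))\<bar> \<le> C * (v - u)"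
    if uv: "u \<in> T i" "v \<in> T i" "a i \<le> u" "u \<le> v" "v \<le> b i" for u v
  proof -
    have "J i q (z(i := v)) - J i q (z(i := u)) = (\<integral>t. q (z(i := t)) \<partial>delta_on (T i) u v)"
      using delta_on_split(2)[OF T(1) uv(3-5) section_integrable[OF i q z T(3,4) order_refl]] by (simp add: J_def)
    then show ?thesis
      using uv z i by (auto intro!: delta_integral_bound T C box_upd)
  qed
  have "C-lipschitz_on (T i \<inter> {a i..b i}) (\<lambda>s. J i q (z(i := s)))"
  proof (rule lipschitz_onI)
    fix u v assume "u \<in> T i \<inter> {a i..b i}" "v \<in> T i \<inter> {a i..b i}"
    then show "dist (J i q (z(i := u))) (J i q (z(i := v))) \<le> C * dist u v"
      using le[of u v] le[of v u] by (cases "u \<le> v") (auto simp: dist_real_def abs_minus_commute)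
  qed (rule C0)
  then show "continuous_on (T i \<inter> {a i..b i}) (\<lambda>s. J i q (z(i := s)))"
    by (rule lipschitz_on_continuous_on)
qed

lemma J_deriv:
  assumes i: "i \<in> {1..n}" and V: "bmeas V" "slice_cont i V" and z: "z \<in> box" "z i < b i"
  shows "has_delta_deriv (T i \<inter> {a i..}) (\<lambda>s. J i V (z(i := s))) (z i) (V z)"
proof -
  note T = closed_T[OF i] a_mem[OF i] b_mem[OF i] and zi = boxD[OF z(1) i]
  have "continuous_on (T i \<inter> {a i..b i}) (\<lambda>s. V (z(i := s)))" using V(2) z(1) unfolding slice_cont_def by blast
  then have "continuous (at (z i) within T i \<inter> {a i..b i}) (\<lambda>s. V (z(i := s)))"
    using zi by (simp add: continuous_on_eq_continuous_within)
  from has_delta_deriv_integral[OF T zi(1,2) z(2) section_integrable[OF i V(1) z(1) b_mem[OF i] a_le_b[OF i] order_refl] this]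
  show ?thesis by (simp add: J_def)
qed

lemma bmeas_J_pow: "i \<in> {1..n} \<Longrightarrow> bmeas q \<Longrightarrow> bmeas ((J i ^^ k) q)"
  by (induction k) (auto intro: bmeas_J)

lemma slice_cont_J_pow: "i \<in> {1..n} \<Longrightarrow> bmeas V \<Longrightarrow> slice_cont i V \<Longrightarrow> slice_cont i ((J i ^^ k) V)"
proof (induction k)
  case (Suc k)
  then show ?case using slice_cont_J[OF Suc.prems(1) bmeas_J_pow[OF Suc.prems(1,2)]] by simp
qed simp

text \<open>At \<open>z\<^sub>i = a\<^sub>i\<close> the derivatives may involve arguments below \<open>a\<^sub>i\<close>, where nothing is known about
  \<open>f\<close>; there the assumed existence of the limit is needed to determine it from the right.\<close>

lemma pd_iter_J_pow:
  assumes i: "i \<in> {1..n}" and V: "bmeas V" "slice_cont i V"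
    and f: "\<And>z. z \<in> box \<Longrightarrow> f z = (J i ^^ r) V z"
    and ex: "\<And>k z. k < r \<Longrightarrow> z \<in> box \<Longrightarrow> z i = a i \<Longrightarrow> \<exists>l. has_pd ((kappa ^^ k) (T i)) i (pd_iter (T i) i k f) z l"
  shows "k \<le> r \<Longrightarrow> z \<in> box \<Longrightarrow> z i < (bwd_jump (T i) ^^ k) (b i) \<Longrightarrow> pd_iter (T i) i k f z = (J i ^^ (r - k)) V z"
proof (induction k arbitrary: z)
  case (Suc k)
  note T = closed_T[OF i] b_mem[OF i] and zi = boxD[OF Suc.prems(2) i]
  let ?\<beta> = "(bwd_jump (T i) ^^ k) (b i)" and ?S = "(kappa ^^ k) (T i)" and ?g = "pd_iter (T i) i k f"
  note fb = funpow_bwd_jump[OF T]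
  have "\<exists>u\<in>T i. z i < u \<and> u < ?\<beta>"
    using mem_between_bwd_jump[OF T(1) zi(1) fb(1)] Suc.prems(3) by simp
  then obtain u where u: "u \<in> T i" "z i < u" "u < ?\<beta>" by blast
  have z\<beta>: "z i < ?\<beta>" using u by simp
  have \<beta>b: "?\<beta> \<le> b i" by (rule fb(3))
  have rk: "r - k = Suc (r - Suc k)" using Suc.prems(1) by simp
  define L where "L = (J i ^^ (r - Suc k)) V z"
  have "has_delta_deriv (T i \<inter> {a i..}) (\<lambda>s. J i ((J i ^^ (r - Suc k)) V) (z(i := s))) (z i) L"
    unfolding L_def using Suc.prems(2) z\<beta> \<beta>b
    by (intro J_deriv i bmeas_J_pow slice_cont_J_pow V) auto
  then have der: "has_delta_deriv (T i \<inter> {a i..}) (\<lambda>s. ?g (z(i := s))) (z i) L"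
  proof (rule has_delta_deriv_cong[rotated -1])
    fix s assume s: "s \<in> T i \<inter> {a i..}" "s \<le> u"
    have zb: "z(i := s) \<in> box" using s u \<beta>b Suc.prems(2) i by (intro box_upd) auto
    then have "?g (z(i := s)) = (J i ^^ (r - k)) V (z(i := s))"
      using s u Suc.prems(1) by (intro Suc.IH[OF _ zb]) auto
    then show "J i ((J i ^^ (r - Suc k)) V) (z(i := s)) = ?g (z(i := s))" by (simp add: rk)
  qed (use u zi T in auto)
  have "pd ?S i ?g z = L"
  proof (cases "z i = a i")
    case True
    have "\<exists>l. has_pd ?S i ?g (z(i := z i)) l"
      unfolding fun_upd_triv using Suc.prems(1) by (intro ex[OF _ Suc.prems(2) True]) simp
    from has_pd_upd[OF this T zi(1) z\<beta>]
    have "has_delta_deriv (T i) (\<lambda>s. ?g (z(i := s))) (z i) (pd ?S i ?g z)" by simp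
    then have d: "has_delta_deriv (T i \<inter> {a i..}) (\<lambda>s. ?g (z(i := s))) (z i) (pd ?S i ?g z)"
      by (rule has_delta_deriv_Int_atLeast(1)[OF zi(2)])
    show ?thesis
    proof (rule has_delta_deriv_unique[OF _ _ _ _ d der])
      show "closed (T i \<inter> {a i..})" using T(1) by (intro closed_Int) auto
      show "u \<in> T i \<inter> {a i..}" "z i \<in> T i \<inter> {a i..}" "z i < u" using u zi by auto
    qed
  next
    case False
    then have "a i < z i" using zi(2) by simp
    then have "has_delta_deriv (T i) (\<lambda>s. ?g (z(i := s))) (z i) L"
      by (rule has_delta_deriv_Int_atLeast(2)[OF zi(2) _ der])
    then have "has_pd ?S i ?g z L"
      unfolding has_pd_iff has_delta_deriv_kappa(1)[OF T z\<beta>] .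
    then show ?thesis
      by (rule has_pd_pd) (simp add: delta_at_neq_bot[OF T(1) zi(1) u(1,2)] has_delta_deriv_kappa(2)[OF T z\<beta>])
  qed
  then show ?case by (simp add: L_def)
qed (use f in simp)

text \<open>A primitive at \<open>x\<close> uses only points of \<open>T i\<close> below
  \<open>x i\<close>, that is, up to its backward jump. Hence \<open>k\<close> primitives ignore
  exactly the region near \<open>b i\<close> where a k-th derivative may be a default value.\<close>

lemma J_pow_cong:
  assumes i: "i \<in> {1..n}"
    and q: "\<And>z. z \<in> box \<Longrightarrow> z i \<le> \<beta> \<Longrightarrow> q z = q' z"
  shows "x \<in> box \<Longrightarrow> (bwd_jump (T i) ^^ k) (x i) \<le> \<beta> \<Longrightarrow> (J i ^^ k) q x = (J i ^^ k) q' x"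
proof (induction k arbitrary: x)
  case (Suc k)
  note xi = boxD[OF Suc.prems(1) i] and T = closed_T[OF i]
  have "J i ((J i ^^ k) q) x = J i ((J i ^^ k) q') x"
  proof (rule J_cong, rule Suc.IH)
    fix t assume t: "t \<in> T i" "a i \<le> t" "t < x i"
    show "x(i := t) \<in> box" using t xi Suc.prems(1) i by (intro box_upd) auto
    have "t \<le> bwd_jump (T i) (x i)" using t by (intro le_bwd_jump)
    then have "(bwd_jump (T i) ^^ k) t \<le> (bwd_jump (T i) ^^ k) (bwd_jump (T i) (x i))"
      using t xi T by (intro funpow_bwd_jump_mono bwd_jump_mem) auto
    also have "\<dots> \<le> \<beta>" using Suc.prems(2) by (simp add: funpow_swap1)
    finally show "(bwd_jump (T i) ^^ k) ((x(i := t)) i) \<le> \<beta>" by simp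
  qed
  then show ?case by simp
qed (use q in auto)

text \<open>The one-sided inequality for delta derivatives is applied with the factors 1 and -1; the
  derivative itself is integrable here and serves as its own majorant.\<close>

lemma taylor_step:
  assumes i: "i \<in> {1..n}" and x: "x \<in> box" "x i \<le> (bwd_jump (T i) ^^ r) (b i)"
    and ex: "\<And>z. z \<in> box \<Longrightarrow> \<exists>l. has_pd ((kappa ^^ r) (T i)) i g z l"
    and bmeas: "bmeas (pd ((kappa ^^ r) (T i)) i g)"
  shows "g x = g (x(i := a i)) + J i (pd ((kappa ^^ r) (T i)) i g) x"
proof -
  let ?g' = "pd ((kappa ^^ r) (T i)) i g"
  note T = closed_T[OF i] a_mem[OF i] and xi = boxD[OF x(1) i]
  have xb: "x(i := t) \<in> box" if "t \<in> T i" "a i \<le> t" "t \<le> x i" for t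
    using that xi x i by (intro box_upd) auto
  have cont: "continuous_on (T i \<inter> {a i..x i}) (\<lambda>s. g (x(i := s)))"
    by (rule has_pd_upd_cont[OF _ T(1) b_mem[OF i] x(2)]) (use ex xb in auto)
  have deriv: "has_delta_deriv (T i) (\<lambda>s. g (x(i := s))) t (?g' (x(i := t)))"
    if "t \<in> T i" "a i \<le> t" "t < x i" for t
    using ex[OF xb[of t]] that x(2) by (intro has_pd_upd[OF _ T(1) b_mem[OF i]]) auto
  have int: "integrable (delta_on (T i) (a i) (x i)) (\<lambda>t. ?g' (x(i := t)))"
    by (rule section_integrable[OF i bmeas x(1) xi])
  have "c * g (x(i := x i)) - c * g (x(i := a i)) \<le> (\<integral>t. c * ?g' (x(i := t)) \<partial>delta_on (T i) (a i) (x i))" for c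
  proof (rule delta_deriv_le_integral[OF T xi(1,2)])
    show "continuous_on (T i \<inter> {a i..x i}) (\<lambda>s. c * g (x(i := s)))"
      by (rule continuous_on_mult_left[OF cont])
    show "has_delta_deriv (T i) (\<lambda>s. c * g (x(i := s))) t (c * ?g' (x(i := t)))"
      if "t \<in> T i" "a i \<le> t" "t < x i" for t
      by (rule has_delta_deriv_cmult[OF deriv[OF that]])
  qed (use int in auto)
  from this[of 1] this[of "-1"] show ?thesis by (simp add: J_def)
qed

end

text \<open>Abstracts integration over the variables in \<open>S\<close>, as seen by the other variables.\<close>

locale slice_operator = time_scale_box +
  fixes S :: "nat set" and op :: "((nat \<Rightarrow> real) \<Rightarrow> real) \<Rightarrow> (nat \<Rightarrow> real) \<Rightarrow> real"
  assumes bmeas_op: "bmeas q \<Longrightarrow> bmeas (op q)"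
    and op_cong: "x \<in> box \<Longrightarrow> (\<And>z. z \<in> box \<Longrightarrow> (\<And>i. i \<notin> S \<Longrightarrow> z i = x i) \<Longrightarrow> q z = q' z) \<Longrightarrow> op q x = op q' x"
    and op_add_scaled: "bmeas q \<Longrightarrow> bmeas q' \<Longrightarrow> x \<in> box \<Longrightarrow> op (\<lambda>z. q z + c * q' z) x = op q x + c * op q' x"
    and op_mono: "bmeas q \<Longrightarrow> bmeas q' \<Longrightarrow> (\<And>z. z \<in> box \<Longrightarrow> q z \<le> q' z) \<Longrightarrow> x \<in> box \<Longrightarrow> op q x \<le> op q' x"
    and op_freeze: "i \<in> {1..n} - S \<Longrightarrow> x \<in> box \<Longrightarrow> op (\<lambda>z. q (z(i := a i))) x = op q (x(i := a i))"
    and op_J: "i \<in> {1..n} - S \<Longrightarrow> bmeas q \<Longrightarrow> x \<in> box \<Longrightarrow> op (J i q) x = J i (op q) x"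

context time_scale_box
begin

abbreviation slice_op :: "nat set \<Rightarrow> (((nat \<Rightarrow> real) \<Rightarrow> real) \<Rightarrow> (nat \<Rightarrow> real) \<Rightarrow> real) \<Rightarrow> bool" where
  "slice_op \<equiv> slice_operator n T a b"

lemmas slice_opD = slice_operator.bmeas_op slice_operator.op_cong slice_operator.op_add_scaled
  slice_operator.op_mono slice_operator.op_freeze slice_operator.op_J

lemmas slice_opI = slice_operator.intro[OF time_scale_box_axioms slice_operator_axioms.intro]

lemma box_freeze: "x \<in> box \<Longrightarrow> i \<in> {1..n} \<Longrightarrow> x(i := a i) \<in> box"
  using a_mem a_le_b by (intro box_upd) auto

lemma slice_op_id: "slice_op S (\<lambda>q. q)"
  by (rule slice_opI) auto

lemma slice_op_comp:
  assumes 1: "slice_op S op1" and 2: "slice_op S op2"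
  shows "slice_op S (\<lambda>q. op1 (op2 q))"
proof (rule slice_opI)
  fix q q' :: "(nat \<Rightarrow> real) \<Rightarrow> real" and x assume x: "x \<in> box" and eq: "\<And>z. z \<in> box \<Longrightarrow> (\<And>i. i \<notin> S \<Longrightarrow> z i = x i) \<Longrightarrow> q z = q' z"
  show "op1 (op2 q) x = op1 (op2 q') x"
    by (intro slice_opD(2)[OF 1 x] slice_opD(2)[OF 2] eq) auto
next
  fix q q' :: "(nat \<Rightarrow> real) \<Rightarrow> real" and c x assume *: "bmeas q" "bmeas q'" "x \<in> box"
  have "op1 (op2 (\<lambda>z. q z + c * q' z)) x = op1 (\<lambda>z. op2 q z + c * op2 q' z) x"
    by (intro slice_opD(2)[OF 1 *(3)] slice_opD(3)[OF 2 *(1,2)])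
  also have "\<dots> = op1 (op2 q) x + c * op1 (op2 q') x"
    by (intro slice_opD(3)[OF 1] slice_opD(1)[OF 2] *)
  finally show "op1 (op2 (\<lambda>z. q z + c * q' z)) x = op1 (op2 q) x + c * op1 (op2 q') x" .
next
  fix i q x assume *: "i \<in> {1..n} - S" "x \<in> box"
  have "op1 (op2 (\<lambda>z. q (z(i := a i)))) x = op1 (\<lambda>z. op2 q (z(i := a i))) x"
    by (intro slice_opD(2)[OF 1 *(2)] slice_opD(5)[OF 2 *(1)])
  also have "\<dots> = op1 (op2 q) (x(i := a i))" by (rule slice_opD(5)[OF 1 *])
  finally show "op1 (op2 (\<lambda>z. q (z(i := a i)))) x = op1 (op2 q) (x(i := a i))" .
next
  fix i q x assume *: "i \<in> {1..n} - S" "bmeas q" "x \<in> box"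
  have "op1 (op2 (J i q)) x = op1 (J i (op2 q)) x"
    by (intro slice_opD(2)[OF 1 *(3)] slice_opD(6)[OF 2 *(1,2)])
  also have "\<dots> = J i (op1 (op2 q)) x" by (intro slice_opD(6)[OF 1] * slice_opD(1)[OF 2])
  finally show "op1 (op2 (J i q)) x = J i (op1 (op2 q)) x" .
qed (auto intro: slice_opD(1,4)[OF 1] slice_opD(1,4)[OF 2])

lemma slice_op_J:
  assumes k: "k \<in> {1..n}" "k \<in> S"
  shows "slice_op S (J k)"
proof (rule slice_opI)
  fix q q' :: "(nat \<Rightarrow> real) \<Rightarrow> real" and x assume x: "x \<in> box" and eq: "\<And>z. z \<in> box \<Longrightarrow> (\<And>i. i \<notin> S \<Longrightarrow> z i = x i) \<Longrightarrow> q z = q' z"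
  show "J k q x = J k q' x"
    using boxD[OF x k(1)] k x by (intro J_cong eq box_upd) auto
next
  fix i q x assume i: "i \<in> {1..n} - S" and "x \<in> box"
  then have "i \<noteq> k" using k by auto
  then show "J k (\<lambda>z. q (z(i := a i))) x = J k q (x(i := a i))"
    by (simp add: J_def fun_upd_twist)
next
  fix i q x assume i: "i \<in> {1..n} - S" and "bmeas q" "x \<in> box"
  then show "J k (J i q) x = J i (J k q) x"
    using k by (intro J_commute) auto
qed (auto intro: bmeas_J J_add_scaled J_mono k)

lemma slice_op_pow:
  assumes "slice_op S op"
  shows "slice_op S (\<lambda>q. (op ^^ r) q)"
proof (induction r)
  case 0
  show ?case using slice_op_id by simp
next
  case (Suc r)
  show ?case using slice_op_comp[OF assms Suc] by simp
qed

text \<open>A new primitive is placed innermost: \<open>mixed_pd\<close> differentiates in the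
  newest variable last, and this derivative is undone before the others.\<close>

primrec iter_J :: "(nat \<Rightarrow> nat) \<Rightarrow> nat \<Rightarrow> ((nat \<Rightarrow> real) \<Rightarrow> real) \<Rightarrow> (nat \<Rightarrow> real) \<Rightarrow> real" where
  "iter_J lam 0 q = q"
| "iter_J lam (Suc m) q = iter_J lam m ((J (Suc m) ^^ lam (Suc m)) q)"

lemma slice_op_iter_J: "{1..m} \<subseteq> S \<Longrightarrow> m \<le> n \<Longrightarrow> slice_op S (iter_J lam m)"
proof (induction m)
  case 0
  have "iter_J lam 0 = (\<lambda>q. q)" by (simp add: fun_eq_iff)
  then show ?case using slice_op_id by simp
next
  case (Suc m)
  have "slice_op S (\<lambda>q. iter_J lam m ((\<lambda>q. (J (Suc m) ^^ lam (Suc m)) q) q))"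
    by (rule slice_op_comp[OF Suc.IH slice_op_pow[OF slice_op_J]]) (use Suc.prems in auto)
  moreover have "iter_J lam (Suc m) = (\<lambda>q. iter_J lam m ((J (Suc m) ^^ lam (Suc m)) q))" by (simp add: fun_eq_iff)
  ultimately show ?case by simp
qed

lemma slice_op_J_pow:
  assumes op: "slice_op S op" and i: "i \<in> {1..n} - S" and q: "bmeas q" and x: "x \<in> box"
  shows "op ((J i ^^ r) q) x = (J i ^^ r) (op q) x"
  using x
proof (induction r arbitrary: x)
  case (Suc r)
  have i': "i \<in> {1..n}" using i by simp
  have "op ((J i ^^ Suc r) q) x = J i (op ((J i ^^ r) q)) x"
    using i' by (simp add: slice_opD(6)[OF op i bmeas_J_pow[OF i' q] Suc.prems])
  also have "\<dots> = J i ((J i ^^ r) (op q)) x"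
    using boxD[OF Suc.prems i'] i' by (intro J_cong Suc.IH box_upd Suc.prems) auto
  finally show ?case by simp
qed simp

end

text \<open>Sign and monotonicity are proved together, since monotonicity yields the measurability
  and boundedness that make the next integral exist.\<close>

lemma h_mono_props:
  assumes S: "closed S" "s \<in> S"
  shows "(\<forall>t\<in>S. s \<le> t \<longrightarrow> 0 \<le> h_mono S k t s) \<and> mono_on (S \<inter> {s..}) (\<lambda>t. h_mono S k t s)"
    and "t \<in> S \<Longrightarrow> s \<le> t \<Longrightarrow> integrable (delta_on S s t) (\<lambda>u. h_mono S k u s)"
proof -
  have int: "integrable (delta_on S s t) g"
    if g: "\<forall>t\<in>S. s \<le> t \<longrightarrow> 0 \<le> g t" "mono_on (S \<inter> {s..}) g" and t: "t \<in> S" "s \<le> t" for g :: "real \<Rightarrow> real" and t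
  proof -
    interpret finite_measure "delta_on S s t" by (rule finite_measure_delta_on[OF S t])
    have "mono_on (S \<inter> {s..<t}) g" using g(2) by (rule mono_on_subset) auto
    then have "g \<in> borel_measurable (delta_on S s t)"
      unfolding measurable_cong_sets[OF sets_delta_on refl] by (rule borel_measurable_mono_on_fnc)
    moreover have "\<bar>g u\<bar> \<le> g t" if "u \<in> S" "s \<le> u" "u < t" for u
      using g t that mono_onD[OF g(2), of u t] by auto
    ultimately show ?thesis by (intro integrable_const_bound[of _ "g t"] AE_I2) auto
  qed
  show *: "(\<forall>t\<in>S. s \<le> t \<longrightarrow> 0 \<le> h_mono S k t s) \<and> mono_on (S \<inter> {s..}) (\<lambda>t. h_mono S k t s)" for k
  proof (induction k)
    case 0
    then show ?case by (auto intro: mono_onI)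
  next
    case (Suc k)
    let ?g = "\<lambda>u. h_mono S k u s"
    have eq: "h_mono S (Suc k) t s = (\<integral>u. ?g u \<partial>delta_on S s t)" if "s \<le> t" for t
      using delta_integral_eq[OF S(1) that] by simp
    have nn: "0 \<le> (\<integral>u. ?g u \<partial>delta_on S v t)" if "s \<le> v" for t v
      using Suc that by (intro Bochner_Integration.integral_nonneg) auto
    have "mono_on (S \<inter> {s..}) (\<lambda>t. h_mono S (Suc k) t s)"
    proof (rule mono_onI)
      fix u t assume ut: "u \<in> S \<inter> {s..}" "t \<in> S \<inter> {s..}" "u \<le> t"
      have "integrable (delta_on S s t) ?g" using ut Suc by (intro int) auto
      from delta_on_split(2)[OF S(1) _ ut(3) order_refl this]
      show "h_mono S (Suc k) u s \<le> h_mono S (Suc k) t s"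
        using ut nn[of u t] eq[of u] eq[of t] by simp
    qed
    then show ?case using eq nn[of s] by simp
  qed
  show "t \<in> S \<Longrightarrow> s \<le> t \<Longrightarrow> integrable (delta_on S s t) (\<lambda>u. h_mono S k u s)"
    by (rule int[OF conjunct1[OF *] conjunct2[OF *]])
qed

section \<open>Taylor's formula in all variables\<close>

context time_scale_box
begin

lemma C_rd_exists:
  assumes f: "f \<in> C_rd n T a b lam" and lam: "\<forall>j\<in>{1..n}. 1 \<le> lam j" and m: "Suc m \<le> n"
    and r: "r < lam (Suc m)" and x: "x \<in> box"
  shows "\<exists>l. has_pd ((kappa ^^ r) (T (Suc m))) (Suc m) (pd_iter (T (Suc m)) (Suc m) r (mixed_pd T lam m f)) x l"
proof -
  have "mixed_pd_exists T box lam (Suc m) f"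
    using f m lam unfolding C_rd_def by auto
  then show ?thesis using r x unfolding mixed_pd_exists_def by (force dest: bspec[of _ _ "Suc m"])
qed

text \<open>\<open>C_rd\<close> covers every multi-index below \<open>lam\<close>, in particular the
  one with full orders in the earlier variables and order \<open>r\<close> in the last.\<close>

lemma C_rd_bmeas:
  assumes f: "f \<in> C_rd n T a b lam" and lam: "\<forall>j\<in>{1..n}. 1 \<le> lam j" and m: "Suc m \<le> n"
    and r: "1 \<le> r" "r \<le> lam (Suc m)"
  shows "bmeas (pd_iter (T (Suc m)) (Suc m) r (mixed_pd T lam m f))"
proof -
  let ?k = "lam(Suc m := r)"
  have k: "1 \<le> ?k i \<and> ?k i \<le> lam i" if "i \<in> {1..Suc m}" for i using lam r m that by auto
  have "Suc m \<in> {1..n}" using m by auto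
  from f[unfolded C_rd_def mem_Collect_eq, rule_format, OF this k]
  have "rd_continuous n T box (mixed_pd T ?k (Suc m) f)" by blast
  moreover have "mixed_pd T ?k m f = mixed_pd T lam m f" by (rule mixed_pd_cong) auto
  ultimately show ?thesis using rd_continuous_bmeas by simp
qed

text \<open>The boundary terms of Taylor's formula in \<open>x\<^sub>i\<close> involve mixed derivatives, whereas only the pure
  derivatives of \<open>f\<close> are known to vanish at \<open>a\<^sub>i\<close>. Interchanging primitives gives \<open>f = J\<^sub>i\<^sup>r V\<close>, where
  \<open>V\<close> at \<open>x\<^sub>i = a\<^sub>i\<close> is the integrated boundary term of order \<open>r\<close>. Differentiating \<open>r\<close> times in \<open>x\<^sub>i\<close>
  identifies it with a pure derivative of \<open>f\<close>.\<close>

lemma iter_J_mixed_pd: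
  assumes f: "f \<in> C_rd n T a b lam" and lam: "\<forall>j\<in>{1..n}. 1 \<le> lam j"
    and start: "\<forall>j\<in>{1..n}. a j < (bwd_jump (T j) ^^ (lam j - 1)) (b j)"
    and van: "vanishes_at_start n T a b lam f"
  shows "m \<le> n \<Longrightarrow> x \<in> box \<Longrightarrow> f x = iter_J lam m (mixed_pd T lam m f) x"
proof (induction m arbitrary: x)
  case (Suc m)
  define i where "i = Suc m"
  define g where "g = mixed_pd T lam m f"
  define op where "op = iter_J lam m"
  have i: "i \<in> {1..n}" and i': "i \<in> {1..n} - {1..m}" and mn: "m \<le> n" using Suc.prems(1) by (auto simp: i_def)
  have op: "slice_op {1..m} op" unfolding op_def by (rule slice_op_iter_J[OF order_refl mn])
  define D where "D r = pd_iter (T i) i r g" for r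
  note T = closed_T[OF i] b_mem[OF i]
  have fz: "pd_iter (T i) i r f x = 0" if "x \<in> box" "x i = a i" "r \<le> lam i - 1" for x r
    using van i that unfolding vanishes_at_start_def by blast
  have fex: "\<exists>l. has_pd ((kappa ^^ k) (T i)) i (pd_iter (T i) i k f) z l"
    if "z \<in> box" "z i = a i" "k < lam i - 1" for z k
    using van i that unfolding vanishes_at_start_def by blast
  have gd: "bmeas (D r)" if "1 \<le> r" "r \<le> lam i" for r
    using C_rd_bmeas[OF f lam Suc.prems(1)] that unfolding D_def g_def i_def by blast
  have "\<forall>x\<in>box. f x = op ((J i ^^ r) (D r)) x" if "r \<le> lam i" for r
    using that
  proof (induction r)
    case 0
    then show ?case using Suc.IH[OF mn] by (simp add: D_def op_def g_def)
  next
    case (Suc r)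
    have gS: "bmeas (D (Suc r))" using Suc.prems by (intro gd) auto
    have DS: "D (Suc r) = pd ((kappa ^^ r) (T i)) i (D r)" by (simp add: D_def)
    have step: "D r z = D r (z(i := a i)) + J i (D (Suc r)) z"
      if z: "z \<in> box" "z i \<le> (bwd_jump (T i) ^^ r) (b i)" for z
      unfolding DS
    proof (rule taylor_step[OF i z])
      show "\<exists>l. has_pd ((kappa ^^ r) (T i)) i (D r) z l" if "z \<in> box" for z
        using C_rd_exists[OF f lam Suc_leD _ that] Suc.prems C_rd_exists[OF f lam \<open>Suc m \<le> n\<close> _ that, of r]
        unfolding D_def g_def i_def by auto
    qed (use gS DS in simp)
    have gJ: "bmeas (J i (D (Suc r)))" by (rule bmeas_J[OF i gS])
    \<comment> \<open>Order 0 is separate: for \<open>m = 0\<close> the function \<open>D 0\<close>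
      is \<open>f\<close> itself, which is not among the derivatives known to be bounded and Borel.
      The boundary term is here the value of \<open>f\<close> on the face, which is 0.\<close>
    show ?case
    proof (cases "r = 0")
      case r0: True
      have f0: "f (x(i := a i)) = 0" if "x \<in> box" for x
        using fz[of "x(i := a i)" 0] box_freeze[OF that i] by simp
      have fg: "f x = op (D 0) x" if "x \<in> box" for x using Suc.IH Suc.prems r0 that by simp
      have st: "D 0 z = D 0 (z(i := a i)) + 1 * J i (D 1) z" if "z \<in> box" for z
        using step[OF that] r0 boxD(3)[OF that i] by simp
      have "f x = op (J i (D 1)) x" if x: "x \<in> box" for x
      proof (cases "m = 0")
        case True
        then have id: "op q = q" for q by (simp add: op_def)
        show ?thesis using st[OF x] fg[OF box_freeze[OF x i]] fg[OF x] f0[OF x] unfolding id by simp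
      next
        case False
        then obtain m' where m': "m = Suc m'" by (cases m) auto
        have "bmeas g"
          using C_rd_bmeas[OF f lam, of m' "lam (Suc m')"] lam mn unfolding g_def m' by auto
        then have g0: "bmeas (D 0)" by (simp add: D_def)
        have "f x = op (\<lambda>z. D 0 (z(i := a i)) + 1 * J i (D 1) z) x"
          unfolding fg[OF x] by (rule slice_opD(2)[OF op x st])
        also have "\<dots> = op (\<lambda>z. D 0 (z(i := a i))) x + 1 * op (J i (D 1)) x"
          using gJ r0 by (intro slice_opD(3)[OF op _ _ x] bmeas_freeze[OF g0 i]) simp
        also have "op (\<lambda>z. D 0 (z(i := a i))) x = op (D 0) (x(i := a i))"
          by (rule slice_opD(5)[OF op i' x])
        also have "\<dots> = 0" using fg[OF box_freeze[OF x i]] f0[OF x] by simp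
        finally show ?thesis by simp
      qed
      then show ?thesis using r0 by simp
    next
      case False
      have gr: "bmeas (D r)" using Suc.prems False by (intro gd) auto
      define W where "W = op (D r)"
      \<comment> \<open>The right-hand side of Taylor's formula is continuous in variable
        \<open>i\<close> up to \<open>b i\<close>, whereas \<open>W\<close> agrees with it only up
        to \<open>?\<beta>\<close>.\<close>
      define V where "V = op (\<lambda>z. D r (z(i := a i)) + 1 * J i (D (Suc r)) z)"
      define W' where "W' = op (D (Suc r))"
      let ?\<beta> = "(bwd_jump (T i) ^^ r) (b i)"
      have gW': "bmeas W'" unfolding W'_def by (rule slice_opD(1)[OF op gS])
      have gV: "bmeas V"
        unfolding V_def by (intro slice_opD(1)[OF op] bmeas_add_scaled bmeas_freeze gr gJ i)
      have V: "V z = W (z(i := a i)) + J i W' z" if z: "z \<in> box" for z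
      proof -
        have "V z = op (\<lambda>z. D r (z(i := a i))) z + 1 * op (J i (D (Suc r))) z"
          unfolding V_def by (intro slice_opD(3)[OF op _ _ z] bmeas_freeze gr gJ i)
        also have "op (\<lambda>z. D r (z(i := a i))) z = W (z(i := a i))"
          unfolding W_def by (rule slice_opD(5)[OF op i' z])
        also have "op (J i (D (Suc r))) z = J i W' z"
          unfolding W'_def by (rule slice_opD(6)[OF op i' gS z])
        finally show ?thesis by (simp add: fun_upd_def)
      qed
      have WV: "W z = V z" if z: "z \<in> box" "z i \<le> ?\<beta>" for z
        unfolding W_def V_def
      proof (rule slice_opD(2)[OF op z(1)])
        fix y assume y: "y \<in> box" "\<And>l. l \<notin> {1..m} \<Longrightarrow> y l = z l"
        then have "y i = z i" using i' by simp
        then show "D r y = D r (y(i := a i)) + 1 * J i (D (Suc r)) y" using step[OF y(1)] z(2) by simp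
      qed
      \<comment> \<open>Replacing \<open>W\<close> by \<open>V\<close> above \<open>?\<beta>\<close>
        goes unnoticed by \<open>r\<close> primitives.\<close>
      have fV: "f x = (J i ^^ r) V x" if x: "x \<in> box" for x
      proof -
        have "f x = op ((J i ^^ r) (D r)) x" using Suc.IH Suc.prems x by simp
        also have "\<dots> = (J i ^^ r) W x" unfolding W_def by (rule slice_op_J_pow[OF op i' gr x])
        also have "\<dots> = (J i ^^ r) V x"
          by (rule J_pow_cong[OF i WV x funpow_bwd_jump_mono[OF T(1) boxD(1)[OF x i] T(2) boxD(3)[OF x i]]])
        finally show ?thesis .
      qed
      have cV: "slice_cont i V"
        unfolding slice_cont_def
      proof
        fix z assume z: "z \<in> box"
        have c: "continuous_on (T i \<inter> {a i..b i}) (\<lambda>s. W (z(i := a i)) + J i W' (z(i := s)))"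
          using slice_cont_J[OF i gW'] z unfolding slice_cont_def by (intro continuous_intros) blast
        have e: "V (z(i := s)) = W (z(i := a i)) + J i W' (z(i := s))" if "s \<in> T i \<inter> {a i..b i}" for s
          using that V[OF box_upd[OF z i]] by simp
        show "continuous_on (T i \<inter> {a i..b i}) (\<lambda>s. V (z(i := s)))"
          by (rule continuous_on_cong[OF refl e, THEN iffD2, OF _ c])
      qed
      \<comment> \<open>The condition \<open>start\<close> puts \<open>a i\<close> below
        \<open>?\<beta>\<close>, where \<open>r\<close> differentiations recover \<open>V\<close>
        from \<open>f\<close>. At \<open>a i\<close> the primitive in \<open>V\<close> vanishes and
        only the boundary term remains, so it is a pure derivative of \<open>f\<close>.\<close>
      have W0: "W (x(i := a i)) = 0" if x: "x \<in> box" for x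
      proof -
        let ?z = "x(i := a i)"
        have z: "?z \<in> box" by (rule box_freeze[OF x i])
        have "a i < (bwd_jump (T i) ^^ (lam i - 1)) (b i)" using start i by blast
        also have "\<dots> \<le> ?\<beta>" using Suc.prems by (intro funpow_bwd_jump_antimono T) auto
        finally have lt: "?z i < ?\<beta>" by simp
        have "pd_iter (T i) i r f ?z = (J i ^^ (r - r)) V ?z"
          using Suc.prems by (intro pd_iter_J_pow[OF i gV cV fV _ order_refl z lt] fex) auto
        moreover have "pd_iter (T i) i r f ?z = 0" using Suc.prems by (intro fz z) auto
        ultimately have "V ?z = 0" by simp
        then show ?thesis using V[OF z] J_start[of ?z i W'] by simp
      qed
      have "f x = op ((J i ^^ Suc r) (D (Suc r))) x" if x: "x \<in> box" for x
      proof -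
        have "f x = (J i ^^ r) V x" by (rule fV[OF x])
        also have "\<dots> = (J i ^^ r) (J i W') x"
        proof (rule J_pow_cong[OF i _ x])
          show "V z = J i W' z" if "z \<in> box" for z using V[OF that] W0[OF that] by simp
          show "(bwd_jump (T i) ^^ r) (x i) \<le> b i"
            using funpow_bwd_jump(3)[OF T(1), of "x i" r] boxD[OF x i] by simp
        qed
        also have "\<dots> = (J i ^^ Suc r) W' x" by (simp add: funpow_swap1)
        also have "\<dots> = op ((J i ^^ Suc r) (D (Suc r))) x"
          unfolding W'_def by (rule slice_op_J_pow[OF op i' gS x, symmetric])
        finally show ?thesis .
      qed
      then show ?thesis by blast
    qed
  qed
  then show ?case
    using Suc.prems(2) by (auto simp: op_def D_def g_def i_def)
qed simp

section \<open>Bounding repeated primitives by monomials\<close>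

lemma J_mono_end:
  assumes i: "i \<in> {1..n}" and q: "bmeas q" "\<And>z. z \<in> box \<Longrightarrow> 0 \<le> q z" and x: "x \<in> box"
    and t: "t \<in> T i" "a i \<le> t" "t \<le> x i"
  shows "J i q (x(i := t)) \<le> J i q x"
proof -
  note xi = boxD[OF x i]
  have "0 \<le> (\<integral>s. q (x(i := s)) \<partial>delta_on (T i) t (x i))"
    using t xi x i by (intro Bochner_Integration.integral_nonneg) (auto intro!: q(2) box_upd)
  then show ?thesis
    using delta_on_split(2)[OF closed_T[OF i] t(2,3) order_refl section_integrable[OF i q(1) x xi]]
    by (simp add: J_def)
qed

text \<open>The integrand is a primitive, so it vanishes at \<open>a i\<close>, the only possible
  point of \<open>T i\<close> before the forward jump; integration may start at the jump, as in the
  recursion of \<open>h_mono\<close>. The factor \<open>J i q\<close> is first replaced by its value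
  at the upper end and then taken out of the integral.\<close>

lemma J_pow_bound:
  assumes i: "i \<in> {1..n}" and q: "bmeas q" "\<And>z. z \<in> box \<Longrightarrow> 0 \<le> q z"
  shows "x \<in> box \<Longrightarrow> a i < x i \<Longrightarrow>
    (J i ^^ Suc k) q x \<le> h_mono (T i) k (x i) (fwd_jump (T i) (a i)) * J i q x"
proof (induction k arbitrary: x)
  case (Suc k)
  note x = Suc.prems(1) and xi = boxD[OF Suc.prems(1) i] and T = closed_T[OF i]
  let ?\<sigma> = "fwd_jump (T i) (a i)" and ?F = "(J i ^^ Suc k) q"
  have \<sigma>: "?\<sigma> \<in> T i" "a i \<le> ?\<sigma>" "?\<sigma> \<le> x i"
    using fwd_jump_mem[OF T xi(1) Suc.prems(2)] fwd_jump_ge fwd_jump_less_le(2)[OF xi(1) Suc.prems(2)] by auto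
  have F: "bmeas ?F" by (rule bmeas_J_pow[OF i q(1)])
  have F0: "?F (x(i := a i)) = 0" by (simp add: J_start)
  have h0: "0 \<le> h_mono (T i) k t ?\<sigma>" if "t \<in> T i" "?\<sigma> \<le> t" for t
    using h_mono_props(1)[OF T \<sigma>(1)] that by blast
  have Jq: "0 \<le> J i q x" by (rule J_nonneg[OF i x q(2)])
  note sp = delta_on_split[OF T \<sigma>(2,3) order_refl section_integrable[OF i F x xi]]
  have "(J i ^^ Suc (Suc k)) q x = (\<integral>t. ?F (x(i := t)) \<partial>delta_on (T i) (a i) (x i))"
    by (simp add: J_def)
  also have "\<dots> = (\<integral>t. ?F (x(i := t)) \<partial>delta_on (T i) (a i) ?\<sigma>) + (\<integral>t. ?F (x(i := t)) \<partial>delta_on (T i) ?\<sigma> (x i))"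
    by (rule sp(2))
  also have "(\<integral>t. ?F (x(i := t)) \<partial>delta_on (T i) (a i) ?\<sigma>) = (\<integral>t. 0 \<partial>delta_on (T i) (a i) ?\<sigma>)"
  proof (rule Bochner_Integration.integral_cong[OF refl])
    fix t assume "t \<in> space (delta_on (T i) (a i) ?\<sigma>)"
    then have "t \<in> T i" "a i \<le> t" "t < ?\<sigma>" by auto
    then have "t = a i" using fwd_jump_less_le(2)[of t "T i" "a i"] by (cases "t = a i") auto
    then show "?F (x(i := t)) = 0" using F0 by simp
  qed
  also have "(\<integral>t. ?F (x(i := t)) \<partial>delta_on (T i) ?\<sigma> (x i)) \<le> (\<integral>t. h_mono (T i) k t ?\<sigma> * J i q x \<partial>delta_on (T i) ?\<sigma> (x i))"
  proof (rule integral_mono)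
    show "integrable (delta_on (T i) ?\<sigma> (x i)) (\<lambda>t. h_mono (T i) k t ?\<sigma> * J i q x)"
      using h_mono_props(2)[OF T \<sigma>(1) xi(1) \<sigma>(3)] by simp
    fix t assume "t \<in> space (delta_on (T i) ?\<sigma> (x i))"
    then have t: "t \<in> T i" "?\<sigma> \<le> t" "t < x i" by auto
    have zb: "x(i := t) \<in> box" using t \<sigma> xi i by (intro box_upd x) auto
    show "?F (x(i := t)) \<le> h_mono (T i) k t ?\<sigma> * J i q x"
    proof (cases "t = a i")
      case True
      then show ?thesis using F0 h0[OF t(1,2)] Jq by simp
    next
      case False
      then have "a i < (x(i := t)) i" using t \<sigma> by simp
      from Suc.IH[OF zb this] have "?F (x(i := t)) \<le> h_mono (T i) k t ?\<sigma> * J i q (x(i := t))" by (simp add: fun_upd_def)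
      also have "\<dots> \<le> h_mono (T i) k t ?\<sigma> * J i q x"
        using t \<sigma> h0 by (intro mult_left_mono J_mono_end[OF i q x]) auto
      finally show ?thesis .
    qed
  qed (rule sp(1))
  also have "\<dots> = h_mono (T i) (Suc k) (x i) ?\<sigma> * J i q x"
    using delta_integral_eq[OF T \<sigma>(3)] by simp
  finally show ?case by simp
qed simp

text \<open>At \<open>x i = a i\<close> both sides are 0. Beyond \<open>a i\<close> the jump is at
  most \<open>x i\<close>, so the monomial is monotone from \<open>x i\<close> to
  \<open>b i\<close>.\<close>

lemma J_pow_bound_b:
  assumes i: "i \<in> {1..n}" and q: "bmeas q" "\<And>z. z \<in> box \<Longrightarrow> 0 \<le> q z" and x: "x \<in> box"
    and l: "1 \<le> l"
  shows "(J i ^^ l) q x \<le> h_mono (T i) (l - 1) (b i) (fwd_jump (T i) (a i)) * J i q x"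
proof (cases "x i = a i")
  case True
  obtain k where "l = Suc k" using l by (cases l) auto
  then show ?thesis using J_start[of x i "(J i ^^ k) q", OF True] J_start[of x i q, OF True] by simp
next
  case False
  note xi = boxD[OF x i] and T = closed_T[OF i]
  have ax: "a i < x i" using False xi by simp
  let ?\<sigma> = "fwd_jump (T i) (a i)"
  have \<sigma>: "?\<sigma> \<in> T i" "?\<sigma> \<le> x i"
    using fwd_jump_mem[OF T xi(1) ax] fwd_jump_less_le(2)[OF xi(1) ax] by auto
  have "(J i ^^ Suc (l - 1)) q x \<le> h_mono (T i) (l - 1) (x i) ?\<sigma> * J i q x"
    by (rule J_pow_bound[OF i q x ax])
  also have "\<dots> \<le> h_mono (T i) (l - 1) (b i) ?\<sigma> * J i q x"
    using h_mono_props(1)[OF T \<sigma>(1), of "l - 1"] \<sigma> xi b_mem[OF i]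
    by (intro mult_right_mono J_nonneg[OF i x q(2)]) (auto elim!: mono_onD)
  finally show ?thesis using l by simp
qed

lemma h_mono_b_nonneg:
  assumes i: "i \<in> {1..n}" and ab: "a i < b i"
  shows "0 \<le> h_mono (T i) k (b i) (fwd_jump (T i) (a i))"
  using h_mono_props(1)[OF closed_T[OF i] fwd_jump_mem[OF closed_T[OF i] b_mem[OF i] ab], of k]
    fwd_jump_less_le(2)[OF b_mem[OF i] ab] b_mem[OF i] by blast

lemma iter_J_bound:
  assumes lam: "\<forall>j\<in>{1..n}. 1 \<le> lam j" and ab: "\<And>j. j \<in> {1..n} \<Longrightarrow> a j < b j"
  shows "m \<le> n \<Longrightarrow> bmeas q \<Longrightarrow> (\<And>z. z \<in> box \<Longrightarrow> 0 \<le> q z) \<Longrightarrow> x \<in> box \<Longrightarrow>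
    iter_J lam m q x \<le> H_mono m T lam b a * iter_J (\<lambda>_. 1) m q x"
proof (induction m arbitrary: q)
  case 0
  then show ?case by (simp add: H_mono_def)
next
  case (Suc m)
  let ?i = "Suc m"
  let ?c = "h_mono (T ?i) (lam ?i - 1) (b ?i) (fwd_jump (T ?i) (a ?i))"
  have i: "?i \<in> {1..n}" and mn: "m \<le> n" using Suc.prems(1) by auto
  have c: "0 \<le> ?c" by (rule h_mono_b_nonneg[OF i ab[OF i]])
  have H: "0 \<le> H_mono m T lam b a"
    unfolding H_mono_def using mn ab by (intro prod_nonneg ballI h_mono_b_nonneg) auto
  note op = slice_op_iter_J[OF order_refl mn, of lam]
  note gJ = bmeas_J[OF i Suc.prems(2)]
  have 0: "bmeas (\<lambda>z. 0)" by (auto simp: bmeas_def)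
  have gcJ: "bmeas (\<lambda>z. 0 + ?c * J ?i q z)" by (rule bmeas_add_scaled[OF 0 gJ])
  have op0: "iter_J lam m (\<lambda>z. 0) x = 0"
    using slice_opD(3)[OF op 0 0 Suc.prems(4), of 1] by simp
  have "iter_J lam (Suc m) q x = iter_J lam m ((J ?i ^^ lam ?i) q) x" by simp
  also have "\<dots> \<le> iter_J lam m (\<lambda>z. 0 + ?c * J ?i q z) x"
    using J_pow_bound_b[OF i Suc.prems(2,3)] lam i
    by (intro slice_opD(4)[OF op bmeas_J_pow[OF i Suc.prems(2)] gcJ _ Suc.prems(4)]) auto
  also have "\<dots> = ?c * iter_J lam m (J ?i q) x"
    using slice_opD(3)[OF op 0 gJ Suc.prems(4)] op0 by simp
  also have "\<dots> \<le> ?c * (H_mono m T lam b a * iter_J (\<lambda>_. 1) m (J ?i q) x)"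
    using Suc.prems(3) by (intro mult_left_mono Suc.IH mn gJ J_nonneg i c Suc.prems(4)) auto
  also have "\<dots> = H_mono (Suc m) T lam b a * iter_J (\<lambda>_. 1) (Suc m) q x"
    by (simp add: H_mono_def mult_ac)
  finally show ?case .
qed

section \<open>Iterated primitives as integrals over boxes\<close>

lemma finite_measure_PiM_axis:
  assumes "corner x" "m \<le> n"
  shows "finite_measure (box_meas m x)"
proof -
  interpret product_sigma_finite "axis_measure x" by (rule product_sigma_finite_axis[OF assms(1)])
  have "emeasure (axis_measure x j) (space (axis_measure x j)) \<noteq> top" if "j \<in> {1..m}" for j
    using finite_measure.emeasure_finite[OF finite_measure_axis[OF assms(1), of j], of "space (axis_measure x j)"]
      that assms(2) by auto
  then show ?thesis
    by (intro finite_measureI) (simp add: space_PiM emeasure_PiM ennreal_prod_eq_top)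
qed

lemma measurable_overwrite:
  assumes x: "x \<in> box" and m: "m \<le> n"
  shows "(\<lambda>y. overwrite m y x) \<in> measurable (box_meas m x) box_space"
  unfolding box_space_def
proof (rule measurable_PiM_single')
  fix j assume j: "j \<in> {1..n}"
  show "(\<lambda>y. overwrite m y x j) \<in> measurable (box_meas m x) (restrict_space borel (T j \<inter> {a j..b j}))"
  proof (cases "j \<in> {1..m}")
    case True
    have "(\<lambda>y. y j) \<in> measurable (box_meas m x) (delta_on (T j) (a j) (x j))"
      using measurable_component_singleton[OF True, of "axis_measure x"] j by (simp add: axis_measure_def)
    from measurable_compose[OF this measurable_delta_on_id[OF boxD(3)[OF x j]]]
    show ?thesis using True by (simp add: overwrite_def)
  next
    case False
    then show ?thesis unfolding overwrite_def if_not_P[OF False]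
      using boxD[OF x j] by (intro measurable_const) (auto simp: space_restrict_space)
  qed
next
  show "(\<lambda>y. overwrite m y x) \<in> space (box_meas m x) \<rightarrow>
      (\<Pi>\<^sub>E i\<in>{1..n}. space (restrict_space borel (T i \<inter> {a i..b i})))"
    using overwrite_box(1)[OF x m] by (auto simp: space_restrict_space ts_box_def)
qed

lemma integrable_overwrite:
  assumes "x \<in> box" "m \<le> n" "bmeas q"
  shows "integrable (box_meas m x) (\<lambda>y. q (overwrite m y x))"
proof -
  interpret finite_measure "box_meas m x"
    by (rule finite_measure_PiM_axis[OF box_corner[OF assms(1)] assms(2)])
  obtain C where C: "\<And>x. x \<in> box \<Longrightarrow> \<bar>q x\<bar> \<le> C" using assms(3) unfolding bmeas_def by blast
  have "(\<lambda>y. q (overwrite m y x)) \<in> borel_measurable (box_meas m x)"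
    using measurable_compose[OF measurable_overwrite[OF assms(1,2)]] assms(3) unfolding bmeas_def by auto
  then show ?thesis
    using overwrite_box(1)[OF assms(1,2)] C by (intro integrable_const_bound[of _ C] AE_I2) auto
qed

lemma iter_J_1_eq:
  "m \<le> n \<Longrightarrow> x \<in> box \<Longrightarrow> bmeas q \<Longrightarrow>
    iter_J (\<lambda>_. 1) m q x = (\<integral>y. q (overwrite m y x) \<partial>box_meas m x)"
proof (induction m arbitrary: q)
  case 0
  then show ?case by (simp add: PiM_empty lebesgue_integral_count_space_finite)
next
  case (Suc m)
  interpret product_sigma_finite "axis_measure x"
    by (rule product_sigma_finite_axis[OF box_corner[OF Suc.prems(2)]])
  let ?i = "Suc m"
  have i: "?i \<in> {1..n}" using Suc.prems(1) by auto
  have I: "finite {1..m}" "?i \<notin> {1..m}" by auto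
  have ins: "{1..Suc m} = insert ?i {1..m}" by auto
  have "iter_J (\<lambda>_. 1) ?i q x = iter_J (\<lambda>_. 1) m (J ?i q) x" by simp
  also have "\<dots> = (\<integral>y. J ?i q (overwrite m y x) \<partial>box_meas m x)"
    using Suc.prems by (intro Suc.IH bmeas_J i) auto
  also have "\<dots> = (\<integral>y. (\<integral>t. q (overwrite ?i (y(?i := t)) x) \<partial>axis_measure x ?i) \<partial>box_meas m x)"
    unfolding overwrite_Suc using i by (simp add: J_def axis_measure_def overwrite_def)
  also have "\<dots> = (\<integral>y. q (overwrite ?i y x) \<partial>box_meas ?i x)"
    using integrable_overwrite[OF Suc.prems(2,1,3)]
    unfolding ins by (rule product_integral_insert[OF I, symmetric])
  finally show ?case .
qed

end

section \<open>The class \<open>\<H>\<^sup>m\<^sub>\<infinity>\<close>\<close>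

text \<open>At an interior point the infimum of the difference quotients to the right is a slope,
  non-negative because \<open>p\<close> increases; at 0 monotonicity alone gives the slope 0. The
  sign is essential, as \<open>|f|\<close> is only estimated from above.\<close>

lemma convex_mono_support:
  fixes p :: "real \<Rightarrow> real"
  assumes cvx: "convex_on {0..} p" and mono: "mono_on {0..} p" and z0: "0 \<le> z0"
  shows "\<exists>c\<ge>0. \<forall>z\<ge>0. p z0 + c * (z - z0) \<le> p z"
proof (cases "z0 = 0")
  case True
  then show ?thesis using mono by (intro exI[of _ 0]) (auto elim: mono_onD)
next
  case False
  define c where "c = Inf ((\<lambda>t. (p z0 - p t) / (z0 - t)) ` ({z0<..} \<inter> {0..}))"
  have "z0 \<in> interior {0..}" using z0 False by simp
  then have "p z0 + c * (z - z0) \<le> p z" if "z \<ge> 0" for z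
    using convex_le_Inf_differential[OF cvx, of z0 z] that unfolding c_def by simp
  moreover have "0 \<le> c"
    unfolding c_def
  proof (rule cInf_greatest)
    have "z0 + 1 \<in> {z0<..} \<inter> {0..}" using z0 by simp
    then show "(\<lambda>t. (p z0 - p t) / (z0 - t)) ` ({z0<..} \<inter> {0..}) \<noteq> {}" by blast
    fix s assume "s \<in> (\<lambda>t. (p z0 - p t) / (z0 - t)) ` ({z0<..} \<inter> {0..})"
    then obtain t where "t > z0" "s = (p z0 - p t) / (z0 - t)" by auto
    then show "0 \<le> s" using mono_onD[OF mono, of z0 t] z0 by (auto intro: divide_nonpos_neg)
  qed
  ultimately show ?thesis by blast
qed

lemma frechet_derivative_partial:
  fixes F :: "real ^ 'm::finite \<Rightarrow> real"
  assumes "F differentiable (at y)"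
  shows "frechet_derivative F (at y) v = (\<Sum>i\<in>UNIV. v $ i * partial i F y)"
proof -
  have lin: "linear (frechet_derivative F (at y))"
    using assms frechet_derivative_works has_derivative_linear by blast
  have "v = (\<Sum>i\<in>UNIV. (v $ i) *\<^sub>R axis i 1)"
    using basis_expansion[of v] by (simp add: scalar_mult_eq_scaleR)
  then have "frechet_derivative F (at y) v = frechet_derivative F (at y) (\<Sum>i\<in>UNIV. (v $ i) *\<^sub>R axis i 1)"
    by simp
  also have "\<dots> = (\<Sum>i\<in>UNIV. v $ i * partial i F y)"
    by (simp add: linear_sum[OF lin] linear_scale[OF lin] partial_def)
  finally show ?thesis .
qed

context
  fixes F :: "real ^ 'm::finite \<Rightarrow> real"
  assumes F: "F \<in> H_infty"
begin

lemma partial_mono_pos: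
  assumes y: "\<And>l. 0 < y $ l" and yz: "\<And>l. y $ l \<le> z $ l"
  shows "partial i F y \<le> partial i F z"
proof -
  \<comment> \<open>Coordinates are raised from \<open>y\<close> to \<open>z\<close> one at a time,
    because monotonicity is given in each variable separately.\<close>
  define w where "w S = (\<chi> l. if l \<in> S then z $ l else y $ l)" for S
  have "partial i F y \<le> partial i F (w S)" for S
  proof (induction S rule: finite_induct[OF finite])
    case 1
    then show ?case by (simp add: w_def)
  next
    case (2 k S)
    have wpos: "\<forall>l. 0 < w S $ l" using y yz less_le_trans unfolding w_def by fastforce
    have mono: "mono_on {0<..} (\<lambda>t. partial i F (\<chi> l. if l = k then t else w S $ l))"
      using F wpos unfolding H_infty_def by blast
    have "w S = (\<chi> l. if l = k then y $ k else w S $ l)" using 2(2) by (simp add: w_def vec_eq_iff)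
    moreover have "w (insert k S) = (\<chi> l. if l = k then z $ k else w S $ l)" by (simp add: w_def vec_eq_iff)
    ultimately have "partial i F (w S) \<le> partial i F (w (insert k S))"
      using mono_onD[OF mono, of "y $ k" "z $ k"] y[of k] yz[of k] by simp
    then show ?case using 2(3) by simp
  qed
  from this[of UNIV] show ?thesis by (simp add: w_def)
qed

text \<open>\<open>H_infty\<close> speaks of the open orthant only, but the arguments met later may
  have zero coordinates. Shifting all coordinates up by \<open>1 / real (Suc k)\<close> and using
  continuity of the partial derivatives reaches the closed orthant.\<close>

lemma partial_limit:
  "(\<lambda>k. partial i F (y + (1 / real (Suc k)) *\<^sub>R 1)) \<longlonglongrightarrow> partial i F y"
proof -
  have "(\<lambda>k. y + (1 / real (Suc k)) *\<^sub>R 1) \<longlonglongrightarrow> y + 0 *\<^sub>R 1"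
    using LIMSEQ_inverse_real_of_nat by (intro tendsto_intros) (simp add: inverse_eq_divide)
  then have "(\<lambda>k. y + (1 / real (Suc k)) *\<^sub>R 1) \<longlonglongrightarrow> y" by simp
  moreover have "isCont (partial i F) y"
    using F by (simp add: H_infty_def C1_fun_def continuous_on_eq_continuous_at)
  ultimately show ?thesis by (rule isCont_tendsto_compose[rotated])
qed

lemma partial_mono:
  assumes "\<And>l. 0 \<le> y $ l" "\<And>l. y $ l \<le> z $ l"
  shows "partial i F y \<le> partial i F z"
proof (rule LIMSEQ_le[OF partial_limit partial_limit], intro exI allI impI)
  fix k :: nat
  show "partial i F (y + (1 / real (Suc k)) *\<^sub>R 1) \<le> partial i F (z + (1 / real (Suc k)) *\<^sub>R 1)"
    using assms by (intro partial_mono_pos) (auto intro: add_nonneg_pos)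
qed

lemma partial_nonneg:
  assumes "\<And>l. 0 \<le> y $ l"
  shows "0 \<le> partial i F y"
proof (rule LIMSEQ_le_const[OF partial_limit], intro exI allI impI)
  fix k :: nat
  have "\<forall>l. 0 < (y + (1 / real (Suc k)) *\<^sub>R 1) $ l" using assms by (auto intro: add_nonneg_pos)
  then show "0 \<le> partial i F (y + (1 / real (Suc k)) *\<^sub>R 1)" using F unfolding H_infty_def by blast
qed

text \<open>The mean value theorem along the segment from \<open>y\<close> to \<open>z\<close> gives
  a point above \<open>y\<close>, where every partial derivative is at least its value at
  \<open>y\<close>.\<close>

lemma partial_increment_le:
  assumes y: "\<And>l. 0 \<le> y $ l" and yz: "\<And>l. y $ l \<le> z $ l"
  shows "(\<Sum>i\<in>UNIV. partial i F y * (z $ i - y $ i)) \<le> F z - F y"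
proof -
  have diff: "F differentiable (at x)" for x using F by (simp add: H_infty_def C1_fun_def)
  have der: "((\<lambda>t. F (y + t *\<^sub>R (z - y))) has_real_derivative frechet_derivative F (at (y + t *\<^sub>R (z - y))) (z - y)) (at t)" for t
  proof -
    let ?F' = "frechet_derivative F (at (y + t *\<^sub>R (z - y)))"
    have F': "(F has_derivative ?F') (at (y + t *\<^sub>R (z - y)))"
      using diff frechet_derivative_works by blast
    have "((\<lambda>t. y + t *\<^sub>R (z - y)) has_derivative (\<lambda>h. h *\<^sub>R (z - y))) (at t)"
      by (auto intro!: derivative_eq_intros)
    from has_derivative_compose[OF this F']
    show ?thesis
      using linear_scale[OF has_derivative_linear[OF F']] by (simp add: has_field_derivative_def mult.commute[of _ "?F' (z - y)"])
  qed
  obtain t where t: "0 < t" "t < 1"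
    "F (y + 1 *\<^sub>R (z - y)) - F (y + 0 *\<^sub>R (z - y)) = (1 - 0) * frechet_derivative F (at (y + t *\<^sub>R (z - y))) (z - y)"
    using MVT2[of 0 1 "\<lambda>t. F (y + t *\<^sub>R (z - y))" "\<lambda>t. frechet_derivative F (at (y + t *\<^sub>R (z - y))) (z - y)"] der
    by auto
  have "(\<Sum>i\<in>UNIV. partial i F y * (z $ i - y $ i)) \<le> (\<Sum>i\<in>UNIV. (z - y) $ i * partial i F (y + t *\<^sub>R (z - y)))"
  proof (rule sum_mono)
    fix i
    have "partial i F y \<le> partial i F (y + t *\<^sub>R (z - y))"
      using t yz by (intro partial_mono y) auto
    then have "partial i F y * (z $ i - y $ i) \<le> partial i F (y + t *\<^sub>R (z - y)) * (z $ i - y $ i)"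
      using yz[of i] by (intro mult_right_mono) auto
    then show "partial i F y * (z $ i - y $ i) \<le> (z - y) $ i * partial i F (y + t *\<^sub>R (z - y))"
      by (simp add: mult.commute)
  qed
  also have "\<dots> = F z - F y" using t(3) frechet_derivative_partial[OF diff] by simp
  finally show ?thesis .
qed

text \<open>The integral on the left is the limit of its lower Riemann-Stieltjes sums for the masses
  \<open>m\<^sub>l(t)\<close> of \<open>{c < t}\<close>; monotonicity of the partial derivatives makes each of these sums a
  telescoping lower bound of \<open>F\<close> at the total masses.\<close>

lemma integral_partial_le:
  fixes g :: "'m \<Rightarrow> 'a \<Rightarrow> real" and c :: "'a \<Rightarrow> real"
  assumes g: "\<And>i. integrable M (g i)" and g0: "\<And>i \<omega>. \<omega> \<in> space M \<Longrightarrow> 0 \<le> g i \<omega>"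
    and c: "c \<in> borel_measurable M" "\<And>\<omega>. \<omega> \<in> space M \<Longrightarrow> \<alpha> \<le> c \<omega> \<and> c \<omega> < \<beta>" and ab: "\<alpha> < \<beta>"
  defines "m \<equiv> \<lambda>t. \<chi> l. \<integral>\<omega>. indicator {..<t} (c \<omega>) * g l \<omega> \<partial>M"
  shows "integrable M (\<lambda>\<omega>. \<Sum>i\<in>UNIV. partial i F (m (c \<omega>)) * g i \<omega>)"
    and "(\<integral>\<omega>. (\<Sum>i\<in>UNIV. partial i F (m (c \<omega>)) * g i \<omega>) \<partial>M) \<le> F (\<chi> i. \<integral>\<omega>. g i \<omega> \<partial>M)"
proof -
  note [measurable] = c(1) borel_measurable_integrable[OF g]
  have int: "integrable M (\<lambda>\<omega>. indicator S (c \<omega>) * g l \<omega>)" if "S \<in> sets borel" for S l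
    by (rule Bochner_Integration.integrable_bound[OF g[of l]]) (use that in \<open>auto simp: indicator_def\<close>)
  have m0: "0 \<le> m t $ l" for t l
    unfolding m_def using g0 by (auto intro!: Bochner_Integration.integral_nonneg)
  have m_mono: "m s $ l \<le> m t $ l" if "s \<le> t" for s t l
    unfolding m_def vec_lambda_beta using that
    by (intro integral_mono int mult_right_mono g0) (auto simp: indicator_def)
  have m\<alpha>: "m \<alpha> = 0"
    unfolding m_def vec_eq_iff using c(2) by (auto intro!: integral_eq_zero_AE AE_I2 simp: indicator_def not_less)
  have m\<beta>: "m t = (\<chi> i. \<integral>\<omega>. g i \<omega> \<partial>M)" if "\<beta> \<le> t" for t
    unfolding m_def vec_eq_iff using c(2) that
    by (auto intro!: Bochner_Integration.integral_cong simp: indicator_def) (meson less_le_trans not_less)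
  \<comment> \<open>The level set of \<open>c\<close> at \<open>t\<close> may carry positive mass,
    as happens at right-scattered points. It is not counted in \<open>m t\<close>, which makes
    \<open>m\<close> left-continuous, and the grid points below approach \<open>c \<omega>\<close>
    from the left.\<close>
  have m_left: "(\<lambda>k. m (s k)) \<longlonglongrightarrow> m t" if s: "\<And>k. s k \<le> t" "s \<longlonglongrightarrow> t" for s :: "nat \<Rightarrow> real" and t
  proof (rule vec_tendstoI)
    fix l
    show "(\<lambda>k. m (s k) $ l) \<longlonglongrightarrow> m t $ l"
      unfolding m_def vec_lambda_beta
    proof (rule integral_dominated_convergence[where w = "g l"])
      show "AE \<omega> in M. (\<lambda>k. indicator {..<s k} (c \<omega>) * g l \<omega>) \<longlonglongrightarrow> indicator {..<t} (c \<omega>) * g l \<omega>"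
      proof (intro AE_I2 tendsto_eventually)
        fix \<omega>
        show "eventually (\<lambda>k. indicator {..<s k} (c \<omega>) * g l \<omega> = indicator {..<t} (c \<omega>) * g l \<omega>) sequentially"
        proof (cases "c \<omega> < t")
          case True
          show ?thesis using order_tendstoD(1)[OF s(2) True] by eventually_elim (use True in \<open>simp add: indicator_def\<close>)
        next
          case False
          then have "\<not> c \<omega> < s k" for k using s(1)[of k] by simp
          then show ?thesis using False by (simp add: indicator_def)
        qed
      qed
    qed (use g g0 in \<open>auto simp: indicator_def intro!: AE_I2\<close>)
  qed
  have partial_cont: "isCont (partial i F) x" for i x
    using F by (simp add: H_infty_def C1_fun_def continuous_on_eq_continuous_at)
  define h where "h N = (\<beta> - \<alpha>) / real (Suc N)" for N
  define t where "t N j = \<alpha> + real j * h N" for N j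
  have h: "h N > 0" for N using ab by (simp add: h_def)
  have tK: "t N (Suc N) = \<beta>" for N by (simp add: t_def h_def field_simps)
  have t_Suc: "t N j \<le> t N (Suc j)" for N j using h[of N] by (simp add: t_def algebra_simps)
  \<comment> \<open>A lower sum: on each slab of the grid the partial derivatives are evaluated at
    the mass below its left end.\<close>
  define u where "u N \<omega> = (\<Sum>j<Suc N. \<Sum>i\<in>UNIV. partial i F (m (t N j)) * (indicator {t N j..<t N (Suc j)} (c \<omega>) * g i \<omega>))" for N \<omega>
  have u_int: "integrable M (u N)" for N
    unfolding u_def by (intro Bochner_Integration.integrable_sum integrable_mult_right int) auto
  define J where "J N x = nat \<lfloor>(x - \<alpha>) / h N\<rfloor>" for N x
  have J: "J N x < Suc N \<and> t N (J N x) \<le> x \<and> x < t N (Suc (J N x))" if x: "\<alpha> \<le> x" "x < \<beta>" for N x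
  proof -
    have "0 \<le> (x - \<alpha>) / h N" using x h[of N] by simp
    then have rJ: "real (J N x) = of_int \<lfloor>(x - \<alpha>) / h N\<rfloor>" unfolding J_def by simp
    have "real (J N x) \<le> (x - \<alpha>) / h N" "(x - \<alpha>) / h N < real (J N x) + 1" unfolding rJ by linarith+
    then have 1: "real (J N x) * h N \<le> x - \<alpha>" "x - \<alpha> < (real (J N x) + 1) * h N"
      using h[of N] by (simp_all add: pos_le_divide_eq pos_divide_less_eq)
    then have "real (J N x) * h N < real (Suc N) * h N" using x by (simp add: h_def)
    then have "J N x < Suc N" using h[of N] by (simp add: mult_less_cancel_right)
    then show ?thesis using 1 by (auto simp: t_def algebra_simps)
  qed
  have J_unique: "j = J N x" if x: "\<alpha> \<le> x" "x < \<beta>" and j: "t N j \<le> x" "x < t N (Suc j)" for N x j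
  proof -
    have "real j * h N < real (Suc (J N x)) * h N" "real (J N x) * h N < real (Suc j) * h N"
      using J[OF x, of N] j by (auto simp: t_def)
    then have "j < Suc (J N x)" "J N x < Suc j" using h[of N] by (simp_all only: mult_less_cancel_right of_nat_less_iff)
    then show ?thesis by simp
  qed
  have u_eq: "u N \<omega> = (\<Sum>i\<in>UNIV. partial i F (m (t N (J N (c \<omega>)))) * g i \<omega>)" if \<omega>: "\<omega> \<in> space M" for N \<omega>
  proof -
    have x: "\<alpha> \<le> c \<omega>" "c \<omega> < \<beta>" using c(2)[OF \<omega>] by auto
    have "u N \<omega> = (\<Sum>j<Suc N. if j = J N (c \<omega>) then (\<Sum>i\<in>UNIV. partial i F (m (t N j)) * g i \<omega>) else 0)"
      unfolding u_def
    proof (rule sum.cong[OF refl])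
      fix j
      have "indicator {t N j..<t N (Suc j)} (c \<omega>) = (if j = J N (c \<omega>) then 1 else 0 :: real)"
      proof (cases "j = J N (c \<omega>)")
        case True
        then show ?thesis using J[OF x, of N] by simp
      next
        case False
        then have "\<not> (t N j \<le> c \<omega> \<and> c \<omega> < t N (Suc j))" using J_unique[OF x] by blast
        then show ?thesis using False by (simp add: indicator_def)
      qed
      then show "(\<Sum>i\<in>UNIV. partial i F (m (t N j)) * (indicator {t N j..<t N (Suc j)} (c \<omega>) * g i \<omega>))
        = (if j = J N (c \<omega>) then (\<Sum>i\<in>UNIV. partial i F (m (t N j)) * g i \<omega>) else 0)" by simp
    qed
    also have "\<dots> = (\<Sum>i\<in>UNIV. partial i F (m (t N (J N (c \<omega>)))) * g i \<omega>)"
      using J[OF x, of N] by (subst sum.delta) auto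
    finally show ?thesis .
  qed
  have h0: "h \<longlonglongrightarrow> 0"
  proof -
    have "(\<lambda>N. (\<beta> - \<alpha>) * inverse (real (Suc N))) \<longlonglongrightarrow> (\<beta> - \<alpha>) * 0"
      by (intro tendsto_intros LIMSEQ_inverse_real_of_nat)
    then show ?thesis by (simp add: h_def[abs_def] divide_inverse)
  qed
  have u_lim: "(\<lambda>N. u N \<omega>) \<longlonglongrightarrow> (\<Sum>i\<in>UNIV. partial i F (m (c \<omega>)) * g i \<omega>)" if \<omega>: "\<omega> \<in> space M" for \<omega>
  proof -
    have x: "\<alpha> \<le> c \<omega>" "c \<omega> < \<beta>" using c(2)[OF \<omega>] by auto
    have "(\<lambda>N. c \<omega> - h N) \<longlonglongrightarrow> c \<omega> - 0" by (intro tendsto_intros h0)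
    then have low: "(\<lambda>N. c \<omega> - h N) \<longlonglongrightarrow> c \<omega>" by simp
    have "c \<omega> - h N \<le> t N (J N (c \<omega>))" "t N (J N (c \<omega>)) \<le> c \<omega>" for N
      using J[OF x, of N] by (auto simp: t_def algebra_simps)
    then have "(\<lambda>N. t N (J N (c \<omega>))) \<longlonglongrightarrow> c \<omega>" "\<And>N. t N (J N (c \<omega>)) \<le> c \<omega>"
      by (auto intro!: tendsto_sandwich[OF _ _ low tendsto_const])
    then have "(\<lambda>N. m (t N (J N (c \<omega>)))) \<longlonglongrightarrow> m (c \<omega>)" by (intro m_left) auto
    then have "(\<lambda>N. \<Sum>i\<in>UNIV. partial i F (m (t N (J N (c \<omega>)))) * g i \<omega>) \<longlonglongrightarrow> (\<Sum>i\<in>UNIV. partial i F (m (c \<omega>)) * g i \<omega>)"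
      by (intro tendsto_intros isCont_tendsto_compose[OF partial_cont])
    then show ?thesis by (simp add: u_eq[OF \<omega>])
  qed
  \<comment> \<open>Partial derivatives at the total masses bound those at all smaller masses, which
    gives an integrable majorant independent of the grid.\<close>
  define w where "w \<omega> = (\<Sum>i\<in>UNIV. partial i F (m \<beta>) * g i \<omega>)" for \<omega>
  have w: "integrable M w" unfolding w_def by (intro Bochner_Integration.integrable_sum integrable_mult_right g)
  have bound: "norm (u N \<omega>) \<le> w \<omega>" if \<omega>: "\<omega> \<in> space M" for N \<omega>
  proof -
    have "t N (J N (c \<omega>)) \<le> \<beta>" using J[of "c \<omega>" N] c(2)[OF \<omega>] by auto
    then have "partial i F (m (t N (J N (c \<omega>)))) \<le> partial i F (m \<beta>)" for i
      by (intro partial_mono m0 m_mono)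
    then have "u N \<omega> \<le> w \<omega>"
      unfolding u_eq[OF \<omega>] w_def by (intro sum_mono mult_right_mono g0[OF \<omega>])
    moreover have "0 \<le> u N \<omega>"
      unfolding u_eq[OF \<omega>] by (intro sum_nonneg mult_nonneg_nonneg partial_nonneg m0 g0[OF \<omega>])
    ultimately show ?thesis by simp
  qed
  have lim_meas: "(\<lambda>\<omega>. \<Sum>i\<in>UNIV. partial i F (m (c \<omega>)) * g i \<omega>) \<in> borel_measurable M"
    by (rule borel_measurable_LIMSEQ_real[OF u_lim borel_measurable_integrable[OF u_int]])
  show "integrable M (\<lambda>\<omega>. \<Sum>i\<in>UNIV. partial i F (m (c \<omega>)) * g i \<omega>)"
    by (rule integrable_dominated_convergence[where s = u and w = w])
      (use u_lim bound lim_meas borel_measurable_integrable[OF u_int] w in auto)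
  have "(\<lambda>N. integral\<^sup>L M (u N)) \<longlonglongrightarrow> (\<integral>\<omega>. (\<Sum>i\<in>UNIV. partial i F (m (c \<omega>)) * g i \<omega>) \<partial>M)"
    by (rule integral_dominated_convergence[where s = u and w = w])
      (use u_lim bound lim_meas borel_measurable_integrable[OF u_int] w in auto)
  moreover have "integral\<^sup>L M (u N) \<le> F (\<chi> i. \<integral>\<omega>. g i \<omega> \<partial>M)" for N
  proof -
    have incr: "(\<integral>\<omega>. indicator {t N j..<t N (Suc j)} (c \<omega>) * g i \<omega> \<partial>M) = m (t N (Suc j)) $ i - m (t N j) $ i" for i j
    proof -
      have "(\<integral>\<omega>. indicator {t N j..<t N (Suc j)} (c \<omega>) * g i \<omega> \<partial>M)
        = (\<integral>\<omega>. indicator {..<t N (Suc j)} (c \<omega>) * g i \<omega> - indicator {..<t N j} (c \<omega>) * g i \<omega> \<partial>M)"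
        using t_Suc[of N j] by (intro Bochner_Integration.integral_cong) (auto simp: indicator_def)
      also have "\<dots> = m (t N (Suc j)) $ i - m (t N j) $ i"
        unfolding m_def vec_lambda_beta by (intro Bochner_Integration.integral_diff int) auto
      finally show ?thesis .
    qed
    have "integral\<^sup>L M (u N) = (\<Sum>j<Suc N. \<Sum>i\<in>UNIV. partial i F (m (t N j)) * (m (t N (Suc j)) $ i - m (t N j) $ i))"
      unfolding u_def
      by (subst Bochner_Integration.integral_sum, (intro Bochner_Integration.integrable_sum integrable_mult_right int, simp),
          rule sum.cong[OF refl], subst Bochner_Integration.integral_sum, (intro integrable_mult_right int, simp))
        (simp add: incr)
    also have "\<dots> \<le> (\<Sum>j<Suc N. F (m (t N (Suc j))) - F (m (t N j)))"
      using m0 m_mono[OF t_Suc] by (intro sum_mono partial_increment_le) auto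
    also have "\<dots> = F (m (t N (Suc N))) - F (m (t N 0))" by (rule sum_lessThan_telescope)
    also have "\<dots> = F (\<chi> i. \<integral>\<omega>. g i \<omega> \<partial>M)"
      using F tK[of N] m\<alpha> m\<beta>[of \<beta>] by (simp add: t_def H_infty_def)
    finally show ?thesis .
  qed
  ultimately show "(\<integral>\<omega>. (\<Sum>i\<in>UNIV. partial i F (m (c \<omega>)) * g i \<omega>) \<partial>M) \<le> F (\<chi> i. \<integral>\<omega>. g i \<omega> \<partial>M)"
    by (intro LIMSEQ_le_const2) auto
qed

end

section \<open>The inequality\<close>

context time_scale_box
begin

text \<open>Both sides agree on rectangles, where passing to \<open>x\<close> cuts each side at
  \<open>x j\<close>. Integrals over the boxes below different corners thereby become integrals
  against a single measure.\<close>

lemma distr_axis_measure: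
  assumes x: "corner x"
  shows "distr (box_meas n x) (box_meas n b) (\<lambda>y. y)
    = density (box_meas n b) (indicator {y \<in> space (box_meas n b). \<forall>j\<in>{1..n}. y j < x j})"
    (is "distr ?X ?B _ = density _ (indicator ?E)")
    and measurable_axis_id: "(\<lambda>y. y) \<in> measurable (box_meas n x) (box_meas n b)"
    and "{y \<in> space (box_meas n b). \<forall>j\<in>{1..n}. y j < x j} \<in> sets (box_meas n b)"
proof -
  interpret X: product_sigma_finite "axis_measure x" by (rule product_sigma_finite_axis[OF x])
  interpret B: product_sigma_finite "axis_measure b" by (rule product_sigma_finite_axis[OF corner_b])
  have xj: "x j \<in> T j" "a j \<le> x j" "x j \<le> b j" if "j \<in> {1..n}" for j using x that by (auto simp: corner_def)
  have sets_axis: "A \<in> sets (axis_measure z j) \<longleftrightarrow> A \<in> sets borel \<and> A \<subseteq> T j \<inter> {a j..<z j}" if "j \<in> {1..n}" for A z j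
    using closed_T[OF that] that by (auto simp: axis_measure_def sets_delta_on sets_restrict_space_iff)
  have cut: "A \<inter> {..<x j} \<in> sets (axis_measure x j)" "A \<inter> {..<x j} \<in> sets (axis_measure b j)"
    "emeasure (axis_measure x j) (A \<inter> {..<x j}) = emeasure (axis_measure b j) (A \<inter> {..<x j})"
    if "j \<in> {1..n}" "A \<in> sets (axis_measure b j)" for A j
  proof -
    have A: "A \<in> sets borel" "A \<subseteq> T j \<inter> {a j..<b j}" using that sets_axis by auto
    then have Ab: "A \<inter> {..<x j} \<in> sets borel" by auto
    show "A \<inter> {..<x j} \<in> sets (axis_measure x j)" "A \<inter> {..<x j} \<in> sets (axis_measure b j)"
      using A that by (auto simp: sets_axis)
    have "A \<inter> {..<x j} = (A \<inter> {..<x j}) \<inter> (T j \<inter> {a j..<x j})" "A \<inter> {..<x j} = (A \<inter> {..<x j}) \<inter> (T j \<inter> {a j..<b j})"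
      using A by auto
    then show "emeasure (axis_measure x j) (A \<inter> {..<x j}) = emeasure (axis_measure b j) (A \<inter> {..<x j})"
      using emeasure_delta_on[OF closed_T[OF that(1)] Ab, of "a j" "x j"]
        emeasure_delta_on[OF closed_T[OF that(1)] Ab, of "a j" "b j"] that(1)
      by (simp add: axis_measure_def)
  qed
  show id: "(\<lambda>y. y) \<in> measurable ?X ?B"
  proof (rule measurable_PiM_single')
    fix j assume j: "j \<in> {1..n}"
    have "(\<lambda>y. y j) \<in> measurable ?X (axis_measure x j)" by (rule measurable_component_singleton[OF j])
    moreover have "(\<lambda>t. t) \<in> measurable (axis_measure x j) (axis_measure b j)"
    proof (rule measurableI)
      fix A assume A: "A \<in> sets (axis_measure b j)"
      have "(\<lambda>t. t) -` A \<inter> space (axis_measure x j) = A \<inter> {..<x j}"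
        using A j sets_axis[OF j, of A b] by (auto simp: space_axis_measure)
      then show "(\<lambda>t. t) -` A \<inter> space (axis_measure x j) \<in> sets (axis_measure x j)"
        using cut(1)[OF j A] by simp
    qed (use j xj(3)[OF j] in \<open>auto simp: space_axis_measure\<close>)
    ultimately show "(\<lambda>y. y j) \<in> measurable ?X (axis_measure b j)" by (rule measurable_compose)
  next
    show "(\<lambda>y. y) \<in> space ?X \<rightarrow> (\<Pi>\<^sub>E i\<in>{1..n}. space (axis_measure b i))"
    proof
      fix y assume "y \<in> space ?X"
      then have "y \<in> (\<Pi>\<^sub>E i\<in>{1..n}. T i \<inter> {a i..<x i})" by (simp only: space_PiM_axis[OF order_refl])
      moreover have "\<dots> \<subseteq> (\<Pi>\<^sub>E i\<in>{1..n}. space (axis_measure b i))"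
      proof (rule PiE_mono)
        fix i assume "i \<in> {1..n}"
        then show "T i \<inter> {a i..<x i} \<subseteq> space (axis_measure b i)"
          using xj(3)[of i] by (auto simp: space_axis_measure)
      qed
      ultimately show "y \<in> (\<Pi>\<^sub>E i\<in>{1..n}. space (axis_measure b i))" by blast
    qed
  qed
  have EP: "?E \<inter> (\<Pi>\<^sub>E j\<in>{1..n}. A j) = (\<Pi>\<^sub>E j\<in>{1..n}. A j \<inter> {..<x j})"
    if "\<And>j. j \<in> {1..n} \<Longrightarrow> A j \<in> sets (axis_measure b j)" for A
    using subsetD[OF sets.sets_into_space[OF that]] by (auto simp: space_PiM PiE_iff)
  have "?E = ?E \<inter> (\<Pi>\<^sub>E j\<in>{1..n}. space (axis_measure b j))" by (auto simp: space_PiM)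
  also have "\<dots> = (\<Pi>\<^sub>E j\<in>{1..n}. space (axis_measure b j) \<inter> {..<x j})" by (rule EP) simp
  also have "\<dots> \<in> sets ?B" by (intro sets_PiM_I_finite cut(2)) auto
  finally show E: "?E \<in> sets ?B" .
  show "distr ?X ?B (\<lambda>y. y) = density ?B (indicator ?E)"
  proof (rule measure_eqI_PiM_finite[where I = "{1..n}" and M = "axis_measure b" and A = "\<lambda>_. space ?B"])
    fix A assume A: "\<And>j. j \<in> {1..n} \<Longrightarrow> A j \<in> sets (axis_measure b j)"
    have PA: "(\<Pi>\<^sub>E j\<in>{1..n}. A j) \<in> sets ?B" using A by (intro sets_PiM_I_finite) auto
    have sub: "t \<in> T j" "a j \<le> t" if "j \<in> {1..n}" "t \<in> A j" for j t
      using A[OF that(1)] that(2) unfolding sets_axis[OF that(1)] by auto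
    have "(\<lambda>y. y) -` (\<Pi>\<^sub>E j\<in>{1..n}. A j) \<inter> space ?X = (\<Pi>\<^sub>E j\<in>{1..n}. A j \<inter> {..<x j})"
      using sub unfolding space_PiM_axis[OF order_refl] by (auto simp: PiE_iff)
    then have "emeasure (distr ?X ?B (\<lambda>y. y)) (\<Pi>\<^sub>E j\<in>{1..n}. A j) = emeasure ?X (\<Pi>\<^sub>E j\<in>{1..n}. A j \<inter> {..<x j})"
      by (simp only: emeasure_distr[OF id PA])
    also have "\<dots> = (\<Prod>j\<in>{1..n}. emeasure (axis_measure x j) (A j \<inter> {..<x j}))"
      using cut(1) A by (intro X.emeasure_PiM) auto
    also have "\<dots> = (\<Prod>j\<in>{1..n}. emeasure (axis_measure b j) (A j \<inter> {..<x j}))"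
      using cut(3) A by (intro prod.cong) auto
    also have "\<dots> = emeasure ?B (\<Pi>\<^sub>E j\<in>{1..n}. A j \<inter> {..<x j})"
      using cut(2) A by (intro B.emeasure_PiM[symmetric]) auto
    also have "\<dots> = emeasure ?B (?E \<inter> (\<Pi>\<^sub>E j\<in>{1..n}. A j))" by (simp only: EP[of A, OF A])
    also have "\<dots> = emeasure (density ?B (indicator ?E)) (\<Pi>\<^sub>E j\<in>{1..n}. A j)"
      using PA E by (simp add: emeasure_density flip: indicator_inter_arith)
    finally show "emeasure (distr ?X ?B (\<lambda>y. y)) (\<Pi>\<^sub>E j\<in>{1..n}. A j) = emeasure (density ?B (indicator ?E)) (\<Pi>\<^sub>E j\<in>{1..n}. A j)" .
  next
    have "space ?B = (\<Pi>\<^sub>E j\<in>{1..n}. space (axis_measure b j))" by (simp add: space_PiM)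
    then show "range (\<lambda>_::nat. space ?B) \<subseteq> prod_algebra {1..n} (axis_measure b)"
      by (auto intro!: prod_algebraI_finite)
    show "emeasure (distr ?X ?B (\<lambda>y. y)) (space ?B) \<noteq> \<infinity>" for i :: nat
      using finite_measure.emeasure_finite[OF finite_measure_PiM_axis[OF x order_refl]]
      by (simp add: emeasure_distr[OF id sets.top] del: One_nat_def)
  qed auto
qed

lemma
  fixes G :: "(nat \<Rightarrow> real) \<Rightarrow> real"
  assumes x: "corner x"
  shows AE_axis: "AE y in box_meas n b. P y \<Longrightarrow> AE y in box_meas n x. P y"
    and integrable_axis: "integrable (box_meas n b) G \<Longrightarrow> integrable (box_meas n x) G"
    and integral_axis: "integrable (box_meas n b) G \<Longrightarrow>
      (\<integral>y. G y \<partial>box_meas n x) =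
      (\<integral>y. indicator {y \<in> space (box_meas n b). \<forall>j\<in>{1..n}. y j < x j} y * G y \<partial>box_meas n b)"
proof -
  let ?X = "box_meas n x" and ?B = "box_meas n b"
  let ?E = "{y \<in> space ?B. \<forall>j\<in>{1..n}. y j < x j}"
  note D = distr_axis_measure(1)[OF x] and id = measurable_axis_id[OF x] and E = distr_axis_measure(3)[OF x]
  have D': "distr ?X ?B (\<lambda>y. y) = density ?B (\<lambda>y. ennreal (indicator ?E y))"
    unfolding D by (simp add: ennreal_indicator)
  {
    assume "AE y in ?B. P y"
    then have "AE y in density ?B (\<lambda>y. ennreal (indicator ?E y)). P y"
      using E by (subst AE_density) auto
    then have "AE y in distr ?X ?B (\<lambda>y. y). P y" unfolding D' .
    from AE_distrD[OF id this] show "AE y in ?X. P y" .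
  }
  assume G: "integrable ?B G"
  have [measurable]: "?E \<in> sets ?B" by (rule E)
  have "integrable ?B (\<lambda>y. indicator ?E y *\<^sub>R G y)"
    by (rule integrable_mult_indicator[OF E G])
  then have "integrable (density ?B (\<lambda>y. ennreal (indicator ?E y))) G"
    using E borel_measurable_integrable[OF G] by (subst integrable_density) auto
  then have "integrable (distr ?X ?B (\<lambda>y. y)) G" unfolding D' .
  from integrable_distr[OF id this] show "integrable ?X G" .
  have "(\<integral>y. G y \<partial>?X) = (\<integral>y. G y \<partial>distr ?X ?B (\<lambda>y. y))"
    by (rule integral_distr[OF id borel_measurable_integrable[OF G], symmetric])
  also have "\<dots> = (\<integral>y. indicator ?E y * G y \<partial>?B)"
    unfolding D' using E borel_measurable_integrable[OF G] by (subst integral_density) auto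
  finally show "(\<integral>y. G y \<partial>?X) = (\<integral>y. indicator ?E y * G y \<partial>?B)" .
qed

lemma overwrite_all:
  assumes "x \<in> box" "y \<in> space (box_meas n x)"
  shows "overwrite n y x = y"
  using assms by (auto simp: overwrite_def fun_eq_iff ts_box_def space_PiM PiE_iff extensional_def)

lemma bmeas_mixed_pd:
  assumes "f \<in> C_rd n T a b lam" "\<forall>j\<in>{1..n}. 1 \<le> lam j" "1 \<le> n"
  shows "bmeas (mixed_pd T lam n f)"
proof -
  obtain m where m: "n = Suc m" using assms(3) by (cases n) auto
  show ?thesis using C_rd_bmeas[OF assms(1,2), of m "lam (Suc m)"] assms(2) unfolding m by simp
qed

text \<open>The iterated primitive is linear and monotone, so applying it to the derivative and to
  its negative bounds \<open>|f|\<close> by the primitive of the absolute value. The monomials then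
  come out one variable at a time and leave first-order primitives, that is, a box integral.\<close>

lemma abs_le_H_mono_integral:
  assumes f: "f \<in> C_rd n T a b lam" and lam: "\<forall>j\<in>{1..n}. 1 \<le> lam j" and n: "1 \<le> n"
    and start: "\<forall>j\<in>{1..n}. a j < (bwd_jump (T j) ^^ (lam j - 1)) (b j)"
    and van: "vanishes_at_start n T a b lam f" and x: "x \<in> box"
  shows "integrable (box_meas n x) (\<lambda>y. \<bar>mixed_pd T lam n f y\<bar>)"
    and "\<bar>f x\<bar> \<le> H_mono n T lam b a * (\<integral>y. \<bar>mixed_pd T lam n f y\<bar> \<partial>box_meas n x)"
proof -
  let ?q = "mixed_pd T lam n f" and ?X = "box_meas n x"
  have ab: "a j < b j" if "j \<in> {1..n}" for j
    using start[rule_format, OF that] funpow_bwd_jump(3)[OF closed_T[OF that] b_mem[OF that], of "lam j - 1"] by simp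
  have q: "bmeas ?q" by (rule bmeas_mixed_pd[OF f lam n])
  have aq: "bmeas (\<lambda>z. \<bar>?q z\<bar>)" by (rule bmeas_abs[OF q])
  have z: "bmeas (\<lambda>z. 0)" by (auto simp: bmeas_def)
  note op = slice_op_iter_J[OF order_refl order_refl, of lam]
  have "f x = iter_J lam n ?q x" by (rule iter_J_mixed_pd[OF f lam start van order_refl x])
  moreover have "iter_J lam n ?q x \<le> iter_J lam n (\<lambda>z. \<bar>?q z\<bar>) x"
    by (rule slice_opD(4)[OF op q aq _ x]) simp
  moreover have "- iter_J lam n ?q x \<le> iter_J lam n (\<lambda>z. \<bar>?q z\<bar>) x"
  proof -
    have z0: "iter_J lam n (\<lambda>z. 0) x = 0" using slice_opD(3)[OF op z z x, of 1] by simp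
    have "iter_J lam n (\<lambda>z. 0 + (-1) * ?q z) x \<le> iter_J lam n (\<lambda>z. \<bar>?q z\<bar>) x"
      by (rule slice_opD(4)[OF op bmeas_add_scaled[OF z q] aq _ x]) simp
    then show ?thesis using slice_opD(3)[OF op z q x, of "-1"] z0 by simp
  qed
  ultimately have "\<bar>f x\<bar> \<le> iter_J lam n (\<lambda>z. \<bar>?q z\<bar>) x" by linarith
  also have "\<dots> \<le> H_mono n T lam b a * iter_J (\<lambda>_. 1) n (\<lambda>z. \<bar>?q z\<bar>) x"
    by (rule iter_J_bound[OF lam ab order_refl aq _ x]) auto
  also have "iter_J (\<lambda>_. 1) n (\<lambda>z. \<bar>?q z\<bar>) x = (\<integral>y. \<bar>?q (overwrite n y x)\<bar> \<partial>?X)"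
    by (rule iter_J_1_eq[OF order_refl x aq])
  also have "\<dots> = (\<integral>y. \<bar>?q y\<bar> \<partial>?X)"
    by (rule Bochner_Integration.integral_cong[OF refl]) (simp only: overwrite_all[OF x])
  finally show "\<bar>f x\<bar> \<le> H_mono n T lam b a * (\<integral>y. \<bar>?q y\<bar> \<partial>?X)" .
  have "integrable ?X (\<lambda>y. \<bar>?q (overwrite n y x)\<bar>) \<longleftrightarrow> integrable ?X (\<lambda>y. \<bar>?q y\<bar>)"
    by (rule Bochner_Integration.integrable_cong[OF refl]) (simp only: overwrite_all[OF x])
  then show "integrable ?X (\<lambda>y. \<bar>?q y\<bar>)" using integrable_overwrite[OF x order_refl aq] by simp
qed

text \<open>Jensen's inequality by means of a supporting line of \<open>p\<close> at \<open>|f(x)| / \<psi>(x)\<close>. In this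
  form the mixed derivative of \<open>\<psi>\<close>, whose joint measurability is unclear, only has to be
  integrated one variable at a time.\<close>

lemma jensen_box:
  assumes f: "f \<in> C_rd n T a b lam" and lam: "\<forall>j\<in>{1..n}. 1 \<le> lam j" and n: "1 \<le> n"
    and start: "\<forall>j\<in>{1..n}. a j < (bwd_jump (T j) ^^ (lam j - 1)) (b j)"
    and van: "vanishes_at_start n T a b lam f"
    and ex: "mixed_pd_exists T box (\<lambda>_. 1) n \<psi>"
    and nonneg: "\<And>z. z \<in> box \<Longrightarrow> 0 \<le> mixed_pd T (\<lambda>_. 1) n \<psi> z"
    and van': "vanishes_at_start n T a b lam \<psi>"
    and p: "convex_on {0..} p" "\<And>u. 0 \<le> u \<Longrightarrow> 0 \<le> p u" "mono_on {0..} p"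
    and quot: "AE y in box_meas n b.
      mixed_pd T (\<lambda>_. 1) n \<psi> y = 0 \<longrightarrow> mixed_pd T lam n f y = 0"
    and x: "x \<in> box"
  defines "G \<equiv> \<lambda>y. mixed_pd T (\<lambda>_. 1) n \<psi> y *
    p (H_mono n T lam b a * (\<bar>mixed_pd T lam n f y\<bar> / mixed_pd T (\<lambda>_. 1) n \<psi> y))"
  assumes G: "integrable (box_meas n b) G"
  shows "0 \<le> \<psi> x"
    and "\<psi> x * p (\<bar>f x\<bar> / \<psi> x) \<le> (\<integral>y. G y \<partial>box_meas n x)"
proof -
  let ?X = "box_meas n x" and ?d = "mixed_pd T (\<lambda>_. 1) n \<psi>" and ?q = "mixed_pd T lam n f"
  let ?H = "H_mono n T lam b a"
  have ab: "a j < b j" if "j \<in> {1..n}" for j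
    using start[rule_format, OF that] funpow_bwd_jump(3)[OF closed_T[OF that] b_mem[OF that], of "lam j - 1"] by simp
  have H: "0 \<le> ?H" unfolding H_mono_def using ab by (intro prod_nonneg ballI h_mono_b_nonneg) auto
  have zero: "\<psi> z = 0" if "z \<in> box" "i \<in> {1..n}" "z i = a i" for z i
    using van' that unfolding vanishes_at_start_def by (metis le0 pd_iter.simps(1))
  have X_box: "y \<in> box" if "y \<in> space ?X" for y
    using overwrite_box(1)[OF x order_refl that] overwrite_all[OF x that] by simp
  have key: "A * \<psi> x \<le> (\<integral>y. Q y \<partial>?X)"
    if Q: "integrable ?X Q" and le: "AE y in ?X. A * ?d y \<le> Q y" for A Q
  proof (rule scaled_le_integral[OF x ex zero order_refl Q])
    show "AE y in ?X. A * ?d (overwrite n y x) \<le> Q y"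
      using le AE_space by eventually_elim (simp only: overwrite_all[OF x])
  qed
  \<comment> \<open>The negative factor together with the majorant 0 shows that
    \<open>\<psi>\<close> is non-negative.\<close>
  have "(- 1) * \<psi> x \<le> (\<integral>y. 0 \<partial>?X)"
    using nonneg X_box by (intro key AE_I2) auto
  then show \<psi>0: "0 \<le> \<psi> x" by simp
  have p_arg: "0 \<le> ?H * (\<bar>?q y\<bar> / ?d y)" if "y \<in> box" for y using H nonneg[OF that] by simp
  have G0: "0 \<le> G y" if "y \<in> box" for y
    unfolding G_def using nonneg[OF that] p(2)[OF p_arg[OF that]] by simp
  have GX: "integrable ?X G" by (rule integrable_axis[OF box_corner[OF x] G])
  show "\<psi> x * p (\<bar>f x\<bar> / \<psi> x) \<le> (\<integral>y. G y \<partial>?X)"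
  proof (cases "\<psi> x = 0")
    case True
    then show ?thesis using G0 X_box by (auto intro!: Bochner_Integration.integral_nonneg)
  next
    case False
    then have pos: "0 < \<psi> x" using \<psi>0 by simp
    define z0 where "z0 = \<bar>f x\<bar> / \<psi> x"
    have "0 \<le> z0" using pos by (simp add: z0_def)
    then obtain c where c: "0 \<le> c" "\<And>z. 0 \<le> z \<Longrightarrow> p z0 + c * (z - z0) \<le> p z"
      using convex_mono_support[OF p(1,3)] by blast
    note q = abs_le_H_mono_integral[OF f lam n start van x]
    \<comment> \<open>The supporting line at \<open>z0\<close>, multiplied by the mixed derivative
      of \<open>\<psi>\<close>, with the integrable term in \<open>|?q|\<close> moved to the
      majorant; what remains on the left is a constant times that derivative.\<close>
    define Q where "Q y = G y - c * ?H * \<bar>?q y\<bar>" for y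
    have Q: "integrable ?X Q" unfolding Q_def using GX q(1) by simp
    have "AE y in ?X. (p z0 - c * z0) * ?d y \<le> Q y"
      using AE_axis[OF box_corner[OF x] quot] AE_space
    proof eventually_elim
      fix y assume y0: "?d y = 0 \<longrightarrow> ?q y = 0" and y: "y \<in> space ?X"
      note yb = X_box[OF y]
      \<comment> \<open>Where \<open>?d y = 0\<close> also \<open>G y = 0\<close>, so the inequality
        rests on \<open>?q y = 0\<close>.\<close>
      show "(p z0 - c * z0) * ?d y \<le> Q y"
      proof (cases "?d y = 0")
        case True
        then show ?thesis using y0 by (simp add: Q_def G_def)
      next
        case False
        then have d: "0 < ?d y" using nonneg[OF yb] by simp
        have "?d y * (p z0 + c * (?H * (\<bar>?q y\<bar> / ?d y) - z0)) \<le> G y"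
          unfolding G_def using c(2)[OF p_arg[OF yb]] d by (intro mult_left_mono) auto
        moreover have "?d y * (p z0 + c * (?H * (\<bar>?q y\<bar> / ?d y) - z0)) = (p z0 - c * z0) * ?d y + c * ?H * \<bar>?q y\<bar>"
          using d by (simp add: field_simps)
        ultimately show ?thesis by (simp add: Q_def)
      qed
    qed
    from key[OF Q this] have "(p z0 - c * z0) * \<psi> x \<le> (\<integral>y. G y \<partial>?X) - c * (?H * (\<integral>y. \<bar>?q y\<bar> \<partial>?X))"
      unfolding Q_def using GX q(1) by simp
    moreover have "c * \<bar>f x\<bar> \<le> c * (?H * (\<integral>y. \<bar>?q y\<bar> \<partial>?X))" using q(2) c(1) by (rule mult_left_mono)
    \<comment> \<open>By the choice of \<open>z0\<close> the product
      \<open>c * z0 * \<psi> x\<close> is \<open>c * |f x|\<close>, and the slope drops out.\<close>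
    moreover have "(p z0 - c * z0) * \<psi> x + c * \<bar>f x\<bar> = \<psi> x * p z0"
      using pos by (simp add: z0_def algebra_simps)
    ultimately show ?thesis by (simp add: z0_def)
  qed
qed

end

theorem theorem3p6:
  fixes n :: nat
    and T :: "nat \<Rightarrow> real set"
    and a b :: "nat \<Rightarrow> real"
    and lam :: "nat \<Rightarrow> nat"
    and F :: "real ^ 'm::finite \<Rightarrow> real"
    and p :: "'m \<Rightarrow> real \<Rightarrow> real"
    and phi f :: "'m \<Rightarrow> (nat \<Rightarrow> real) \<Rightarrow> real"
  assumes "1 \<le> n"
    and "\<forall>j\<in>{1..n}. time_scale (T j)"
    and "\<forall>j\<in>{1..n}. 1 \<le> lam j"
    and "\<forall>j\<in>{1..n}. a j \<in> T j \<and> b j \<in> T j"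
    and "\<forall>j\<in>{1..n}. a j < (bwd_jump (T j) ^^ (lam j - 1)) (b j)"
    and "F \<in> H_infty"
    and "\<forall>i. convex_on {0..} (p i) \<and> (\<forall>u\<ge>0. 0 \<le> p i u) \<and> mono_on {0..} (p i)"
    and "\<forall>i. mixed_pd_exists T (ts_box n T a b) (\<lambda>_. 1) n (phi i)"
    and "\<forall>i. \<forall>x\<in>ts_box n T a b. 0 \<le> mixed_pd T (\<lambda>_. 1) n (phi i) x"
    and "\<forall>i. vanishes_at_start n T a b lam (phi i)"
    and "\<forall>i. f i \<in> C_rd n T a b lam"
    and "\<forall>i. vanishes_at_start n T a b lam (f i)"
    and quotients_defined: "\<forall>i. AE x in box_measure n T a b.
      mixed_pd T (\<lambda>_. 1) n (phi i) x = 0 \<longrightarrow> mixed_pd T lam n (f i) x = 0"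
    and integrals_exist: "\<forall>i. integrable (box_measure n T a b)
      (\<lambda>x. mixed_pd T (\<lambda>_. 1) n (phi i) x *
        p i (H_mono n T lam b a * (\<bar>mixed_pd T lam n (f i) x\<bar> / mixed_pd T (\<lambda>_. 1) n (phi i) x)))"
  shows
    "iter_integral T a b n (\<lambda>x. \<Sum>i\<in>UNIV.
        partial i F (\<chi> l. phi l x * p l (\<bar>f l x\<bar> / phi l x)) *
        mixed_pd T (\<lambda>_. 1) n (phi i) x *
        p i (H_mono n T lam b a * (\<bar>mixed_pd T lam n (f i) x\<bar> / mixed_pd T (\<lambda>_. 1) n (phi i) x)))
     \<le> F (\<chi> i. iter_integral T a b n (\<lambda>x.
        mixed_pd T (\<lambda>_. 1) n (phi i) x *
        p i (H_mono n T lam b a * (\<bar>mixed_pd T lam n (f i) x\<bar> / mixed_pd T (\<lambda>_. 1) n (phi i) x))))"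
proof -
  have ab: "a j < b j" if "j \<in> {1..n}" for j
    using assms(5)[rule_format, OF that] funpow_bwd_jump(3)[of "T j" "b j" "lam j - 1"] assms(2,4) that
    by (force simp: time_scale_def)
  interpret time_scale_box n T a b
    by standard (use assms(2,4) ab in \<open>auto simp: time_scale_def intro: less_imp_le\<close>)
  let ?B = "box_meas n b"
  define G where "G i y = mixed_pd T (\<lambda>_. 1) n (phi i) y *
    p i (H_mono n T lam b a * (\<bar>mixed_pd T lam n (f i) y\<bar> / mixed_pd T (\<lambda>_. 1) n (phi i) y))" for i y
  define m where "m t = (\<chi> l. \<integral>y. indicator {..<t} (y 1) * G l y \<partial>?B)" for t
  define Y where "Y x = (\<chi> l. phi l x * p l (\<bar>f l x\<bar> / phi l x))" for x
  have one: "1 \<in> {1..n}" using assms(1) by simp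
  have intG: "integrable ?B (G i)" for i using integrals_exist by (simp add: G_def[abs_def] box_measure_eq)
  have quot: "AE y in ?B. mixed_pd T (\<lambda>_. 1) n (phi i) y = 0 \<longrightarrow> mixed_pd T lam n (f i) y = 0" for i
    using quotients_defined by (simp only: box_measure_eq)
  have p: "convex_on {0..} (p i)" "\<And>u. 0 \<le> u \<Longrightarrow> 0 \<le> p i u" "mono_on {0..} (p i)" for i
    using assms(7) by auto
  have B_box: "y \<in> box" "y 1 < b 1" "a 1 \<le> y 1" if "y \<in> space ?B" for y
  proof -
    have y: "y \<in> (\<Pi>\<^sub>E i\<in>{1..n}. T i \<inter> {a i..<b i})" using that by (simp only: space_PiM_axis[OF order_refl])
    have "(\<Pi>\<^sub>E i\<in>{1..n}. T i \<inter> {a i..<b i}) \<subseteq> box" unfolding ts_box_def by (rule PiE_mono) auto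
    then show "y \<in> box" using y by blast
    show "y 1 < b 1" "a 1 \<le> y 1" using PiE_mem[OF y one] by auto
  qed
  have H: "0 \<le> H_mono n T lam b a"
    unfolding H_mono_def using ab by (intro prod_nonneg ballI h_mono_b_nonneg) auto
  have G0: "0 \<le> G i y" if "y \<in> box" for i y
    unfolding G_def using assms(9) that H by (intro mult_nonneg_nonneg p(2) divide_nonneg_nonneg) auto
  have meas1: "(\<lambda>y. y 1) \<in> borel_measurable ?B"
  proof -
    have "(\<lambda>y. y 1) \<in> measurable ?B (axis_measure b 1)" by (rule measurable_component_singleton[OF one])
    moreover have "(\<lambda>t. t) \<in> borel_measurable (axis_measure b 1)"
      using measurable_delta_on_id[of "b 1" 1] one by (simp add: axis_measure_def measurable_restrict_space2_iff)
    ultimately show ?thesis by (rule measurable_compose)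
  qed
  have Y: "0 \<le> Y x $ l" "Y x $ l \<le> m (x 1) $ l" if x: "x \<in> box" for x l
  proof -
    let ?E = "{y \<in> space ?B. \<forall>j\<in>{1..n}. y j < x j}"
    have ex: "mixed_pd_exists T box (\<lambda>_. 1) n (phi l)" using assms(8) by blast
    have nn: "0 \<le> mixed_pd T (\<lambda>_. 1) n (phi l) z" if "z \<in> box" for z using assms(9) that by blast
    note J = jensen_box[OF spec[OF assms(11), of l] assms(3,1,5) spec[OF assms(12), of l] ex nn
        spec[OF assms(10), of l] p(1)[of l] p(2)[of _ l] p(3)[of l] quot[of l] x intG[of l, unfolded G_def[abs_def]]]
    show "0 \<le> Y x $ l" using J(1) p(2)[of "\<bar>f l x\<bar> / phi l x" l] by (simp add: Y_def)
    have "Y x $ l \<le> (\<integral>y. G l y \<partial>box_meas n x)"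
      using J(2) by (simp add: Y_def G_def)
    also have "\<dots> = (\<integral>y. indicator ?E y * G l y \<partial>?B)"
      by (rule integral_axis[OF box_corner[OF x] intG])
    \<comment> \<open>All constraints except the one on the first coordinate are dropped, at the
      cost of adding the non-negative \<open>G l\<close> on a larger set.\<close>
    also have "\<dots> \<le> (\<integral>y. indicator {..<x 1} (y 1) * G l y \<partial>?B)"
    proof (rule integral_mono')
      show "integrable ?B (\<lambda>y. indicator {..<x 1} (y 1) * G l y)"
        by (intro Bochner_Integration.integrable_bound[OF intG[of l]])
          (use meas1 borel_measurable_integrable[OF intG[of l]] in \<open>auto simp: indicator_def\<close>)
      fix y assume "y \<in> space ?B"
      then show "indicator ?E y * G l y \<le> indicator {..<x 1} (y 1) * G l y" "0 \<le> indicator {..<x 1} (y 1) * G l y"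
        using one G0[OF B_box(1)] by (auto simp: indicator_def)
    qed
    finally show "Y x $ l \<le> m (x 1) $ l" by (simp add: m_def)
  qed
  define u where "u x = (\<Sum>i\<in>UNIV. partial i F (Y x) * G i x)" for x
  define v where "v x = (\<Sum>i\<in>UNIV. partial i F (m (x 1)) * G i x)" for x
  note L = integral_partial_le[where \<alpha> = "a 1" and \<beta> = "b 1", OF assms(6) intG _ meas1]
  \<comment> \<open>Measurability of \<open>Y\<close>, and hence of \<open>u\<close>, has not been
    established; its iterated integral is compared directly with the integral of \<open>v\<close>,
    which is integrable.\<close>
  have "iter_integral T a b n u \<le> (\<integral>y. v y \<partial>?B)"
  proof (rule iter_integral_le[OF order_refl])
    show "integrable ?B v" unfolding v_def m_def by (rule L(1)) (use G0 B_box ab[OF one] in auto)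
    show "0 \<le> u y" if "y \<in> space ?B" for y
      unfolding u_def using Y G0 B_box(1)[OF that] by (intro sum_nonneg mult_nonneg_nonneg partial_nonneg[OF assms(6)]) auto
    show "AE y in ?B. u y \<le> v y"
    proof (rule AE_I2)
      fix y assume "y \<in> space ?B"
      note y = B_box(1)[OF this]
      show "u y \<le> v y"
        unfolding u_def v_def by (intro sum_mono mult_right_mono partial_mono[OF assms(6)] Y[OF y] G0[OF y])
    qed
  qed
  also have "\<dots> \<le> F (\<chi> i. \<integral>y. G i y \<partial>?B)"
    unfolding v_def m_def by (rule L(2)) (use G0 B_box ab[OF one] in auto)
  also have "\<dots> = F (\<chi> i. iter_integral T a b n (G i))"
    using iter_integral_eq[OF order_refl intG] by simp
  finally show ?thesis by (simp only: u_def[abs_def] Y_def G_def[abs_def] mult.assoc)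
qed

end
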